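(* Let $R/I_{\mathcal{A}}$ be a $3$-dimensional simplicial toric ring, with all notation as in the context. Let $\mathbf{x}^\beta=v\,x_{n-1}^b\in C$ (with $v\in\mathcal{B}_0$, $b\ge2$). (1) If $\mathbf{x}^\beta\in C_1$, then $$v x_{n-1}^b\in\mathcal{B}_1\iff v x_{n-1}^{b-1}\notin I_{\mathcal{A}}+\langle x_{n-2}\rangle.$$ (2) If $\mathbf{x}^\beta\in C_2$, denote by $w x_n^c$ (with $w\in\mathcal{B}_0$, $c\ge1$) the remainder of the division of $\mathbf{x}^\beta$ by $\mathcal{G}$. Then $$v x_{n-1}^b\in\mathcal{B}_1\iff v x_{n-1}^{b-1}\notin I_{\mathcal{A}}+\langle x_{n-2}\rangle\ \text{ or }\ w x_n^{c-1}\notin I_{\mathcal{A}}+\langle x_{n-2}\rangle.$$ Therefore, $$\mathcal{B}_1=(\mathcal{B}_1'\setminus C)\cup\{v x_{n-1}^b\in C_1\mid v x_{n-1}^{b-1}\notin I_{\mathcal{A}}+\langle x_{n-2}\rangle\}\cup\{v x_{n-1}^b\in C_2\mid v x_{n-1}^{b-1}\notin I_{\mathcal{A}}+\langle x_{n-2}\rangle\text{ or }w x_n^{c-1}\notin I_{\mathcal{A}}+\langle x_{n-2}\rangle\},$$ where in the last set $w x_n^c$ denotes the remainder of $v x_{n-1}^b$ by $\mathcal{G}$.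
   Context: Let $\Bbbk$ be an arbitrary field, $\mathcal{A}=\{\mathbf{a}_1,\ldots,\mathbf{a}_n\}\subset\mathbb{N}^3$ a finite set of nonzero vectors and $\mathcal{S}$ the affine monoid it spans. Assume $\mathcal{S}$ is simplicial, i.e. the rational cone spanned by $\mathcal{A}$ has dimension $3$ and is generated by $3$ rays, and that these extremal rays are spanned by the last three generators $\mathbf{a}_{n-2},\mathbf{a}_{n-1},\mathbf{a}_n$. Let $R=\Bbbk[x_1,\ldots,x_n]$, $A=\Bbbk[x_{n-2},x_{n-1},x_n]$, and let $I=I_{\mathcal{A}}\subset R$ be the toric ideal (kernel of $x_i\mapsto\mathbf{t}^{\mathbf{a}_i}$). For a monomial, $|\mathbf{x}^\alpha|_{\mathcal{S}}=\sum_i\alpha_i\mathbf{a}_i\in\mathcal{S}$ is its $\mathcal{S}$-degree; $I$ is homogeneous for the $\mathcal{S}$-grading, and $R/I$ is a finitely generated $\mathcal{S}$-graded $A$-module ($A$ is a Noether normalization of $R/I$). Let $\omega=(\omega_1,\ldots,\omega_n)$ with $\omega_i=|\mathbf{a}_i|$ the sum of the entries of $\mathbf{a}_i$, and let $>_\omega$ be the $\omega$-graded reverse lexicographic order: $\mathbf{x}^\alpha>_\omega\mathbf{x}^\beta$ iff $\sum\omega_i\alpha_i>\sum\omega_i\beta_i$, or these are equal and the last nonzero entry of $\alpha-\beta$ is negative. $\mathrm{in}(\cdot)$ is taken with respect to $>_\omega$ and $\mathcal{G}$ is the reduced Gröbner basis of $I$ for $>_\omega$. It consists of binomials, and the remainder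 of a monomial by $\mathcal{G}$ is a monomial. $\mathcal{B}_0$ is the set of monomials of $R$ not in $\mathrm{in}(I)+\langle x_{n-2},x_{n-1},x_n\rangle$. $J\subset R$ is the ideal generated by $\chi(\mathrm{in}(I))$, where $\chi:R\to R$ is the $\Bbbk$-algebra morphism fixing $x_1,\ldots,x_{n-3}$ and sending $x_{n-2},x_{n-1},x_n$ to $1$. For $u\in\mathcal{B}_0\cap J$, $I_u=(\mathrm{in}(I):u)\cap A$ and $G(I_u)=\{M_{(u,1)},\ldots,M_{(u,\ell_u)}\}$ is its minimal monomial generating set (monomials in $x_{n-2},x_{n-1}$ only). Set $$\mathcal{B}_1'=\{u\,M_{(u,i)}\mid u\in\mathcal{B}_0\cap J,\ 1\le i\le\ell_u\}.$$ $\mathcal{B}_1\subset\mathcal{B}_1'$ is the subset giving the actual shifts in the first step of the short resolution of $R/I$: i.e. $\mathcal{B}_1$ is such that the multiset $\{|\mathbf{x}^\alpha|_{\mathcal{S}}\mid\mathbf{x}^\alpha\in\mathcal{B}_1\}$ equals the multiset of shifts of the free module in homological degree $1$ of the minimal $\mathcal{S}$-graded free resolution of $R/I$ as an $A$-module. $C=\{v\,x_{n-1}^b\in\mathcal{B}_1'\mid v\in\mathcal{B}_0,\ b\ge2\}$. For $\mathbf{x}^\beta\in C$, let $r_\beta$ be the remainder of $\mathbf{x}^\beta$ by $\mathcal{G}$ (it is a multiple of $x_n$). Then $C=C_1\sqcup C_2$ with $$C_1=\{\mathbf{x}^\beta\in C\mid r_\beta=w x_{n-2}^a x_n^c\text{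 for some }a,c\ge1,\ w\in\mathcal{B}_0\},\qquad C_2=\{\mathbf{x}^\beta\in C\mid r_\beta=w x_n^c\text{ for some }c\ge1,\ w\in\mathcal{B}_0\}.$$ *)

theory Defs
  imports
    "HOL-Analysis.Analysis"
    "HOL-Algebra.Ideal"
    "HOL-Library.Poly_Mapping"
    "HOL-Library.Multiset"
begin

section \<open>Polynomial rings and monomials\<close>

text \<open>
  A monomial is represented by its exponent vector, so the product of monomials is the sum of
  exponent vectors and \<open>0\<close> is the monomial \<open>1\<close>.  The variables are \<open>x\<^sub>1, x\<^sub>2, \<dots>\<close>; the ring
  \<open>\<Bbbk>[x\<^sub>i | i \<in> V]\<close> is cut out as a carrier, so that the number \<open>n\<close> of variables is an ordinary
  natural number.
\<close>

type_synonym expo = "nat \<Rightarrow>\<^sub>0 nat"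
type_synonym 'k mpol = "expo \<Rightarrow>\<^sub>0 'k"

definition monomials :: "nat set \<Rightarrow> expo set" where
  "monomials V = {\<alpha>. Poly_Mapping.keys \<alpha> \<subseteq> V}"

definition xpow :: "expo \<Rightarrow> 'k::field mpol" where
  "xpow \<alpha> = Poly_Mapping.single \<alpha> 1"

text \<open>The monomial \<open>x\<^sub>i\<^sup>b\<close>, as an exponent vector.\<close>

definition pw :: "nat \<Rightarrow> nat \<Rightarrow> expo" where
  "pw i b = Poly_Mapping.single i b"

definition var :: "nat \<Rightarrow> 'k::field mpol" where
  "var i = xpow (pw i 1)"

definition poly_ring :: "nat set \<Rightarrow> 'k::field mpol ring" where
  "poly_ring V =
     \<lparr>carrier = {p. Poly_Mapping.keys p \<subseteq> monomials V}, mult = (*), one = 1, zero = 0, add = (+)\<rparr>"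

abbreviation Rr :: "nat \<Rightarrow> 'k::field mpol ring" where
  "Rr n \<equiv> poly_ring {1..n}"

abbreviation Ar :: "nat \<Rightarrow> 'k::field mpol ring" where
  "Ar n \<equiv> poly_ring {n-2..n}"

text \<open>The \<open>\<Bbbk>\<close>-algebra morphism \<open>x\<^sub>i \<mapsto> g i\<close> into a monoid algebra over \<open>\<Bbbk>\<close>.\<close>

definition alg_hom ::
  "(nat \<Rightarrow> ('m::comm_monoid_add \<Rightarrow>\<^sub>0 'k::field)) \<Rightarrow> 'k mpol \<Rightarrow> ('m \<Rightarrow>\<^sub>0 'k)" where
  "alg_hom g p =
     (\<Sum>\<alpha>\<in>Poly_Mapping.keys p. Poly_Mapping.single 0 (Poly_Mapping.lookup p \<alpha>) *
        (\<Prod>i\<in>Poly_Mapping.keys \<alpha>. g i ^ Poly_Mapping.lookup \<alpha> i))"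


section \<open>Simplicial affine monoids and toric ideals\<close>

definition sdeg :: "(nat \<Rightarrow> nat^3) \<Rightarrow> expo \<Rightarrow> nat^3" where
  "sdeg a \<alpha> = (\<Sum>i\<in>Poly_Mapping.keys \<alpha>. Poly_Mapping.lookup \<alpha> i *s a i)"

definition aff_monoid :: "nat \<Rightarrow> (nat \<Rightarrow> nat^3) \<Rightarrow> (nat^3) set" where
  "aff_monoid n a = {(\<Sum>i\<in>{1..n}. m i *s a i) | m. True}"

definition to_rat :: "nat^3 \<Rightarrow> rat^3" where
  "to_rat v = (\<chi> i. of_nat (v $ i))"

text \<open>Rational cone spanned by a finite set.\<close>

definition rat_cone :: "(rat^3) set \<Rightarrow> (rat^3) set" where
  "rat_cone V = {(\<Sum>v\<in>V. c v *s v) | c. \<forall>v\<in>V. 0 \<le> c v}"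

definition extremal_rays :: "(rat^3) set \<Rightarrow> (rat^3) set set" where
  "extremal_rays K = {rat_cone {v} | v. v \<in> K \<and> v \<noteq> 0 \<and>
     (\<forall>x\<in>K. \<forall>y\<in>K. x + y \<in> rat_cone {v} \<longrightarrow> x \<in> rat_cone {v} \<and> y \<in> rat_cone {v})}"

definition simplicial_cone :: "(rat^3) set \<Rightarrow> bool" where
  "simplicial_cone K \<longleftrightarrow>
     vec.dim K = 3 \<and> (\<exists>T. card T = 3 \<and> 0 \<notin> T \<and> K = rat_cone T)"

definition simplicial_generators :: "nat \<Rightarrow> (nat \<Rightarrow> nat^3) \<Rightarrow> bool" where
  "simplicial_generators n a \<longleftrightarrow>
     3 \<le> n \<and> inj_on a {1..n} \<and> (\<forall>i\<in>{1..n}. a i \<noteq> 0) \<and>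
     (let K = rat_cone (to_rat ` a ` {1..n}) in
        simplicial_cone K \<and>
        extremal_rays K =
          {rat_cone {to_rat (a (n-2))}, rat_cone {to_rat (a (n-1))}, rat_cone {to_rat (a n)}})"

definition toric_ideal :: "nat \<Rightarrow> (nat \<Rightarrow> nat^3) \<Rightarrow> 'k::field mpol set" where
  "toric_ideal n a =
     {p \<in> carrier (Rr n). alg_hom (\<lambda>i. Poly_Mapping.single (a i) (1::'k)) p = 0}"

definition weights :: "(nat \<Rightarrow> nat^3) \<Rightarrow> nat \<Rightarrow> nat" where
  "weights a i = (\<Sum>k\<in>UNIV. a i $ k)"


section \<open>The weighted reverse lexicographic order and Groebner bases\<close>

definition wdeg :: "(nat \<Rightarrow> nat) \<Rightarrow> expo \<Rightarrow> nat" where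
  "wdeg \<omega> \<alpha> = (\<Sum>i\<in>Poly_Mapping.keys \<alpha>. \<omega> i * Poly_Mapping.lookup \<alpha> i)"

definition mon_gt :: "(nat \<Rightarrow> nat) \<Rightarrow> expo \<Rightarrow> expo \<Rightarrow> bool" where
  "mon_gt \<omega> \<alpha> \<beta> \<longleftrightarrow>
     wdeg \<omega> \<alpha> > wdeg \<omega> \<beta> \<or>
     (wdeg \<omega> \<alpha> = wdeg \<omega> \<beta> \<and>
      (\<exists>k. Poly_Mapping.lookup \<alpha> k < Poly_Mapping.lookup \<beta> k \<and> (\<forall>j>k. Poly_Mapping.lookup \<alpha> j = Poly_Mapping.lookup \<beta> j)))"

text \<open>Exponent of the leading monomial; only meaningful for nonzero polynomials.\<close>

definition lead :: "(nat \<Rightarrow> nat) \<Rightarrow> 'k::field mpol \<Rightarrow> expo" where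
  "lead \<omega> p = (THE \<alpha>. \<alpha> \<in> Poly_Mapping.keys p \<and> (\<forall>\<beta>\<in>Poly_Mapping.keys p. \<beta> \<noteq> \<alpha> \<longrightarrow> mon_gt \<omega> \<alpha> \<beta>))"

definition initial_ideal :: "nat \<Rightarrow> (nat \<Rightarrow> nat) \<Rightarrow> 'k::field mpol set \<Rightarrow> 'k mpol set" where
  "initial_ideal n \<omega> F = Idl\<^bsub>Rr n\<^esub> {xpow (lead \<omega> f) | f. f \<in> F \<and> f \<noteq> 0}"

definition is_reduced_gb ::
  "nat \<Rightarrow> (nat \<Rightarrow> nat) \<Rightarrow> 'k::field mpol set \<Rightarrow> 'k mpol set \<Rightarrow> bool" where
  "is_reduced_gb n \<omega> I G \<longleftrightarrow>
     finite G \<and> G \<subseteq> I \<and> initial_ideal n \<omega> G = initial_ideal n \<omega> I \<and>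
     (\<forall>g\<in>G. g \<noteq> 0 \<and> Poly_Mapping.lookup g (lead \<omega> g) = 1 \<and>
        (\<forall>\<alpha>\<in>Poly_Mapping.keys g. xpow \<alpha> \<notin> initial_ideal n \<omega> (G - {g})))"

text \<open>
  \<open>r\<close> is a remainder of the division of \<open>f\<close> by \<open>G\<close>: \<open>f = \<Sum>\<^sub>g q\<^sub>g g + r\<close>, where no monomial of \<open>q\<^sub>g g\<close>
  exceeds the leading monomial of \<open>f\<close> and no monomial of \<open>r\<close> is divisible by the leading
  monomial of an element of \<open>G\<close>.  For a Groebner basis \<open>G\<close> it is unique.
\<close>

definition is_remainder ::
  "nat \<Rightarrow> (nat \<Rightarrow> nat) \<Rightarrow> 'k::field mpol set \<Rightarrow> 'k mpol \<Rightarrow> 'k mpol \<Rightarrow> bool" where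
  "is_remainder n \<omega> G f r \<longleftrightarrow>
     r \<in> carrier (Rr n) \<and>
     (\<exists>q. (\<forall>g\<in>G. q g \<in> carrier (Rr n) \<and>
                 (\<forall>\<mu>\<in>Poly_Mapping.keys (q g * g). \<exists>\<nu>\<in>Poly_Mapping.keys f. \<mu> = \<nu> \<or> mon_gt \<omega> \<nu> \<mu>)) \<and>
          f = (\<Sum>g\<in>G. q g * g) + r) \<and>
     (\<forall>\<mu>\<in>Poly_Mapping.keys r. \<forall>g\<in>G. \<not> (\<exists>\<gamma>. \<mu> = lead \<omega> g + \<gamma>))"


section \<open>The sets of monomials \<open>B\<^sub>0\<close>, \<open>B\<^sub>1'\<close>, \<open>C\<close>, \<open>C\<^sub>1\<close>, \<open>C\<^sub>2\<close>\<close>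

definition B0 :: "nat \<Rightarrow> (nat \<Rightarrow> nat) \<Rightarrow> 'k::field mpol set \<Rightarrow> expo set" where
  "B0 n \<omega> I = {\<alpha> \<in> monomials {1..n}.
     xpow \<alpha> \<notin> initial_ideal n \<omega> I <+>\<^bsub>Rr n\<^esub> Idl\<^bsub>Rr n\<^esub> {var (n-2), var (n-1), var n}}"

definition chi :: "nat \<Rightarrow> 'k::field mpol \<Rightarrow> 'k mpol" where
  "chi n = alg_hom (\<lambda>i. if i \<in> {n-2..n} then 1 else var i)"

definition J_ideal :: "nat \<Rightarrow> (nat \<Rightarrow> nat) \<Rightarrow> 'k::field mpol set \<Rightarrow> 'k mpol set" where
  "J_ideal n \<omega> I = Idl\<^bsub>Rr n\<^esub> (chi n ` initial_ideal n \<omega> I)"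

text \<open>\<open>I\<^sub>u = (in(I) : u) \<inter> A\<close>\<close>

definition colon_A :: "nat \<Rightarrow> (nat \<Rightarrow> nat) \<Rightarrow> 'k::field mpol set \<Rightarrow> expo \<Rightarrow> 'k mpol set" where
  "colon_A n \<omega> I u = {p \<in> carrier (Rr n). p * xpow u \<in> initial_ideal n \<omega> I} \<inter> carrier (Ar n)"

definition is_min_mon_gens :: "nat \<Rightarrow> 'k::field mpol set \<Rightarrow> expo set \<Rightarrow> bool" where
  "is_min_mon_gens n K M \<longleftrightarrow>
     M \<subseteq> monomials {n-2..n} \<and> Idl\<^bsub>Ar n\<^esub> (xpow ` M) = K \<and>
     (\<forall>M'. M' \<subset> M \<longrightarrow> Idl\<^bsub>Ar n\<^esub> (xpow ` M') \<noteq> K)"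

text \<open>The minimal monomial generating set of a monomial ideal is unique.\<close>

definition B1' :: "nat \<Rightarrow> (nat \<Rightarrow> nat) \<Rightarrow> 'k::field mpol set \<Rightarrow> expo set" where
  "B1' n \<omega> I = {u + m | u m. u \<in> B0 n \<omega> I \<and> xpow u \<in> J_ideal n \<omega> I \<and>
     (\<exists>M. is_min_mon_gens n (colon_A n \<omega> I u) M \<and> m \<in> M)}"

definition setC :: "nat \<Rightarrow> (nat \<Rightarrow> nat) \<Rightarrow> 'k::field mpol set \<Rightarrow> expo set" where
  "setC n \<omega> I = {v + pw (n-1) b | v b. v \<in> B0 n \<omega> I \<and> 2 \<le> b \<and> v + pw (n-1) b \<in> B1' n \<omega> I}"

definition setC1 ::
  "nat \<Rightarrow> (nat \<Rightarrow> nat) \<Rightarrow> 'k::field mpol set \<Rightarrow> 'k mpol set \<Rightarrow> expo set" where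
  "setC1 n \<omega> I G = {\<beta> \<in> setC n \<omega> I. \<exists>a\<ge>1. \<exists>c\<ge>1. \<exists>w\<in>B0 n \<omega> I.
     is_remainder n \<omega> G (xpow \<beta>) (xpow (w + pw (n-2) a + pw n c))}"

definition setC2 ::
  "nat \<Rightarrow> (nat \<Rightarrow> nat) \<Rightarrow> 'k::field mpol set \<Rightarrow> 'k mpol set \<Rightarrow> expo set" where
  "setC2 n \<omega> I G = {\<beta> \<in> setC n \<omega> I. \<exists>c\<ge>1. \<exists>w\<in>B0 n \<omega> I.
     is_remainder n \<omega> G (xpow \<beta>) (xpow (w + pw n c))}"


section \<open>The short resolution\<close>

text \<open>
  Graded free resolutions \<open>\<dots> \<rightarrow> F\<^sub>2 \<rightarrow> F\<^sub>1 \<rightarrow> F\<^sub>0 \<rightarrow> R/I \<rightarrow> 0\<close> over \<open>A\<close>, with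
  \<open>F\<^sub>i = \<Oplus>\<^sub>j A(-sh i ! j)\<close>.  Elements of \<open>F\<^sub>i\<close> are coordinate functions \<open>f\<close> of which only the values
  at \<open>j < length (sh i)\<close> matter.  The map \<open>F\<^sub>i\<^sub>+\<^sub>1 \<rightarrow> F\<^sub>i\<close> is given by the matrix \<open>D i\<close>, and the
  augmentation sends the \<open>j\<close>-th basis element of \<open>F\<^sub>0\<close> to the class of the homogeneous
  polynomial \<open>g j\<close> of \<open>R\<close>.
\<close>

definition free_mod :: "nat \<Rightarrow> nat \<Rightarrow> (nat \<Rightarrow> 'k::field mpol) set" where
  "free_mod n r = {f. \<forall>j<r. f j \<in> carrier (Ar n)}"

definition mat_app ::
  "nat \<Rightarrow> (nat \<Rightarrow> nat \<Rightarrow> 'k::field mpol) \<Rightarrow> (nat \<Rightarrow> 'k mpol) \<Rightarrow> nat \<Rightarrow> 'k mpol" where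
  "mat_app r M f k = (\<Sum>j<r. M k j * f j)"

definition is_graded_free_resolution ::
  "nat \<Rightarrow> (nat \<Rightarrow> nat^3) \<Rightarrow> 'k::field mpol set \<Rightarrow> (nat \<Rightarrow> (nat^3) list) \<Rightarrow>
   (nat \<Rightarrow> 'k mpol) \<Rightarrow> (nat \<Rightarrow> nat \<Rightarrow> nat \<Rightarrow> 'k mpol) \<Rightarrow> bool" where
  "is_graded_free_resolution n a I sh g D \<longleftrightarrow>
     \<comment> \<open>all maps are graded of degree \<open>0\<close>\<close>
     (\<forall>i. set (sh i) \<subseteq> aff_monoid n a) \<and>
     (\<forall>j<length (sh 0). g j \<in> carrier (Rr n) \<and> (\<forall>\<alpha>\<in>Poly_Mapping.keys (g j). sdeg a \<alpha> = sh 0 ! j)) \<and>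
     (\<forall>i. \<forall>k<length (sh i). \<forall>j<length (sh (Suc i)).
        D i k j \<in> carrier (Ar n) \<and>
        (\<forall>\<alpha>\<in>Poly_Mapping.keys (D i k j). sdeg a \<alpha> + sh i ! k = sh (Suc i) ! j)) \<and>
     \<comment> \<open>exactness at \<open>R/I\<close>, at \<open>F\<^sub>0\<close>, and at \<open>F\<^sub>i\<^sub>+\<^sub>1\<close>\<close>
     (\<forall>p\<in>carrier (Rr n). \<exists>f\<in>free_mod n (length (sh 0)).
        p - (\<Sum>j<length (sh 0). f j * g j) \<in> I) \<and>
     (\<forall>f\<in>free_mod n (length (sh 0)).
        (\<Sum>j<length (sh 0). f j * g j) \<in> I \<longleftrightarrow>
        (\<exists>h\<in>free_mod n (length (sh 1)).
           \<forall>k<length (sh 0). f k = mat_app (length (sh 1)) (D 0) h k)) \<and>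
     (\<forall>i. \<forall>f\<in>free_mod n (length (sh (Suc i))).
        (\<forall>k<length (sh i). mat_app (length (sh (Suc i))) (D i) f k = 0) \<longleftrightarrow>
        (\<exists>h\<in>free_mod n (length (sh (Suc (Suc i)))).
           \<forall>k<length (sh (Suc i)).
             f k = mat_app (length (sh (Suc (Suc i)))) (D (Suc i)) h k))"

text \<open>Minimality: each differential maps \<open>F\<^sub>i\<^sub>+\<^sub>1\<close> into \<open>\<langle>x\<^sub>n\<^sub>-\<^sub>2, x\<^sub>n\<^sub>-\<^sub>1, x\<^sub>n\<rangle> F\<^sub>i\<close>.\<close>

definition is_minimal_graded_free_resolution ::
  "nat \<Rightarrow> (nat \<Rightarrow> nat^3) \<Rightarrow> 'k::field mpol set \<Rightarrow> (nat \<Rightarrow> (nat^3) list) \<Rightarrow>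
   (nat \<Rightarrow> 'k mpol) \<Rightarrow> (nat \<Rightarrow> nat \<Rightarrow> nat \<Rightarrow> 'k mpol) \<Rightarrow> bool" where
  "is_minimal_graded_free_resolution n a I sh g D \<longleftrightarrow>
     is_graded_free_resolution n a I sh g D \<and>
     (\<forall>i. \<forall>k<length (sh i). \<forall>j<length (sh (Suc i)).
        D i k j \<in> Idl\<^bsub>Ar n\<^esub> {var (n-2), var (n-1), var n})"

text \<open>
  \<open>B \<subseteq> B\<^sub>1'\<close> gives the shifts in homological degree \<open>1\<close>.  Finiteness is spelled out because
  \<open>mset_set\<close> of an infinite set is empty.
\<close>

definition is_B1 ::
  "nat \<Rightarrow> (nat \<Rightarrow> nat^3) \<Rightarrow> (nat \<Rightarrow> nat) \<Rightarrow> 'k::field mpol set \<Rightarrow> expo set \<Rightarrow> bool" where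
  "is_B1 n a \<omega> I B \<longleftrightarrow>
     B \<subseteq> B1' n \<omega> I \<and> finite B \<and>
     (\<exists>sh g D. is_minimal_graded_free_resolution n a I sh g D \<and>
        image_mset (sdeg a) (mset_set B) = mset (sh 1))"

end

theory Submission
  imports Defs
begin

text \<open>
  Write \<open>x, y, z\<close> for the last three variables and let \<open>\<Delta>\<^sub>s\<close> be the complex of those
  \<open>F \<subseteq> {x, y, z}\<close> for which some monomial of \<open>\<S>\<close>-degree \<open>s\<close> is divisible by every variable in
  \<open>F\<close>.  As \<open>R/I\<close> has dimension at most one in each degree, the number of shifts equal to \<open>s\<close> in
  homological degree \<open>1\<close> is the number of connected components of \<open>\<Delta>\<^sub>s\<close> minus one; the bounds
  needed here are obtained directly on the resolution, with linear functionals vanishing on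
  \<open>\<langle>x, y, z\<rangle> ker(F\<^sub>0 \<rightarrow> R/I)\<close>.  On the other hand, if \<open>u M \<in> B\<^sub>1'\<close> has degree \<open>s\<close>, then dividing it by any variable
  occurring in \<open>M\<close> gives a standard monomial; the reverse lexicographic order makes standard
  monomials maximal in \<open>z\<close>, then in \<open>y\<close>, within their degree, which decides almost all edges of
  \<open>\<Delta>\<^sub>s\<close>: an element of \<open>B\<^sub>1'\<close> of degree \<open>s\<close> belongs to \<open>B\<^sub>1\<close> unless both \<open>{x, y}\<close> and \<open>{x, z}\<close> are
  edges.  For elements of \<open>C\<close> these two edges are the conditions
  \<open>v y\<^sup>b\<^sup>-\<^sup>1 \<in> I + \<langle>x\<rangle>\<close> and \<open>w z\<^sup>c\<^sup>-\<^sup>1 \<in> I + \<langle>x\<rangle>\<close>.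
\<close>

text \<open>The number of shifts equal to \<open>s\<close> is never computed. As a degree contains
  at most two elements of \<open>B1'\<close>, three statements suffice: no shift if one vertex is
  joined to both others; at least one if some vertex is isolated and another vertex exists; at least
  two if all three vertices exist and are isolated. The lower bounds use the indicator functions of
  one-vertex components, so nothing depends on the field; the vanishing statement is Nakayama's
  lemma written out on the matrices of the resolution. The criterion singles out x for the following
  reason. Let m be the part in x, y, z of an element of \<open>B1'\<close>. Then z does not divide
  m, and a variable dividing m is never joined to z. If y divides m, then y and z are both vertices
  and {y, z} is not an edge, so the complex is connected exactly when {x, y} and {x, z} are edges.
  If m is a power of x, then x is isolated. If m = y, then {x, y} is not an edge. What remains open
  is whether both edges occur for the powers of y with exponent at least 2, which is the set
  C.\<close>

abbreviation keys where "keys \<equiv> Poly_Mapping.keys"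
abbreviation lookup where "lookup \<equiv> Poly_Mapping.lookup"
abbreviation single where "single \<equiv> Poly_Mapping.single"

section \<open>Linear functionals on monoid algebras\<close>

text \<open>The linear functional with value \<open>\<phi> m\<close> on the basis element m.
  Coefficients, the components of the toric map and the functionals detecting shifts are all
  instances, so linearity and the behaviour on products are proved once.\<close>

definition pairing :: "('a \<Rightarrow> 'b) \<Rightarrow> ('a \<Rightarrow>\<^sub>0 'b::comm_ring_1) \<Rightarrow> 'b" where
  "pairing \<phi> p = (\<Sum>m\<in>keys p. lookup p m * \<phi> m)"

lemma pairing_superset:
  assumes "finite S" "keys p \<subseteq> S"
  shows "pairing \<phi> p = (\<Sum>m\<in>S. lookup p m * \<phi> m)"
  unfolding pairing_def using assms
  by (intro sum.mono_neutral_left) (auto simp: in_keys_iff)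

lemma pairing_zero [simp]: "pairing \<phi> 0 = 0"
  by (simp add: pairing_def)

lemma pairing_single [simp]: "pairing \<phi> (single m c) = c * \<phi> m"
  by (simp add: pairing_def)

lemma pairing_add: "pairing \<phi> (p + q) = pairing \<phi> p + pairing \<phi> q"
proof -
  let ?S = "keys p \<union> keys q"
  have "pairing \<phi> (p + q) = (\<Sum>m\<in>?S. lookup (p + q) m * \<phi> m)"
    by (intro pairing_superset) (auto simp: keys_add)
  also have "\<dots> = (\<Sum>m\<in>?S. lookup p m * \<phi> m) + (\<Sum>m\<in>?S. lookup q m * \<phi> m)"
    by (simp add: lookup_add sum.distrib distrib_right)
  also have "\<dots> = pairing \<phi> p + pairing \<phi> q"
    using pairing_superset[of ?S p \<phi>] pairing_superset[of ?S q \<phi>] by simp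
  finally show ?thesis .
qed

lemma pairing_uminus: "pairing \<phi> (- p) = - pairing \<phi> p"
  using pairing_add[of \<phi> p "- p"] by (simp add: add_eq_0_iff)

lemma pairing_diff: "pairing \<phi> (p - q) = pairing \<phi> p - pairing \<phi> q"
  using pairing_add[of \<phi> p "- q"] by (simp add: pairing_uminus)

lemma pairing_sum: "pairing \<phi> (sum f S) = (\<Sum>i\<in>S. pairing \<phi> (f i))"
  by (induction S rule: infinite_finite_induct) (auto simp: pairing_add)

lemma pairing_cong:
  assumes "\<And>m. m \<in> keys p \<Longrightarrow> \<phi> m = \<phi>' m"
  shows "pairing \<phi> p = pairing \<phi>' p"
  unfolding pairing_def using assms by simp

lemma pairing_cmul: "pairing (\<lambda>m. c * \<phi> m) p = c * pairing \<phi> p"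
  unfolding pairing_def sum_distrib_left by (simp add: mult.left_commute)

lemma pairing_eq_0:
  assumes "\<And>m. m \<in> keys p \<Longrightarrow> \<phi> m = 0"
  shows "pairing \<phi> p = 0"
  unfolding pairing_def using assms by simp

lemma sum_singles: "(\<Sum>m\<in>keys p. single m (lookup p m)) = p"
proof (rule poly_mapping_eqI)
  fix k
  show "lookup (\<Sum>m\<in>keys p. single m (lookup p m)) k = lookup p k"
  proof (cases "k \<in> keys p")
    case True
    then show ?thesis
      by (simp add: lookup_sum lookup_single when_def sum.delta)
  next
    case False
    then show ?thesis
      by (auto simp: lookup_sum lookup_single when_def in_keys_iff intro!: sum.neutral)
  qed
qed

lemma poly_mapping_linear_induct [case_names add single]:
  fixes P :: "('a \<Rightarrow>\<^sub>0 'b::comm_monoid_add) \<Rightarrow> bool"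
  assumes "\<And>p q. P p \<Longrightarrow> P q \<Longrightarrow> P (p + q)" "\<And>m c. P (single m c)"
  shows "P p"
proof -
  have "P (\<Sum>m\<in>S. single m (lookup p m))" if "finite S" for S
    using that
  proof (induction S)
    case empty
    show ?case using assms(2)[of _ 0] by simp
  qed (simp add: assms)
  then show ?thesis by (metis finite_keys sum_singles)
qed

lemma pairing_single_mult:
  "pairing \<phi> (single m c * p) = c * pairing (\<lambda>k. \<phi> (m + k)) p"
  by (induction p rule: poly_mapping_linear_induct)
     (simp_all add: distrib_left pairing_add mult_single mult.assoc)

lemma pairing_mult:
  "pairing \<phi> (p * q) = pairing (\<lambda>m. pairing (\<lambda>k. \<phi> (m + k)) q) p"
  by (induction p rule: poly_mapping_linear_induct)
     (simp_all add: distrib_right pairing_add pairing_single_mult)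

section \<open>Polynomial rings and monomial ideals\<close>

lemma poly_ring_simps [simp]:
  "carrier (poly_ring V) = {p. keys p \<subseteq> monomials V}"
  "x \<otimes>\<^bsub>poly_ring V\<^esub> y = x * y" "x \<oplus>\<^bsub>poly_ring V\<^esub> y = x + y"
  "\<one>\<^bsub>poly_ring V\<^esub> = 1" "\<zero>\<^bsub>poly_ring V\<^esub> = 0"
  by (simp_all add: poly_ring_def)

lemma keys_expo_add: "keys (\<alpha> + \<beta> :: expo) = keys \<alpha> \<union> keys \<beta>"
  by (auto simp: in_keys_iff lookup_add)

lemma monomials_0 [simp]: "0 \<in> monomials V"
  by (simp add: monomials_def)

lemma monomials_add_iff [simp]: "\<alpha> + \<beta> \<in> monomials V \<longleftrightarrow> \<alpha> \<in> monomials V \<and> \<beta> \<in> monomials V"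
  by (simp add: monomials_def keys_expo_add)

lemma monomials_mono: "V \<subseteq> W \<Longrightarrow> monomials V \<subseteq> monomials W"
  by (auto simp: monomials_def)

lemma keys_uminus [simp]: "keys (- p :: 'a \<Rightarrow>\<^sub>0 'b::ab_group_add) = keys p"
  by (auto simp: in_keys_iff)

lemma keys_xpow [simp]: "keys (xpow \<alpha>) = {\<alpha>}"
  by (simp add: xpow_def)

lemma xpow_mult: "xpow \<alpha> * xpow \<beta> = xpow (\<alpha> + \<beta>)"
  by (simp add: xpow_def mult_single)

lemma carrier_add: "keys p \<subseteq> monomials V \<Longrightarrow> keys q \<subseteq> monomials V \<Longrightarrow> keys (p + q) \<subseteq> monomials V"
  using keys_add[of p q] by blast

lemma carrier_diff:
  fixes p q :: "'k::field mpol"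
  shows "keys p \<subseteq> monomials V \<Longrightarrow> keys q \<subseteq> monomials V \<Longrightarrow> keys (p - q) \<subseteq> monomials V"
  using carrier_add[of p V "- q"] by simp

lemma carrier_mult: "keys p \<subseteq> monomials V \<Longrightarrow> keys q \<subseteq> monomials V \<Longrightarrow> keys (p * q) \<subseteq> monomials V"
  using keys_mult[of p q] by force

lemma carrier_sum:
  "(\<And>i. i \<in> S \<Longrightarrow> keys (f i) \<subseteq> monomials V) \<Longrightarrow> keys (sum f S) \<subseteq> monomials V"
  by (induction S rule: infinite_finite_induct) (simp_all add: carrier_add)

lemma cring_poly_ring: "cring (poly_ring V :: 'k::field mpol ring)"
proof (rule cringI)
  show "abelian_group (poly_ring V :: 'k mpol ring)"
  proof (rule abelian_groupI)
    fix x :: "'k mpol" assume "x \<in> carrier (poly_ring V)"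
    then show "\<exists>y\<in>carrier (poly_ring V). y \<oplus>\<^bsub>poly_ring V\<^esub> x = \<zero>\<^bsub>poly_ring V\<^esub>"
      by (intro bexI[of _ "- x"]) auto
  qed (simp_all add: carrier_add add.assoc add.commute)
  show "comm_monoid (poly_ring V :: 'k mpol ring)"
    by (rule comm_monoidI) (simp_all add: carrier_mult mult.assoc mult.commute)
qed (simp add: distrib_right)

lemma ring_poly_ring: "ring (poly_ring V :: 'k::field mpol ring)"
  using cring_poly_ring by (rule cring.axioms)

lemma ideal_poly_ringI:
  fixes K :: "'k::field mpol set"
  assumes "K \<subseteq> carrier (poly_ring V)" "0 \<in> K"
    and "\<And>p q. p \<in> K \<Longrightarrow> q \<in> K \<Longrightarrow> p + q \<in> K"
    and "\<And>p q. p \<in> K \<Longrightarrow> q \<in> carrier (poly_ring V) \<Longrightarrow> q * p \<in> K"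
  shows "ideal K (poly_ring V)"
proof (rule idealI[OF ring_poly_ring])
  have 1: "keys (- 1 :: 'k mpol) \<subseteq> monomials V" by simp
  have "- p \<in> K" if "p \<in> K" for p
    using assms(4)[of p "- 1"] that 1 by simp
  moreover have "inv\<^bsub>add_monoid (poly_ring V)\<^esub> p = - p" if "p \<in> K" for p
  proof -
    interpret R: ring "poly_ring V :: 'k mpol ring" by (rule ring_poly_ring)
    have "\<ominus>\<^bsub>poly_ring V\<^esub> p = - p"
      using that assms(1) by (intro R.minus_equality) auto
    then show ?thesis by (simp add: a_inv_def)
  qed
  ultimately show "subgroup K (add_monoid (poly_ring V))"
    using assms by (intro subgroup.intro) auto
next
  fix p q :: "'k mpol" assume "p \<in> K" "q \<in> carrier (poly_ring V)"
  then show "q \<otimes>\<^bsub>poly_ring V\<^esub> p \<in> K" "p \<otimes>\<^bsub>poly_ring V\<^esub> q \<in> K"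
    using assms(4)[of p q] by (simp_all add: mult.commute)
qed

text \<open>The right-hand side is an ideal containing the generators, and each term of one of its
  members is a multiple of a generator. Stated for any V because it serves both R and A; it reduces
  the ideals of monomials and variables below to divisibility of exponents.\<close>

lemma monomial_ideal:
  fixes V :: "nat set"
  assumes "M \<subseteq> monomials V"
  shows "Idl\<^bsub>poly_ring V\<^esub> (xpow ` M) =
    {p :: 'k::field mpol. keys p \<subseteq> monomials V \<and> (\<forall>\<mu>\<in>keys p. \<exists>m\<in>M. \<exists>\<gamma>. \<mu> = m + \<gamma>)}"
    (is "_ = ?K")
proof
  have "ideal ?K (poly_ring V)"
  proof (rule ideal_poly_ringI)
    fix p q :: "'k mpol" assume p: "p \<in> ?K" and q: "q \<in> ?K"
    then show "p + q \<in> ?K" using keys_add[of p q] carrier_add[of p V q] by blast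
  next
    fix p q :: "'k mpol" assume p: "p \<in> ?K" and q: "q \<in> carrier (poly_ring V)"
    have "\<exists>m\<in>M. \<exists>\<gamma>. \<mu> = m + \<gamma>" if "\<mu> \<in> keys (q * p)" for \<mu>
    proof -
      obtain \<alpha> \<beta> where "\<mu> = \<alpha> + \<beta>" "\<beta> \<in> keys p" using \<open>\<mu> \<in> keys (q * p)\<close> keys_mult[of q p] by blast
      with p obtain m \<gamma> where "m \<in> M" "\<beta> = m + \<gamma>" by blast
      with \<open>\<mu> = \<alpha> + \<beta>\<close> show ?thesis by (metis add.left_commute)
    qed
    then show "q * p \<in> ?K" using p q carrier_mult[of q V p] by auto
  qed auto
  moreover have "xpow ` M \<subseteq> ?K"
    using assms by (auto intro!: bexI exI[of _ 0])
  ultimately show "Idl\<^bsub>poly_ring V\<^esub> (xpow ` M) \<subseteq> ?K"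
    unfolding genideal_def by auto
next
  show "?K \<subseteq> Idl\<^bsub>poly_ring V\<^esub> (xpow ` M)"
  proof
    fix p assume p: "p \<in> ?K"
    show "p \<in> Idl\<^bsub>poly_ring V\<^esub> (xpow ` M)"
      unfolding genideal_def
    proof safe
      fix K :: "'k mpol set" assume K: "ideal K (poly_ring V)" "xpow ` M \<subseteq> K"
      interpret ideal K "poly_ring V" by (rule K)
      have mono: "single \<mu> (lookup p \<mu>) \<in> K" if \<mu>: "\<mu> \<in> keys p" for \<mu>
      proof -
        obtain m \<gamma> where m: "m \<in> M" "\<mu> = m + \<gamma>" using p \<mu> by blast
        have "\<gamma> \<in> monomials V" using p \<mu> m by auto
        then have "single \<gamma> (lookup p \<mu>) * xpow m \<in> K"
          using I_l_closed[of "xpow m" "single \<gamma> (lookup p \<mu>)"] m K(2) by auto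
        then show ?thesis using m by (simp add: xpow_def mult_single add.commute)
      qed
      have "(\<Sum>\<mu>\<in>S. single \<mu> (lookup p \<mu>)) \<in> K" if "finite S" "S \<subseteq> keys p" for S
        using that
      proof (induction S)
        case empty
        show ?case using additive_subgroup.zero_closed[OF is_additive_subgroup] by simp
      next
        case (insert \<mu> S)
        then show ?case using additive_subgroup.a_closed[OF is_additive_subgroup, of "single \<mu> (lookup p \<mu>)"] mono by simp
      qed
      from this[of "keys p"] show "p \<in> K" by (simp add: sum_singles)
    qed
  qed
qed

lemma expo_dvd_iff: "(\<exists>\<gamma>. \<mu> = (m::expo) + \<gamma>) \<longleftrightarrow> (\<forall>i. lookup m i \<le> lookup \<mu> i)"
proof
  assume "\<forall>i. lookup m i \<le> lookup \<mu> i"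
  then have "\<mu> = m + (\<mu> - m)"
    by (intro poly_mapping_eqI) (simp add: lookup_add lookup_minus)
  then show "\<exists>\<gamma>. \<mu> = m + \<gamma>" by blast
qed (auto simp: lookup_add)

lemma lookup_pw: "lookup (pw i b) j = (if i = j then b else 0)"
  by (simp add: pw_def lookup_single when_def)

lemma pw_dvd_iff: "(\<exists>\<gamma>. \<mu> = pw i 1 + \<gamma>) \<longleftrightarrow> 0 < lookup \<mu> i"
  by (auto simp: expo_dvd_iff lookup_pw Suc_le_eq)

lemma pw_in_monomials: "i \<in> V \<Longrightarrow> pw i b \<in> monomials V"
  by (auto simp: monomials_def pw_def)

lemma var_ideal:
  assumes "W \<subseteq> V"
  shows "Idl\<^bsub>poly_ring V\<^esub> (var ` W) =
    {p :: 'k::field mpol. keys p \<subseteq> monomials V \<and> (\<forall>\<mu>\<in>keys p. \<exists>i\<in>W. 0 < lookup \<mu> i)}"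
proof -
  have *: "var ` W = (xpow ` ((\<lambda>i. pw i 1) ` W) :: 'k mpol set)" by (auto simp: var_def)
  have "(\<lambda>i. pw i 1) ` W \<subseteq> monomials V" using assms by (auto intro: pw_in_monomials)
  from monomial_ideal[OF this] show ?thesis
    unfolding * by (simp add: pw_dvd_iff[symmetric])
qed

section \<open>The grading by the affine monoid\<close>

lemma sdeg_superset:
  assumes "finite S" "keys \<alpha> \<subseteq> S"
  shows "sdeg a \<alpha> $ k = (\<Sum>i\<in>S. lookup \<alpha> i * a i $ k)"
proof -
  have "sdeg a \<alpha> $ k = (\<Sum>i\<in>keys \<alpha>. lookup \<alpha> i * a i $ k)"
    by (simp add: sdeg_def vector_scalar_mult_def)
  also have "\<dots> = (\<Sum>i\<in>S. lookup \<alpha> i * a i $ k)"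
    using assms by (intro sum.mono_neutral_left) (auto simp: in_keys_iff)
  finally show ?thesis .
qed

lemma sdeg_add: "sdeg a (\<alpha> + \<beta>) = sdeg a \<alpha> + sdeg a \<beta>"
proof (rule vec_eq_iff[THEN iffD2], rule allI)
  fix k
  let ?S = "keys \<alpha> \<union> keys \<beta>"
  show "sdeg a (\<alpha> + \<beta>) $ k = (sdeg a \<alpha> + sdeg a \<beta>) $ k"
    using sdeg_superset[of ?S \<alpha> a k] sdeg_superset[of ?S \<beta> a k]
      sdeg_superset[of ?S "\<alpha> + \<beta>" a k]
    by (simp add: keys_expo_add lookup_add distrib_right sum.distrib)
qed

lemma vec_nat_add_cancel [simp]:
  fixes u v w :: "nat^3"
  shows "u + v = u + w \<longleftrightarrow> v = w" "v + u = w + u \<longleftrightarrow> v = w"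
  by (auto simp: vec_eq_iff)

text \<open>Consequently monomials of equal degree in the affine monoid have equal weight, and among
  them only the reverse lexicographic tie-break decides.\<close>

lemma wdeg_weights: "wdeg (weights a) \<alpha> = (\<Sum>k\<in>UNIV. sdeg a \<alpha> $ k)"
proof -
  have "(\<Sum>k\<in>UNIV. sdeg a \<alpha> $ k) = (\<Sum>k\<in>UNIV. \<Sum>i\<in>keys \<alpha>. lookup \<alpha> i * a i $ k)"
    by (simp add: sdeg_superset[of "keys \<alpha>"])
  also have "\<dots> = (\<Sum>i\<in>keys \<alpha>. \<Sum>k\<in>UNIV. lookup \<alpha> i * a i $ k)"
    by (rule sum.swap)
  also have "\<dots> = wdeg (weights a) \<alpha>"
    by (simp add: wdeg_def weights_def sum_distrib_left mult.commute)
  finally show ?thesis by simp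
qed

lemma single_power: "single x (1::'k::field) ^ j = single (j *s x) 1" for x :: "nat^3"
proof (induction j)
  case 0
  have "0 *s x = 0" by (simp add: vec_eq_iff)
  then show ?case by (simp only: power_0 single_one)
next
  case (Suc j)
  have "Suc j *s x = x + j *s x" by (simp add: vec_eq_iff)
  then show ?case using Suc by (simp only: power_Suc mult_single mult_1_left)
qed

lemma prod_single: "(\<Prod>i\<in>S. single (f i) (1::'k::field)) = single (\<Sum>i\<in>S. f i) 1"
  for f :: "'i \<Rightarrow> nat^3"
  by (induction S rule: infinite_finite_induct) (simp_all add: mult_single)

text \<open>The coefficient at \<open>t\<^sup>s\<close> of the image of a polynomial in the monoid algebra.\<close>

definition toric_coeff :: "(nat \<Rightarrow> nat^3) \<Rightarrow> nat^3 \<Rightarrow> 'k::field mpol \<Rightarrow> 'k" where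
  "toric_coeff a s = pairing (\<lambda>m. of_bool (sdeg a m = s))"

lemma lookup_alg_hom:
  "lookup (alg_hom (\<lambda>i. single (a i) (1::'k::field)) p) s = toric_coeff a s p"
  unfolding alg_hom_def single_power prod_single mult_single toric_coeff_def pairing_def
  by (simp add: lookup_sum lookup_single when_def sdeg_def of_bool_def if_distrib cong: if_cong)

lemma toric_ideal_iff:
  "p \<in> toric_ideal n a \<longleftrightarrow>
    keys p \<subseteq> monomials {1..n} \<and> (\<forall>s. toric_coeff a s p = 0)"
  by (simp add: toric_ideal_def lookup_alg_hom[symmetric] poly_mapping_eq_iff fun_eq_iff)

lemma toric_coeff_xpow: "toric_coeff a s (xpow \<alpha>) = of_bool (sdeg a \<alpha> = s)"
  by (simp add: toric_coeff_def xpow_def)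

lemma toric_coeff_mult:
  "toric_coeff a s (p * q) =
    pairing (\<lambda>m. pairing (\<lambda>k. of_bool (sdeg a m + sdeg a k = s)) q) p"
  by (simp add: toric_coeff_def pairing_mult sdeg_add)

lemma toric_coeff_shift: "pairing (\<lambda>k. of_bool (d + sdeg a k = d + t)) q = toric_coeff a t q"
  by (simp add: toric_coeff_def)

text \<open>Degrees cannot be subtracted: s may fail to be of the form d + t, and then no monomial
  contributes to the sum at all.\<close>

lemma toric_coeff_shift_eq_0:
  assumes "\<And>t. toric_coeff a t q = 0"
  shows "pairing (\<lambda>k. of_bool (d + sdeg a k = s)) q = 0"
proof (cases "\<exists>t. s = d + t")
  case True
  then obtain t where "s = d + t" ..
  then show ?thesis using assms by (simp only: toric_coeff_shift)
next
  case False
  then show ?thesis by (intro pairing_eq_0) auto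
qed

lemma toric_coeff_ex_key:
  assumes "toric_coeff a s p \<noteq> 0"
  obtains \<mu> where "\<mu> \<in> keys p" "sdeg a \<mu> = s"
proof -
  have "\<exists>\<mu>\<in>keys p. sdeg a \<mu> = s"
    using assms unfolding toric_coeff_def by (rule contrapos_np) (intro pairing_eq_0, auto)
  then show thesis using that by blast
qed

lemma toric_ideal_add:
  "p \<in> toric_ideal n a \<Longrightarrow> q \<in> toric_ideal n a \<Longrightarrow> p + q \<in> toric_ideal n a"
  by (simp add: toric_ideal_iff toric_coeff_def pairing_add carrier_add)

lemma toric_ideal_diff:
  "p \<in> toric_ideal n a \<Longrightarrow> q \<in> toric_ideal n a \<Longrightarrow> p - q \<in> toric_ideal n a"
  by (simp add: toric_ideal_iff toric_coeff_def pairing_diff carrier_diff)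

lemma toric_ideal_mult:
  assumes "p \<in> toric_ideal n a" "keys q \<subseteq> monomials {1..n}"
  shows "q * p \<in> toric_ideal n a"
proof -
  have "toric_coeff a s (q * p) = 0" for s
    unfolding toric_coeff_mult using assms(1)
    by (intro pairing_eq_0 toric_coeff_shift_eq_0) (simp add: toric_ideal_iff)
  then show ?thesis using assms carrier_mult[of q "{1..n}" p] by (simp add: toric_ideal_iff)
qed

lemma toric_ideal_sum:
  "(\<And>i. i \<in> S \<Longrightarrow> f i \<in> toric_ideal n a) \<Longrightarrow> sum f S \<in> toric_ideal n a"
  by (induction S rule: infinite_finite_induct)
     (auto simp: toric_ideal_add toric_ideal_iff[of 0] toric_coeff_def)

lemma xpow_diff_in_toric_ideal:
  assumes "\<alpha> \<in> monomials {1..n}" "\<beta> \<in> monomials {1..n}" "sdeg a \<alpha> = sdeg a \<beta>"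
  shows "xpow \<alpha> - xpow \<beta> \<in> toric_ideal n a"
  using assms carrier_diff[of "xpow \<alpha>" "{1..n}" "xpow \<beta>"]
  by (simp add: toric_ideal_iff toric_coeff_def pairing_diff xpow_def)

lemma set_add_poly_ring: "p \<in> H <+>\<^bsub>poly_ring V\<^esub> K \<longleftrightarrow> (\<exists>h\<in>H. \<exists>k\<in>K. p = h + k)"
  by (auto simp: set_add_def')

text \<open>The coefficient functional in the degree of \<alpha> vanishes on I and is 1 on the
  monomial, so the other summand must contain a monomial of that degree. Conversely, the binomial of
  two monomials of equal degree lies in I.\<close>

lemma xpow_in_toric_plus_var:
  assumes "\<alpha> \<in> monomials {1..n}" "i \<in> {1..n}"
  shows "xpow \<alpha> \<in> (toric_ideal n a :: 'k::field mpol set) <+>\<^bsub>Rr n\<^esub> Idl\<^bsub>Rr n\<^esub> {var i} \<longleftrightarrow>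
    (\<exists>\<beta>\<in>monomials {1..n}. sdeg a \<beta> = sdeg a \<alpha> \<and> 0 < lookup \<beta> i)"
proof -
  have idl: "Idl\<^bsub>Rr n\<^esub> {var i} =
    {p :: 'k mpol. keys p \<subseteq> monomials {1..n} \<and> (\<forall>\<mu>\<in>keys p. 0 < lookup \<mu> i)}"
    using var_ideal[of "{i}" "{1..n}"] assms by simp
  show ?thesis
  proof
    assume "xpow \<alpha> \<in> (toric_ideal n a :: 'k mpol set) <+>\<^bsub>Rr n\<^esub> Idl\<^bsub>Rr n\<^esub> {var i}"
    then obtain p q :: "'k mpol" where pq: "p \<in> toric_ideal n a" "q \<in> Idl\<^bsub>Rr n\<^esub> {var i}"
      "xpow \<alpha> = p + q"
      unfolding set_add_poly_ring by blast
    have "toric_coeff a (sdeg a \<alpha>) p = 0" using pq(1) by (simp add: toric_ideal_iff)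
    moreover have "toric_coeff a (sdeg a \<alpha>) (p + q) = 1"
      using toric_coeff_xpow[of a "sdeg a \<alpha>" \<alpha>, where 'a = 'k] unfolding pq(3) by simp
    ultimately have "toric_coeff a (sdeg a \<alpha>) q \<noteq> 0"
      by (simp add: toric_coeff_def pairing_add)
    then obtain \<mu> where "\<mu> \<in> keys q" "sdeg a \<mu> = sdeg a \<alpha>" by (rule toric_coeff_ex_key)
    with pq(2) show "\<exists>\<beta>\<in>monomials {1..n}. sdeg a \<beta> = sdeg a \<alpha> \<and> 0 < lookup \<beta> i"
      unfolding idl by auto
  next
    assume "\<exists>\<beta>\<in>monomials {1..n}. sdeg a \<beta> = sdeg a \<alpha> \<and> 0 < lookup \<beta> i"
    then obtain \<beta> where \<beta>: "\<beta> \<in> monomials {1..n}" "sdeg a \<beta> = sdeg a \<alpha>" "0 < lookup \<beta> i" by blast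
    have "xpow \<alpha> - xpow \<beta> \<in> (toric_ideal n a :: 'k mpol set)"
      using assms \<beta> by (intro xpow_diff_in_toric_ideal) auto
    moreover have "xpow \<beta> \<in> (Idl\<^bsub>Rr n\<^esub> {var i} :: 'k mpol set)"
      unfolding idl using \<beta> by simp
    moreover have "xpow \<alpha> = (xpow \<alpha> - xpow \<beta>) + (xpow \<beta> :: 'k mpol)" by simp
    ultimately show "xpow \<alpha> \<in> (toric_ideal n a :: 'k mpol set) <+>\<^bsub>Rr n\<^esub> Idl\<^bsub>Rr n\<^esub> {var i}"
      unfolding set_add_poly_ring by blast
  qed
qed

section \<open>The monomial order and standard monomials\<close>

lemma wdeg_add: "wdeg \<omega> (\<alpha> + \<beta>) = wdeg \<omega> \<alpha> + wdeg \<omega> \<beta>"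
proof -
  have *: "wdeg \<omega> \<gamma> = (\<Sum>i\<in>keys \<alpha> \<union> keys \<beta>. \<omega> i * lookup \<gamma> i)" if "keys \<gamma> \<subseteq> keys \<alpha> \<union> keys \<beta>" for \<gamma>
    unfolding wdeg_def using that by (intro sum.mono_neutral_left) (auto simp: in_keys_iff)
  show ?thesis
    by (subst (1 2 3) *) (auto simp: keys_expo_add lookup_add distrib_left sum.distrib)
qed

lemma mon_gt_add_right: "mon_gt \<omega> (\<alpha> + \<gamma>) (\<beta> + \<gamma>) \<longleftrightarrow> mon_gt \<omega> \<alpha> \<beta>"
  by (simp add: mon_gt_def wdeg_add lookup_add)

lemma mon_gt_add_left: "mon_gt \<omega> (\<gamma> + \<alpha>) (\<gamma> + \<beta>) \<longleftrightarrow> mon_gt \<omega> \<alpha> \<beta>"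
  using mon_gt_add_right[of \<omega> \<alpha> \<gamma> \<beta>] by (simp add: add.commute)

lemma mon_gt_irrefl: "\<not> mon_gt \<omega> \<alpha> \<alpha>"
  by (simp add: mon_gt_def)

lemma mon_gt_trans:
  assumes "mon_gt \<omega> \<alpha> \<beta>" "mon_gt \<omega> \<beta> \<gamma>"
  shows "mon_gt \<omega> \<alpha> \<gamma>"
proof (cases "wdeg \<omega> \<alpha> = wdeg \<omega> \<beta> \<and> wdeg \<omega> \<beta> = wdeg \<omega> \<gamma>")
  case True
  then obtain k l where
    k: "lookup \<alpha> k < lookup \<beta> k" "\<forall>j>k. lookup \<alpha> j = lookup \<beta> j" and
    l: "lookup \<beta> l < lookup \<gamma> l" "\<forall>j>l. lookup \<beta> j = lookup \<gamma> j"
    using assms by (auto simp: mon_gt_def)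
  have "lookup \<alpha> (max k l) < lookup \<gamma> (max k l)"
    using k l by (cases k l rule: linorder_cases) (auto simp: max_def)
  moreover have "\<forall>j>max k l. lookup \<alpha> j = lookup \<gamma> j" using k(2) l(2) by simp
  ultimately show ?thesis using True unfolding mon_gt_def by auto
next
  case False
  then show ?thesis using assms unfolding mon_gt_def by linarith
qed

lemma mon_gt_asym: "mon_gt \<omega> \<alpha> \<beta> \<Longrightarrow> \<not> mon_gt \<omega> \<beta> \<alpha>"
  using mon_gt_trans mon_gt_irrefl by blast

lemma mon_gt_total:
  assumes "\<alpha> \<noteq> \<beta>"
  shows "mon_gt \<omega> \<alpha> \<beta> \<or> mon_gt \<omega> \<beta> \<alpha>"
proof -
  define D where "D = {k. lookup \<alpha> k \<noteq> lookup \<beta> k}"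
  have "D \<subseteq> keys \<alpha> \<union> keys \<beta>" by (auto simp: D_def in_keys_iff)
  then have fin: "finite D" by (rule finite_subset) simp
  have "D \<noteq> {}" using assms poly_mapping_eqI[of \<alpha> \<beta>] unfolding D_def by blast
  then have "Max D \<in> D" using fin by (rule Max_in[rotated])
  then have "lookup \<alpha> (Max D) \<noteq> lookup \<beta> (Max D)" by (simp add: D_def)
  moreover have "lookup \<alpha> j = lookup \<beta> j" if "j > Max D" for j
  proof (rule ccontr)
    assume "lookup \<alpha> j \<noteq> lookup \<beta> j"
    then have "j \<le> Max D" using fin by (intro Max_ge) (auto simp: D_def)
    with that show False by simp
  qed
  ultimately obtain k where k: "lookup \<alpha> k \<noteq> lookup \<beta> k" "\<forall>j>k. lookup \<alpha> j = lookup \<beta> j"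
    by blast
  have w: "wdeg \<omega> \<alpha> > wdeg \<omega> \<beta> \<or> wdeg \<omega> \<beta> > wdeg \<omega> \<alpha> \<or>
    (wdeg \<omega> \<alpha> = wdeg \<omega> \<beta> \<and> wdeg \<omega> \<beta> = wdeg \<omega> \<alpha>)" by linarith
  show ?thesis
  proof (cases "lookup \<alpha> k < lookup \<beta> k")
    case True
    then have "\<exists>k. lookup \<alpha> k < lookup \<beta> k \<and> (\<forall>j>k. lookup \<alpha> j = lookup \<beta> j)" using k by blast
    then show ?thesis using w unfolding mon_gt_def by blast
  next
    case False
    then have "lookup \<beta> k < lookup \<alpha> k" using k(1) by linarith
    moreover have "\<forall>j>k. lookup \<beta> j = lookup \<alpha> j" by (simp add: k(2))
    ultimately have "\<exists>k. lookup \<beta> k < lookup \<alpha> k \<and> (\<forall>j>k. lookup \<beta> j = lookup \<alpha> j)" by blast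
    then show ?thesis using w unfolding mon_gt_def by blast
  qed
qed

text \<open>The relation is kept abstract because it is instantiated with \<open>mon_gt\<close> for
  leading monomials and with its converse for normal forms.\<close>

lemma finite_total_greatest:
  assumes "finite S" "S \<noteq> {}"
    and trans: "\<And>x y z. R x y \<Longrightarrow> R y z \<Longrightarrow> R x z"
    and total: "\<And>x y. x \<noteq> y \<Longrightarrow> R x y \<or> R y x"
  shows "\<exists>\<alpha>\<in>S. \<forall>\<beta>\<in>S. \<beta> \<noteq> \<alpha> \<longrightarrow> R \<alpha> \<beta>"
  using assms(1,2)
proof (induction S rule: finite_ne_induct)
  case (insert x S)
  then obtain \<alpha> where \<alpha>: "\<alpha> \<in> S" "\<forall>\<beta>\<in>S. \<beta> \<noteq> \<alpha> \<longrightarrow> R \<alpha> \<beta>" by blast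
  show ?case
  proof (cases "R x \<alpha>")
    case True
    then have "\<forall>\<beta>\<in>insert x S. \<beta> \<noteq> x \<longrightarrow> R x \<beta>" using \<alpha> trans by (metis insertE)
    then show ?thesis by blast
  next
    case False
    then have "\<forall>\<beta>\<in>insert x S. \<beta> \<noteq> \<alpha> \<longrightarrow> R \<alpha> \<beta>" using \<alpha> total by blast
    then show ?thesis using \<alpha> by blast
  qed
qed auto

lemma lead_props:
  assumes "p \<noteq> 0"
  shows "lead \<omega> p \<in> keys p \<and> (\<forall>\<beta>\<in>keys p. \<beta> \<noteq> lead \<omega> p \<longrightarrow> mon_gt \<omega> (lead \<omega> p) \<beta>)"
  unfolding lead_def
proof (rule theI')
  have "keys p \<noteq> {}" using assms by (metis lookup_zero not_in_keys_iff_lookup_eq_zero poly_mapping_eqI empty_iff)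
  then obtain \<alpha> where \<alpha>: "\<alpha> \<in> keys p" "\<forall>\<beta>\<in>keys p. \<beta> \<noteq> \<alpha> \<longrightarrow> mon_gt \<omega> \<alpha> \<beta>"
    using finite_keys[of p] finite_total_greatest[of "keys p" "mon_gt \<omega>"] mon_gt_trans mon_gt_total by blast
  show "\<exists>!\<alpha>. \<alpha> \<in> keys p \<and> (\<forall>\<beta>\<in>keys p. \<beta> \<noteq> \<alpha> \<longrightarrow> mon_gt \<omega> \<alpha> \<beta>)"
  proof (intro ex1I[of _ \<alpha>] conjI \<alpha>)
    fix \<gamma> assume \<gamma>: "\<gamma> \<in> keys p \<and> (\<forall>\<beta>\<in>keys p. \<beta> \<noteq> \<gamma> \<longrightarrow> mon_gt \<omega> \<gamma> \<beta>)"
    show "\<gamma> = \<alpha>"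
    proof (rule ccontr)
      assume "\<gamma> \<noteq> \<alpha>"
      then have "mon_gt \<omega> \<gamma> \<alpha>" "mon_gt \<omega> \<alpha> \<gamma>" using \<alpha> \<gamma> by auto
      then show False using mon_gt_asym by blast
    qed
  qed
qed

lemma initial_ideal_eq:
  fixes F :: "'k::field mpol set"
  assumes "F \<subseteq> carrier (Rr n)"
  shows "initial_ideal n \<omega> F = {p. keys p \<subseteq> monomials {1..n} \<and>
    (\<forall>\<mu>\<in>keys p. \<exists>f\<in>F. f \<noteq> 0 \<and> (\<exists>\<gamma>. \<mu> = lead \<omega> f + \<gamma>))}"
proof -
  let ?M = "{lead \<omega> f |f. f \<in> F \<and> f \<noteq> 0}"
  have "?M \<subseteq> monomials {1..n}" using assms lead_props by fastforce
  then have "Idl\<^bsub>Rr n\<^esub> (xpow ` ?M) =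
    {p :: 'k mpol. keys p \<subseteq> monomials {1..n} \<and> (\<forall>\<mu>\<in>keys p. \<exists>m\<in>?M. \<exists>\<gamma>. \<mu> = m + \<gamma>)}"
    by (rule monomial_ideal)
  moreover have "{xpow (lead \<omega> f) |f. f \<in> F \<and> f \<noteq> 0} = (xpow ` ?M :: 'k mpol set)" by auto
  ultimately have "initial_ideal n \<omega> F =
    {p :: 'k mpol. keys p \<subseteq> monomials {1..n} \<and> (\<forall>\<mu>\<in>keys p. \<exists>m\<in>?M. \<exists>\<gamma>. \<mu> = m + \<gamma>)}"
    unfolding initial_ideal_def by simp
  moreover have "(\<exists>m\<in>?M. \<exists>\<gamma>. \<mu> = m + \<gamma>) \<longleftrightarrow> (\<exists>f\<in>F. f \<noteq> 0 \<and> (\<exists>\<gamma>. \<mu> = lead \<omega> f + \<gamma>))" for \<mu>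
    by blast
  ultimately show ?thesis by simp
qed

lemma xpow_in_initial_ideal:
  fixes F :: "'k::field mpol set"
  assumes "F \<subseteq> carrier (Rr n)"
  shows "xpow \<alpha> \<in> initial_ideal n \<omega> F \<longleftrightarrow>
    \<alpha> \<in> monomials {1..n} \<and> (\<exists>f\<in>F. f \<noteq> 0 \<and> (\<exists>\<gamma>. \<alpha> = lead \<omega> f + \<gamma>))"
  unfolding initial_ideal_eq[OF assms] by simp

lemma toric_ideal_subset: "toric_ideal n a \<subseteq> carrier (Rr n)"
  by (auto simp: toric_ideal_def)

text \<open>The least monomial of its degree. This description avoids the ideal and the field;
  \<open>initial_toric_ideal\<close> identifies these monomials with those outside in(I).\<close>

definition standard :: "nat \<Rightarrow> (nat \<Rightarrow> nat^3) \<Rightarrow> expo \<Rightarrow> bool" where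
  "standard n a \<alpha> \<longleftrightarrow> \<alpha> \<in> monomials {1..n} \<and>
    (\<forall>\<beta>\<in>monomials {1..n}. sdeg a \<beta> = sdeg a \<alpha> \<longrightarrow> \<not> mon_gt (weights a) \<alpha> \<beta>)"

lemma standard_add: "standard n a (\<alpha> + \<gamma>) \<Longrightarrow> standard n a \<alpha>"
  unfolding standard_def
  by (metis mon_gt_add_right monomials_add_iff sdeg_add)

lemma standard_unique:
  "standard n a \<alpha> \<Longrightarrow> standard n a \<beta> \<Longrightarrow> sdeg a \<alpha> = sdeg a \<beta> \<Longrightarrow> \<alpha> = \<beta>"
  unfolding standard_def by (metis mon_gt_total)

text \<open>A leading monomial cannot be the only monomial of its degree in f: the toric coefficient
  in that degree would be its nonzero coefficient. Hence f contains a smaller monomial of the same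
  degree. Conversely, a smaller \<beta> of the same degree makes \<alpha> the leading monomial of a
  binomial in I.\<close>

lemma initial_toric_ideal:
  assumes "\<alpha> \<in> monomials {1..n}"
  shows "xpow \<alpha> \<in> initial_ideal n (weights a) (toric_ideal n a :: 'k::field mpol set) \<longleftrightarrow>
    \<not> standard n a \<alpha>"
proof
  assume "xpow \<alpha> \<in> initial_ideal n (weights a) (toric_ideal n a :: 'k mpol set)"
  then obtain f :: "'k mpol" and \<gamma> where f: "f \<in> toric_ideal n a" "f \<noteq> 0"
    "\<alpha> = lead (weights a) f + \<gamma>"
    by (auto simp: xpow_in_initial_ideal[OF toric_ideal_subset])
  let ?l = "lead (weights a) f"
  have l: "?l \<in> keys f" "\<And>\<beta>. \<beta> \<in> keys f \<Longrightarrow> \<beta> \<noteq> ?l \<Longrightarrow> mon_gt (weights a) ?l \<beta>"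
    using lead_props[OF f(2), of "weights a"] by auto
  have "\<exists>\<beta>\<in>keys f. \<beta> \<noteq> ?l \<and> sdeg a \<beta> = sdeg a ?l"
  proof (rule ccontr)
    assume *: "\<not> ?thesis"
    have "toric_coeff a (sdeg a ?l) f =
      (\<Sum>m\<in>keys f. if m = ?l then lookup f m else 0)"
      unfolding toric_coeff_def pairing_def using * by (intro sum.cong) auto
    also have "\<dots> = lookup f ?l" using l(1) by simp
    finally show False using f(1) l(1) by (simp add: toric_ideal_iff in_keys_iff)
  qed
  then obtain \<beta> where \<beta>: "\<beta> \<in> keys f" "\<beta> \<noteq> ?l" "sdeg a \<beta> = sdeg a ?l" by blast
  then have "\<not> standard n a ?l"
    using l(2)[of \<beta>] f(1) unfolding standard_def toric_ideal_iff by blast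
  then show "\<not> standard n a \<alpha>" using standard_add f(3) by blast
next
  assume "\<not> standard n a \<alpha>"
  then obtain \<beta> where \<beta>: "\<beta> \<in> monomials {1..n}" "sdeg a \<beta> = sdeg a \<alpha>" "mon_gt (weights a) \<alpha> \<beta>"
    using assms unfolding standard_def by blast
  let ?f = "xpow \<alpha> - xpow \<beta> :: 'k mpol"
  have ne: "\<alpha> \<noteq> \<beta>" using \<beta>(3) mon_gt_irrefl by blast
  then have coeff: "lookup ?f \<alpha> = 1" by (simp add: xpow_def lookup_minus lookup_single)
  then have "?f \<noteq> 0" by (metis lookup_zero zero_neq_one)
  moreover have "?f \<in> toric_ideal n a"
    using assms \<beta> by (intro xpow_diff_in_toric_ideal) auto
  moreover have "lead (weights a) ?f = \<alpha>"
  proof (rule ccontr)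
    assume "lead (weights a) ?f \<noteq> \<alpha>"
    moreover have "lead (weights a) ?f \<in> keys ?f" using lead_props[OF \<open>?f \<noteq> 0\<close>] by blast
    moreover have "keys ?f \<subseteq> {\<alpha>, \<beta>}"
      using keys_add[of "xpow \<alpha>" "- (xpow \<beta> :: 'k mpol)"] by auto
    ultimately have "lead (weights a) ?f = \<beta>" by auto
    moreover have "mon_gt (weights a) (lead (weights a) ?f) \<alpha>"
      using lead_props[OF \<open>?f \<noteq> 0\<close>, of "weights a"] \<open>lead (weights a) ?f \<noteq> \<alpha>\<close> coeff
      by (metis in_keys_iff zero_neq_one)
    ultimately show False using \<beta>(3) mon_gt_asym by simp
  qed
  ultimately show "xpow \<alpha> \<in> initial_ideal n (weights a) (toric_ideal n a :: 'k mpol set)"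
    unfolding xpow_in_initial_ideal[OF toric_ideal_subset]
    using assms by (metis add.right_neutral)
qed

lemma initial_toric_ideal_eq:
  "initial_ideal n (weights a) (toric_ideal n a :: 'k::field mpol set) =
    {p. keys p \<subseteq> monomials {1..n} \<and> (\<forall>\<mu>\<in>keys p. \<not> standard n a \<mu>)}"
proof -
  have "\<not> standard n a \<mu> \<longleftrightarrow>
      (\<exists>f\<in>toric_ideal n a :: 'k mpol set. f \<noteq> 0 \<and> (\<exists>\<gamma>. \<mu> = lead (weights a) f + \<gamma>))"
    if "\<mu> \<in> monomials {1..n}" for \<mu>
    using initial_toric_ideal[OF that] xpow_in_initial_ideal[OF toric_ideal_subset] that by blast
  then show ?thesis
    unfolding initial_ideal_eq[OF toric_ideal_subset]
    by (intro Collect_cong conj_cong refl ball_cong) blast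
qed

section \<open>Shifts in the first step of the resolution\<close>

lemma expo_add_eq_0_iff: "(\<alpha> + \<beta> :: expo) = 0 \<longleftrightarrow> \<alpha> = 0 \<and> \<beta> = 0"
  by (auto simp: poly_mapping_eq_iff lookup_add fun_eq_iff)

lemma lookup_mult_0:
  fixes p q :: "'k::field mpol"
  assumes "lookup p 0 = 0"
  shows "lookup (p * q) 0 = 0"
proof (rule ccontr)
  assume "lookup (p * q) 0 \<noteq> 0"
  then have "0 \<in> keys (p * q)" by (simp add: in_keys_iff)
  then obtain \<alpha> \<beta> where "0 = \<alpha> + \<beta>" "\<alpha> \<in> keys p" using keys_mult[of p q] by blast
  then have "\<alpha> = 0" using expo_add_eq_0_iff[of \<alpha> \<beta>] by simp
  then show False using \<open>\<alpha> \<in> keys p\<close> assms by (simp add: in_keys_iff)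
qed

lemma pw_eq_0_iff: "pw i b = 0 \<longleftrightarrow> b = 0"
  by (metis keys_eq_empty keys_single insert_not_empty keys_zero pw_def single_zero)

lemma sdeg_pw: "sdeg a (pw i 1) = a i"
  by (simp add: sdeg_def pw_def vec_eq_iff)

lemma expo_split: "0 < lookup \<beta> i \<Longrightarrow> \<exists>\<gamma>. \<beta> = pw i 1 + \<gamma>"
  by (simp only: pw_dvd_iff)

lemma expo_split2:
  assumes "0 < lookup \<beta> i" "0 < lookup \<beta> j" "i \<noteq> j"
  shows "\<exists>\<gamma>. \<beta> = pw i 1 + (pw j 1 + \<gamma>)"
proof -
  obtain \<gamma> where \<gamma>: "\<beta> = pw i 1 + \<gamma>" using expo_split[OF assms(1)] by blast
  then have "0 < lookup \<gamma> j" using assms by (simp add: lookup_add lookup_pw)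
  then show ?thesis using \<gamma> expo_split by blast
qed

text \<open>Each monomial of p is assigned to one variable of W dividing it, so no cancellation
  occurs. The clause on keys lets homogeneity and membership in A pass from p to the
  \<open>q i\<close>.\<close>

lemma split_by_variables:
  fixes p :: "'k::field mpol"
  assumes "finite W" "\<And>m. m \<in> keys p \<Longrightarrow> \<exists>i\<in>W. 0 < lookup m i"
  shows "\<exists>q. p = (\<Sum>i\<in>W. var i * q i) \<and> (\<forall>i. \<forall>\<alpha>\<in>keys (q i). pw i 1 + \<alpha> \<in> keys p)"
proof -
  have "\<forall>m. \<exists>i \<gamma>. m \<in> keys p \<longrightarrow> i \<in> W \<and> m = pw i 1 + \<gamma>"
    using assms(2) expo_split by meson
  then obtain \<iota> \<gamma> where \<iota>: "\<And>m. m \<in> keys p \<Longrightarrow> \<iota> m \<in> W \<and> m = pw (\<iota> m) 1 + \<gamma> m"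
    by metis
  define q where "q i = (\<Sum>m\<in>{m\<in>keys p. \<iota> m = i}. single (\<gamma> m) (lookup p m))" for i
  have "var i * q i = (\<Sum>m\<in>{m\<in>keys p. \<iota> m = i}. single m (lookup p m))" for i
    unfolding q_def sum_distrib_left using \<iota>
    by (intro sum.cong) (auto simp: var_def xpow_def mult_single simp flip: One_nat_def)
  moreover have "(\<Sum>i\<in>W. \<Sum>m\<in>{m\<in>keys p. \<iota> m = i}. single m (lookup p m)) = p"
    using sum.group[of "keys p" W \<iota> "\<lambda>m. single m (lookup p m)"] \<iota> assms(1)
    by (auto simp: sum_singles)
  ultimately have "p = (\<Sum>i\<in>W. var i * q i)" by simp
  moreover have "pw i 1 + \<alpha> \<in> keys p" if "\<alpha> \<in> keys (q i)" for i \<alpha>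
  proof -
    have "lookup (q i) \<alpha> \<noteq> 0" using that by (simp add: in_keys_iff)
    then obtain m where "m \<in> keys p" "\<iota> m = i" "lookup (single (\<gamma> m) (lookup p m)) \<alpha> \<noteq> 0"
      unfolding q_def lookup_sum by (auto elim: sum.not_neutral_contains_not_neutral)
    then show ?thesis using \<iota>[of m] by (simp add: lookup_single when_def split: if_splits)
  qed
  ultimately show ?thesis by blast
qed

text \<open>
  \<open>face n a s F\<close> says that \<open>F\<close> is a face of the complex \<open>{F. s - \<Sum>\<^sub>i\<^sub>\<in>\<^sub>F a i \<in> \<S>}\<close>, whose reduced
  homology computes the multigraded Betti numbers of \<open>R/I\<close> over \<open>A\<close> in degree \<open>s\<close>.
\<close>

definition face :: "nat \<Rightarrow> (nat \<Rightarrow> nat^3) \<Rightarrow> nat^3 \<Rightarrow> nat set \<Rightarrow> bool" where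
  "face n a s F \<longleftrightarrow> (\<exists>\<beta>\<in>monomials {1..n}. sdeg a \<beta> = s \<and> (\<forall>i\<in>F. 0 < lookup \<beta> i))"

text \<open>Only edges are tested, so this also holds if v is not a vertex; where it matters,
  \<open>face n a s {v}\<close> is assumed separately.\<close>

definition isolated :: "nat \<Rightarrow> (nat \<Rightarrow> nat^3) \<Rightarrow> nat^3 \<Rightarrow> nat \<Rightarrow> bool" where
  "isolated n a s v \<longleftrightarrow> (\<forall>i\<in>{n-2..n} - {v}. \<not> face n a s {v, i})"

locale short_resolution =
  fixes n :: nat and a :: "nat \<Rightarrow> nat^3" and sh :: "nat \<Rightarrow> (nat^3) list"
    and g :: "nat \<Rightarrow> 'k::field mpol" and D :: "nat \<Rightarrow> nat \<Rightarrow> nat \<Rightarrow> 'k mpol"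
  assumes n3: "3 \<le> n"
    and res: "is_minimal_graded_free_resolution n a (toric_ideal n a) sh g D"
begin

lemma subA: "{n-2..n} \<subseteq> {1..n}"
  using n3 by auto

lemma monomials_A: "\<alpha> \<in> monomials {n-2..n} \<Longrightarrow> \<alpha> \<in> monomials {1..n}"
  using monomials_mono[OF subA] by blast

lemma carrier_A: "keys p \<subseteq> monomials {n-2..n} \<Longrightarrow> keys p \<subseteq> monomials {1..n}"
  using monomials_mono[OF subA] by blast

lemma g_homogeneous:
  "j < length (sh 0) \<Longrightarrow> keys (g j) \<subseteq> monomials {1..n}"
  "j < length (sh 0) \<Longrightarrow> \<alpha> \<in> keys (g j) \<Longrightarrow> sdeg a \<alpha> = sh 0 ! j"
  using res unfolding is_minimal_graded_free_resolution_def is_graded_free_resolution_def by auto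

lemma D_homogeneous:
  assumes "k < length (sh i)" "j < length (sh (Suc i))"
  shows "keys (D i k j) \<subseteq> monomials {n-2..n}"
    and "\<alpha> \<in> keys (D i k j) \<Longrightarrow> sdeg a \<alpha> + sh i ! k = sh (Suc i) ! j"
  using res assms unfolding is_minimal_graded_free_resolution_def is_graded_free_resolution_def
  by auto

lemma D_minimal:
  assumes "k < length (sh i)" "j < length (sh (Suc i))" "\<alpha> \<in> keys (D i k j)"
  shows "\<exists>v\<in>{n-2,n-1,n}. 0 < lookup \<alpha> v"
proof -
  have "D i k j \<in> Idl\<^bsub>Ar n\<^esub> (var ` {n-2,n-1,n})"
    using res assms unfolding is_minimal_graded_free_resolution_def by auto
  also have "\<dots> = {p. keys p \<subseteq> monomials {n-2..n} \<and> (\<forall>\<mu>\<in>keys p. \<exists>i\<in>{n-2,n-1,n}. 0 < lookup \<mu> i)}"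
    by (rule var_ideal) auto
  finally show ?thesis using assms(3) by blast
qed

lemma surjective:
  assumes "keys p \<subseteq> monomials {1..n}"
  obtains f where "f \<in> free_mod n (length (sh 0))"
    "p - (\<Sum>j<length (sh 0). f j * g j) \<in> toric_ideal n a"
  using res assms that
  unfolding is_minimal_graded_free_resolution_def is_graded_free_resolution_def by auto

section \<open>First syzygies and linear functionals on them\<close>

definition K :: "(nat \<Rightarrow> 'k mpol) set" where
  "K = {f \<in> free_mod n (length (sh 0)). (\<Sum>j<length (sh 0). f j * g j) \<in> toric_ideal n a}"

lemma K_eq_image:
  assumes "f \<in> free_mod n (length (sh 0))"
  shows "f \<in> K \<longleftrightarrow> (\<exists>h\<in>free_mod n (length (sh 1)).
    \<forall>k<length (sh 0). f k = mat_app (length (sh 1)) (D 0) h k)"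
  using res assms
  unfolding is_minimal_graded_free_resolution_def is_graded_free_resolution_def K_def by blast

lemma K_lift:
  assumes "f \<in> K"
  obtains h where "h \<in> free_mod n (length (sh 1))"
    "\<And>k. k < length (sh 0) \<Longrightarrow> f k = mat_app (length (sh 1)) (D 0) h k"
  using K_eq_image[of f] assms unfolding K_def by blast

lemma ker_D0:
  assumes "f \<in> free_mod n (length (sh 1))"
    and "\<And>k. k < length (sh 0) \<Longrightarrow> mat_app (length (sh 1)) (D 0) f k = 0"
  obtains h where "h \<in> free_mod n (length (sh 2))"
    "\<And>k. k < length (sh 1) \<Longrightarrow> f k = mat_app (length (sh 2)) (D 1) h k"
proof -
  have "\<forall>i. \<forall>f\<in>free_mod n (length (sh (Suc i))).
        (\<forall>k<length (sh i). mat_app (length (sh (Suc i))) (D i) f k = 0) \<longleftrightarrow>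
        (\<exists>h\<in>free_mod n (length (sh (Suc (Suc i)))).
           \<forall>k<length (sh (Suc i)). f k = mat_app (length (sh (Suc (Suc i)))) (D (Suc i)) h k)"
    using res unfolding is_minimal_graded_free_resolution_def is_graded_free_resolution_def by blast
  from this[rule_format, of f 0] assms that show ?thesis by (auto simp: numeral_2_eq_2)
qed

text \<open>As \<open>g j\<close> is homogeneous and R/I has dimension at most one in each degree,
  this scalar is the class of \<open>g j\<close>. It is 0 exactly when \<open>g j\<close> lies in
  I.\<close>

definition gen_coeff :: "nat \<Rightarrow> 'k" where
  "gen_coeff j = toric_coeff a (sh 0 ! j) (g j)"

text \<open>The coefficient at \<open>t\<^sup>s\<close> of the image of f in the monoid algebra,
  counting only the terms of the coordinates \<open>f j\<close> whose monomial satisfies P. Without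
  restriction it is \<open>eps s\<close>, and K is the common kernel of all
  \<open>eps s\<close>.\<close>

definition aug :: "(expo \<Rightarrow> bool) \<Rightarrow> nat^3 \<Rightarrow> (nat \<Rightarrow> 'k mpol) \<Rightarrow> 'k" where
  "aug P s f = (\<Sum>j<length (sh 0).
     pairing (\<lambda>m. of_bool (sdeg a m + sh 0 ! j = s \<and> P m)) (f j) * gen_coeff j)"

abbreviation "eps \<equiv> aug (\<lambda>_. True)"

lemma aug_add: "aug P s (\<lambda>j. f j + h j) = aug P s f + aug P s h"
  by (simp add: aug_def pairing_add distrib_right sum.distrib)

lemma aug_diff: "aug P s (\<lambda>j. f j - h j) = aug P s f - aug P s h"
  by (simp add: aug_def pairing_diff left_diff_distrib sum_subtractf)

lemma aug_sum: "aug P s (\<lambda>j. \<Sum>i\<in>S. f i j) = (\<Sum>i\<in>S. aug P s (f i))"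
  by (induction S rule: infinite_finite_induct) (simp_all add: aug_add, simp_all add: aug_def)

lemma aug_scale: "aug P s (\<lambda>j. single 0 c * f j) = c * aug P s f"
  by (simp add: aug_def pairing_single_mult sum_distrib_left mult.assoc)

lemma aug_cong: "(\<And>j. j < length (sh 0) \<Longrightarrow> f j = h j) \<Longrightarrow> aug P s f = aug P s h"
  by (simp add: aug_def)

lemma eps_eq: "toric_coeff a s (\<Sum>j<length (sh 0). f j * g j) = eps s f"
proof -
  have "toric_coeff a s (f j * g j) =
      pairing (\<lambda>m. of_bool (sdeg a m + sh 0 ! j = s)) (f j) * gen_coeff j"
    if j: "j < length (sh 0)" for j
  proof -
    have inner: "pairing (\<lambda>k. of_bool (sdeg a m + sdeg a k = s)) (g j) =
        gen_coeff j * of_bool (sdeg a m + sh 0 ! j = s)" for m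
    proof -
      have "pairing (\<lambda>k. of_bool (sdeg a m + sdeg a k = s)) (g j) =
          pairing (\<lambda>k. of_bool (sdeg a m + sh 0 ! j = s) * of_bool (sdeg a k = sh 0 ! j)) (g j)"
        using g_homogeneous(2)[OF j] by (intro pairing_cong) auto
      also have "\<dots> = gen_coeff j * of_bool (sdeg a m + sh 0 ! j = s)"
        unfolding pairing_cmul gen_coeff_def toric_coeff_def by (rule mult.commute)
      finally show ?thesis .
    qed
    show ?thesis unfolding toric_coeff_mult inner pairing_cmul by (rule mult.commute)
  qed
  then show ?thesis by (simp add: aug_def toric_coeff_def pairing_sum)
qed

lemma K_iff: "f \<in> K \<longleftrightarrow> f \<in> free_mod n (length (sh 0)) \<and> (\<forall>s. eps s f = 0)"
proof -
  have "keys (\<Sum>j<length (sh 0). f j * g j) \<subseteq> monomials {1..n}"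
    if "f \<in> free_mod n (length (sh 0))"
    using that g_homogeneous(1)
    by (intro carrier_sum carrier_mult, intro carrier_A) (auto simp: free_mod_def)
  then show ?thesis by (auto simp: K_def toric_ideal_iff eps_eq)
qed

lemma K_mult:
  assumes "f \<in> K" "keys p \<subseteq> monomials {n-2..n}"
  shows "(\<lambda>j. p * f j) \<in> K"
proof -
  have "(\<Sum>j<length (sh 0). p * f j * g j) = p * (\<Sum>j<length (sh 0). f j * g j)"
    by (simp add: sum_distrib_left mult.assoc)
  then show ?thesis
    using assms toric_ideal_mult[OF _ carrier_A[OF assms(2)]]
    by (simp add: K_def free_mod_def carrier_mult)
qed

lemma column_in_K:
  assumes "l < length (sh 1)"
  shows "(\<lambda>j. D 0 j l) \<in> K"
proof -
  have 1: "(\<lambda>j. D 0 j l) \<in> free_mod n (length (sh 0))"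
    using D_homogeneous(1)[of _ 0 l] assms by (auto simp: free_mod_def)
  have "D 0 k l = mat_app (length (sh 1)) (D 0) (\<lambda>j. if j = l then 1 else 0) k" for k
    using assms by (simp add: mat_app_def if_distrib cong: if_cong)
  moreover have "(\<lambda>j. if j = l then 1 else 0) \<in> free_mod n (length (sh 1))"
    by (simp add: free_mod_def)
  ultimately show ?thesis using K_eq_image[OF 1] by blast
qed

text \<open>A nonzero \<open>gen_coeff j\<close> provides a monomial of \<open>g j\<close> in its
  degree; its product with m realises the face. This is how terms of \<open>F_0\<close> are compared
  with monomials of R.\<close>

lemma face_of_generator:
  assumes "j < length (sh 0)" "gen_coeff j \<noteq> 0" "m \<in> monomials {n-2..n}"
    "\<And>i. i \<in> F \<Longrightarrow> 0 < lookup m i"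
  shows "face n a (sdeg a m + sh 0 ! j) F"
proof -
  obtain \<gamma> where \<gamma>: "\<gamma> \<in> keys (g j)" "sdeg a \<gamma> = sh 0 ! j"
    using assms(2) unfolding gen_coeff_def by (rule toric_coeff_ex_key)
  then have "m + \<gamma> \<in> monomials {1..n}"
    using g_homogeneous(1)[OF assms(1)] monomials_A[OF assms(3)] by auto
  then show ?thesis
    unfolding face_def using \<gamma> assms(4) by (intro bexI[of _ "m + \<gamma>"]) (auto simp: sdeg_add lookup_add)
qed

text \<open>The class of a monomial is nonzero, so by surjectivity of \<open>F_0\<close> onto R/I
  some term in the same degree, a monomial of A times a basis vector, has nonzero image.\<close>

lemma generator_exists:
  assumes "\<beta> \<in> monomials {1..n}"
  obtains j m where "j < length (sh 0)" "gen_coeff j \<noteq> 0" "m \<in> monomials {n-2..n}"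
    "sdeg a m + sh 0 ! j = sdeg a \<beta>"
proof -
  obtain f where f: "f \<in> free_mod n (length (sh 0))"
    "xpow \<beta> - (\<Sum>j<length (sh 0). f j * g j) \<in> toric_ideal n a"
    using assms surjective[of "xpow \<beta>"] by auto
  then have "toric_coeff a (sdeg a \<beta>) (xpow \<beta>) = eps (sdeg a \<beta>) f"
    by (simp add: toric_ideal_iff toric_coeff_def pairing_diff eps_eq[unfolded toric_coeff_def])
  then have "eps (sdeg a \<beta>) f \<noteq> 0" by (simp add: toric_coeff_xpow)
  then obtain j where j: "j < length (sh 0)" "gen_coeff j \<noteq> 0"
    "pairing (\<lambda>m. of_bool (sdeg a m + sh 0 ! j = sdeg a \<beta>)) (f j) \<noteq> 0"
    unfolding aug_def by (auto elim: sum.not_neutral_contains_not_neutral)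
  have "\<exists>m\<in>keys (f j). sdeg a m + sh 0 ! j = sdeg a \<beta>"
    using j(3) by (rule contrapos_np) (intro pairing_eq_0, auto)
  then show thesis using that j f(1) by (auto simp: free_mod_def)
qed

lemma eps_var_mult: "eps (a i + t) (\<lambda>j. var i * f j) = eps t f"
proof -
  have "sdeg a (pw i 1 + m) + u = a i + t \<longleftrightarrow> sdeg a m + u = t" for m u
    by (simp only: sdeg_add sdeg_pw add.assoc vec_nat_add_cancel)
  then show ?thesis by (simp add: aug_def var_def xpow_def pairing_single_mult)
qed

text \<open>
  The functionals \<open>aug (\<lambda>m. 0 < lookup m v) s\<close>, for isolated vertices \<open>v\<close>, detect \<open>Tor\<^sub>1\<close> in degree
  \<open>s\<close>: they vanish on \<open>\<langle>x\<^sub>n\<^sub>-\<^sub>2, x\<^sub>n\<^sub>-\<^sub>1, x\<^sub>n\<rangle> K\<close>.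
\<close>

lemma aug_var_mult:
  assumes "f \<in> K" "isolated n a s v" "i \<in> {n-2..n}"
  shows "aug (\<lambda>m. 0 < lookup m v) s (\<lambda>j. var i * f j) = 0"
proof (cases "i = v")
  case True
  \<comment> \<open>Every monomial of \<open>var v * f j\<close> is divisible by the variable v, so
    the restriction is vacuous and the functional agrees with \<open>eps s\<close>, which vanishes
    on K.\<close>
  have *: "aug (\<lambda>m. 0 < lookup m v) s (\<lambda>j. var i * f j) = eps s (\<lambda>j. var i * f j)"
    by (simp add: aug_def var_def xpow_def pairing_single_mult True lookup_add lookup_pw)
  show ?thesis
    using K_mult[OF assms(1), of "var i"] assms(3) unfolding *
    by (simp add: K_iff var_def pw_in_monomials)
next
  case False
  have zero: "pairing (\<lambda>m. of_bool (sdeg a m + sh 0 ! j = s \<and> 0 < lookup m v)) (var i * f j)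
      * gen_coeff j = 0" if j: "j < length (sh 0)" for j
  proof (cases "gen_coeff j = 0")
    case c: False
    \<comment> \<open>A term counted here would be divisible by both variables v and i, and together
      with a monomial of \<open>g j\<close> it would make {v, i} an edge.\<close>
    have "\<not> (sdeg a (pw i 1 + m) + sh 0 ! j = s \<and> 0 < lookup (pw i 1 + m) v)" if m: "m \<in> keys (f j)" for m
    proof
      assume *: "sdeg a (pw i 1 + m) + sh 0 ! j = s \<and> 0 < lookup (pw i 1 + m) v"
      have "m \<in> monomials {n-2..n}" using assms(1) j m by (auto simp: K_def free_mod_def)
      then have "face n a (sdeg a (pw i 1 + m) + sh 0 ! j) {v, i}"
        using * assms(3) by (intro face_of_generator j c) (auto simp: pw_in_monomials lookup_add lookup_pw)
      then show False using * assms(2,3) False unfolding isolated_def by auto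
    qed
    then have "pairing (\<lambda>m. of_bool (sdeg a m + sh 0 ! j = s \<and> 0 < lookup m v)) (var i * f j) = 0"
      unfolding var_def xpow_def pairing_single_mult
      by (subst pairing_eq_0) auto
    then show ?thesis by simp
  qed simp
  show ?thesis unfolding aug_def by (intro sum.neutral ballI zero) simp
qed

text \<open>A nonconstant term of p is a variable times a term, and the latter keeps f in K, so
  \<open>aug_var_mult\<close> kills it. Thus on K the functional factors through K modulo <x, y,
  z>K.\<close>

lemma aug_mult:
  assumes f: "f \<in> K" and s: "isolated n a s v" and p: "keys p \<subseteq> monomials {n-2..n}"
  shows "aug (\<lambda>m. 0 < lookup m v) s (\<lambda>j. p * f j) = lookup p 0 * aug (\<lambda>m. 0 < lookup m v) s f"
proof -
  let ?T = "aug (\<lambda>m. 0 < lookup m v) s"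
  have mono: "?T (\<lambda>j. single m (lookup p m) * f j) = (if m = 0 then lookup p 0 * ?T f else 0)"
    if m: "m \<in> keys p" for m
  proof (cases "m = 0")
    case False
    have "m \<in> monomials {n-2..n}" using p m by blast
    obtain i where "i \<in> keys m" using False by (metis ex_in_conv keys_eq_empty)
    then have i: "i \<in> {n-2..n}" "0 < lookup m i"
      using \<open>m \<in> monomials _\<close> unfolding monomials_def by (blast, simp add: in_keys_iff)
    then obtain \<gamma> where \<gamma>: "m = pw i 1 + \<gamma>" using expo_split by blast
    then have "keys (single \<gamma> (lookup p m)) \<subseteq> monomials {n-2..n}"
      using \<open>m \<in> monomials _\<close> by simp
    then have "?T (\<lambda>j. var i * (single \<gamma> (lookup p m) * f j)) = 0"
      by (intro aug_var_mult K_mult f s i)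
    moreover have "var i * (single \<gamma> (lookup p m) * q) = single m (lookup p m) * q" for q :: "'k mpol"
      unfolding mult.assoc[symmetric] by (simp add: \<gamma> var_def xpow_def mult_single)
    ultimately show ?thesis using False by simp
  qed (simp add: aug_scale)
  have "?T (\<lambda>j. p * f j) = ?T (\<lambda>j. \<Sum>m\<in>keys p. single m (lookup p m) * f j)"
    by (simp add: sum_distrib_right[symmetric] sum_singles)
  also have "\<dots> = (\<Sum>m\<in>keys p. if m = 0 then lookup p 0 * ?T f else 0)"
    by (simp add: aug_sum mono)
  also have "\<dots> = lookup p 0 * ?T f" by (auto simp: in_keys_iff)
  finally show ?thesis .
qed

text \<open>The \<open>c l\<close> are the constant terms of a lift of f through \<open>D 0\<close>;
  columns of other degrees contribute nothing by homogeneity. The same c works for all isolated v,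
  which is what the rank argument in \<open>two_shifts_exist\<close> requires.\<close>

lemma aug_K:
  assumes "f \<in> K"
  shows "\<exists>c. \<forall>v. isolated n a s v \<longrightarrow> aug (\<lambda>m. 0 < lookup m v) s f =
    (\<Sum>l\<in>{l. l < length (sh 1) \<and> sh 1 ! l = s}. c l * aug (\<lambda>m. 0 < lookup m v) s (\<lambda>j. D 0 j l))"
proof -
  obtain h where h: "h \<in> free_mod n (length (sh 1))"
    "\<And>k. k < length (sh 0) \<Longrightarrow> f k = mat_app (length (sh 1)) (D 0) h k"
    using K_lift[OF assms] by blast
  have "aug (\<lambda>m. 0 < lookup m v) s f =
    (\<Sum>l\<in>{l. l < length (sh 1) \<and> sh 1 ! l = s}. lookup (h l) 0 * aug (\<lambda>m. 0 < lookup m v) s (\<lambda>j. D 0 j l))"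
    if v: "isolated n a s v" for v
  proof -
    let ?T = "aug (\<lambda>m. 0 < lookup m v) s"
    have "?T f = ?T (\<lambda>k. \<Sum>l<length (sh 1). h l * D 0 k l)"
      using h(2) by (intro aug_cong) (simp add: mat_app_def mult.commute)
    also have "\<dots> = (\<Sum>l<length (sh 1). lookup (h l) 0 * ?T (\<lambda>j. D 0 j l))"
      unfolding aug_sum using h(1)
      by (intro sum.cong aug_mult column_in_K v) (auto simp: free_mod_def)
    also have "\<dots> = (\<Sum>l\<in>{l. l < length (sh 1) \<and> sh 1 ! l = s}. lookup (h l) 0 * ?T (\<lambda>j. D 0 j l))"
    proof (rule sum.mono_neutral_right)
      show "\<forall>l\<in>{..<length (sh 1)} - {l. l < length (sh 1) \<and> sh 1 ! l = s}.
          lookup (h l) 0 * ?T (\<lambda>j. D 0 j l) = 0"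
      proof
        fix l assume l: "l \<in> {..<length (sh 1)} - {l. l < length (sh 1) \<and> sh 1 ! l = s}"
        have "pairing (\<lambda>m. of_bool (sdeg a m + sh 0 ! j = s \<and> 0 < lookup m v)) (D 0 j l) = 0"
          if "j < length (sh 0)" for j
          using D_homogeneous(2)[of j 0 l] that l by (intro pairing_eq_0) auto
        then have "?T (\<lambda>j. D 0 j l) = 0" by (simp add: aug_def)
        then show "lookup (h l) 0 * ?T (\<lambda>j. D 0 j l) = 0" by simp
      qed
    qed auto
    finally show ?thesis .
  qed
  then show ?thesis by (intro exI[of _ "\<lambda>l. lookup (h l) 0"]) blast
qed

section \<open>Lower bounds on the number of shifts\<close>

definition unit_vec :: "nat \<Rightarrow> expo \<Rightarrow> nat \<Rightarrow> 'k mpol" where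
  "unit_vec j m = (\<lambda>i. if i = j then single m (1 / gen_coeff j) else 0)"

text \<open>The factor \<open>1 / gen_coeff j\<close> in \<open>unit_vec\<close> normalises the
  image of the term to a bare power of t, so differences of two such terms of equal degree lie in
  K.\<close>

lemma aug_unit_vec:
  assumes "j < length (sh 0)" "gen_coeff j \<noteq> 0"
  shows "aug P s (unit_vec j m) = of_bool (sdeg a m + sh 0 ! j = s \<and> P m)"
proof -
  have "aug P s (unit_vec j m) = (\<Sum>i<length (sh 0). if i = j then of_bool (sdeg a m + sh 0 ! j = s \<and> P m) else 0)"
    unfolding aug_def using assms(2) by (intro sum.cong) (auto simp: unit_vec_def)
  then show ?thesis using assms(1) by simp
qed

lemma unit_vec_free_mod:
  "m \<in> monomials {n-2..n} \<Longrightarrow> unit_vec j m \<in> free_mod n r"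
  by (simp add: free_mod_def unit_vec_def)

text \<open>Take two terms of \<open>F_0\<close> in degree s with the same image, one divisible by v
  and one by w, and subtract. An isolated u divides the first only if u = v and the second only if u
  = w, since otherwise it would lie on an edge. Neither v nor w has to be isolated.\<close>

lemma kernel_witness:
  assumes "v \<in> {n-2..n}" "w \<in> {n-2..n}" "v \<noteq> w" "face n a s {v}" "face n a s {w}"
  shows "\<exists>f\<in>K. \<forall>u\<in>{n-2..n}. isolated n a s u \<longrightarrow>
    aug (\<lambda>m. 0 < lookup m u) s f = of_bool (u = v) - of_bool (u = w)"
proof -
  have ex: "\<exists>j m. j < length (sh 0) \<and> gen_coeff j \<noteq> 0 \<and> m \<in> monomials {n-2..n} \<and>
      0 < lookup m i \<and> sdeg a m + sh 0 ! j = s" if i: "i \<in> {n-2..n}" "face n a s {i}" for i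
  proof -
    obtain \<beta> where \<beta>: "\<beta> \<in> monomials {1..n}" "sdeg a \<beta> = s" "0 < lookup \<beta> i"
      using i(2) unfolding face_def by auto
    obtain \<gamma> where \<gamma>: "\<beta> = pw i 1 + \<gamma>" using expo_split[OF \<beta>(3)] by blast
    then obtain j m where jm: "j < length (sh 0)" "gen_coeff j \<noteq> 0" "m \<in> monomials {n-2..n}"
      "sdeg a m + sh 0 ! j = sdeg a \<gamma>"
      using generator_exists[of \<gamma>] \<beta>(1) by auto
    have "sdeg a (pw i 1 + m) + sh 0 ! j = s"
      using jm(4) \<gamma> \<beta>(2) by (simp only: sdeg_add add.assoc)
    then show ?thesis using jm i(1)
      by (intro exI[of _ j] exI[of _ "pw i 1 + m"]) (simp add: pw_in_monomials lookup_add lookup_pw)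
  qed
  obtain j m where jm: "j < length (sh 0)" "gen_coeff j \<noteq> 0" "m \<in> monomials {n-2..n}"
    "0 < lookup m v" "sdeg a m + sh 0 ! j = s" using ex[OF assms(1,4)] by blast
  obtain j' m' where jm': "j' < length (sh 0)" "gen_coeff j' \<noteq> 0" "m' \<in> monomials {n-2..n}"
    "0 < lookup m' w" "sdeg a m' + sh 0 ! j' = s" using ex[OF assms(2,5)] by blast
  have other: "lookup m u = 0" if "isolated n a s u" "u \<in> {n-2..n}" "u \<noteq> v" for u
  proof (rule ccontr)
    assume "lookup m u \<noteq> 0"
    then have "face n a (sdeg a m + sh 0 ! j) {u, v}"
      using jm by (intro face_of_generator) auto
    then show False using that assms(1) jm(5) unfolding isolated_def by auto
  qed
  have other': "lookup m' u = 0" if "isolated n a s u" "u \<in> {n-2..n}" "u \<noteq> w" for u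
  proof (rule ccontr)
    assume "lookup m' u \<noteq> 0"
    then have "face n a (sdeg a m' + sh 0 ! j') {u, w}"
      using jm' by (intro face_of_generator) auto
    then show False using that assms(2) jm'(5) unfolding isolated_def by auto
  qed
  let ?f = "\<lambda>i. unit_vec j m i - unit_vec j' m' i"
  have aug: "aug P t ?f = of_bool (s = t \<and> P m) - of_bool (s = t \<and> P m')" for P t
    unfolding aug_diff aug_unit_vec[OF jm(1,2)] aug_unit_vec[OF jm'(1,2)] jm(5) jm'(5) ..
  have "?f \<in> free_mod n (length (sh 0))"
    using unit_vec_free_mod[OF jm(3), of j "length (sh 0)"]
      unit_vec_free_mod[OF jm'(3), of j' "length (sh 0)"]
    by (auto simp: free_mod_def carrier_diff)
  then have "?f \<in> K" unfolding K_iff aug by simp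
  moreover have "aug (\<lambda>m. 0 < lookup m u) s ?f = of_bool (u = v) - of_bool (u = w)"
    if "u \<in> {n-2..n}" "isolated n a s u" for u
  proof -
    have "0 < lookup m u \<longleftrightarrow> u = v" using other[OF that(2,1)] jm(4) by (cases "u = v") simp_all
    moreover have "0 < lookup m' u \<longleftrightarrow> u = w" using other'[OF that(2,1)] jm'(4) by (cases "u = w") simp_all
    ultimately show ?thesis by (simp add: aug)
  qed
  ultimately show ?thesis by blast
qed

text \<open>The functional at v is 1 on the witness for v and w; without a column of degree s,
  \<open>aug_K\<close> would express it as an empty sum.\<close>

lemma shift_exists:
  assumes "v \<in> {n-2..n}" "w \<in> {n-2..n}" "v \<noteq> w" "face n a s {v}" "face n a s {w}"
    and "isolated n a s v"
  shows "\<exists>l<length (sh 1). sh 1 ! l = s"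
proof (rule ccontr)
  assume "\<not> ?thesis"
  then have empty: "{l. l < length (sh 1) \<and> sh 1 ! l = s} = {}" by blast
  obtain f where f: "f \<in> K" "aug (\<lambda>m. 0 < lookup m v) s f = of_bool (v = v) - of_bool (v = w)"
    using kernel_witness[OF assms(1-5)] assms(1,6) by blast
  have "aug (\<lambda>m. 0 < lookup m v) s f = 0"
    using aug_K[OF f(1), of s] assms(6) unfolding empty by auto
  then show False using f(2) assms(3) by simp
qed

text \<open>With a single column of degree s, the triples of values of the three functionals on K
  would all be multiples of one triple. But one element of K has values 1, -1, 0 at x, y, z, and
  another has 1 at x and -1 at z.\<close>

lemma two_shifts_exist:
  assumes V: "{x, y, z} \<subseteq> {n-2..n}" "x \<noteq> y" "x \<noteq> z" "y \<noteq> z"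
    and face: "face n a s {x}" "face n a s {y}" "face n a s {z}"
    and iso: "isolated n a s x" "isolated n a s y" "isolated n a s z"
  shows "\<exists>l l'. l \<noteq> l' \<and> l < length (sh 1) \<and> l' < length (sh 1) \<and> sh 1 ! l = s \<and> sh 1 ! l' = s"
proof (rule ccontr)
  let ?S = "{l. l < length (sh 1) \<and> sh 1 ! l = s}"
  let ?T = "\<lambda>v. aug (\<lambda>m. 0 < lookup m v) s"
  assume no: "\<not> ?thesis"
  obtain l0 where l0: "l0 < length (sh 1)" "sh 1 ! l0 = s"
    using shift_exists[of x y s] assms by auto
  have S: "?S = {l0}" using no l0 by blast
  have lin: "\<exists>c. \<forall>v\<in>{x,y,z}. ?T v f = c * ?T v (\<lambda>j. D 0 j l0)" if f: "f \<in> K" for f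
  proof -
    obtain c where "\<forall>v. isolated n a s v \<longrightarrow> ?T v f = (\<Sum>l\<in>?S. c l * ?T v (\<lambda>j. D 0 j l))"
      using aug_K[OF f, of s] by blast
    then show ?thesis using iso unfolding S by (intro exI[of _ "c l0"]) auto
  qed
  have A: "x \<in> {n-2..n}" "y \<in> {n-2..n}" "z \<in> {n-2..n}" using V(1) by auto
  have "\<exists>f\<in>K. ?T x f = 1 \<and> ?T y f = - 1 \<and> ?T z f = 0"
    using kernel_witness[OF A(1,2) V(2) face(1,2)] A iso V(2-4) by fastforce
  then obtain f where f: "f \<in> K" "?T x f = 1" "?T y f = - 1" "?T z f = 0" by blast
  have "\<exists>f\<in>K. ?T x f = 1 \<and> ?T z f = - 1"
    using kernel_witness[OF A(1,3) V(3) face(1,3)] A iso V(2-4) by fastforce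
  then obtain h where h: "h \<in> K" "?T x h = 1" "?T z h = - 1" by blast
  obtain c where c: "?T v f = c * ?T v (\<lambda>j. D 0 j l0)" if "v \<in> {x,y,z}" for v
    using lin[OF f(1)] by blast
  obtain d where d: "?T v h = d * ?T v (\<lambda>j. D 0 j l0)" if "v \<in> {x,y,z}" for v
    using lin[OF h(1)] by blast
  have "c \<noteq> 0" using c[of x] f(2) by auto
  then have "?T z (\<lambda>j. D 0 j l0) = 0" using c[of z] f(4) by simp
  then show False using d[of z] h(3) by simp
qed

section \<open>Absence of shifts when one vertex is joined to both others\<close>

definition homogeneous :: "nat^3 \<Rightarrow> (nat \<Rightarrow> 'k mpol) \<Rightarrow> bool" where
  "homogeneous d f \<longleftrightarrow> f \<in> free_mod n (length (sh 0)) \<and>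
    (\<forall>j<length (sh 0). \<forall>\<alpha>\<in>keys (f j). sdeg a \<alpha> + sh 0 ! j = d)"

lemma homogeneous_add:
  assumes "homogeneous d f" "homogeneous d h"
  shows "homogeneous d (\<lambda>j. f j + h j)"
  unfolding homogeneous_def
proof (intro conjI allI impI ballI)
  show "(\<lambda>j. f j + h j) \<in> free_mod n (length (sh 0))"
    using assms by (simp add: homogeneous_def free_mod_def carrier_add)
  show "sdeg a \<alpha> + sh 0 ! j = d" if "j < length (sh 0)" "\<alpha> \<in> keys (f j + h j)" for j \<alpha>
    using keys_add[of "f j" "h j"] assms that unfolding homogeneous_def by blast
qed

lemma homogeneous_scale:
  assumes "homogeneous d f"
  shows "homogeneous d (\<lambda>j. single 0 c * f j)"
proof -
  have sub: "keys (single 0 c * p) \<subseteq> keys p" for p :: "'k mpol"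
    using keys_mult[of "single 0 c" p] by (auto split: if_splits)
  show ?thesis
    unfolding homogeneous_def
  proof (intro conjI allI impI ballI)
    show "(\<lambda>j. single 0 c * f j) \<in> free_mod n (length (sh 0))"
      using assms by (simp add: homogeneous_def free_mod_def carrier_mult)
    show "sdeg a \<alpha> + sh 0 ! j = d" if "j < length (sh 0)" "\<alpha> \<in> keys (single 0 c * f j)" for j \<alpha>
      using sub assms that unfolding homogeneous_def by blast
  qed
qed

text \<open>In all degrees other than d the image vanishes, so membership in K is one scalar
  equation. It can be enforced by adding a multiple of an element with \<open>eps d\<close> equal to
  1.\<close>

lemma homogeneous_K: "homogeneous d f \<Longrightarrow> eps d f = 0 \<Longrightarrow> f \<in> K"
proof -
  assume f: "homogeneous d f" "eps d f = 0"
  have "eps s f = 0" if "s \<noteq> d" for s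
    unfolding aug_def using f(1) that
    by (intro sum.neutral ballI) (auto simp: homogeneous_def intro!: pairing_eq_0)
  then show "f \<in> K" using f unfolding K_iff homogeneous_def by metis
qed

lemma homogeneous_unit_vec:
  assumes "m \<in> monomials {n-2..n}" "sdeg a m + sh 0 ! j = d"
  shows "homogeneous d (unit_vec j m)"
  using assms unit_vec_free_mod[OF assms(1)] by (auto simp: homogeneous_def unit_vec_def)

text \<open>Divide a monomial realising the edge by both variables and represent the quotient by a
  term of \<open>F_0\<close>. Multiplying this term by w gives E and by v gives E'.\<close>

lemma edge_syzygy:
  assumes "face n a s {v, w}" "v \<noteq> w" "v \<in> {n-2..n}" "w \<in> {n-2..n}" "a v + t = s" "a w + t' = s"
  obtains E E' where "homogeneous t E" "eps t E = 1" "homogeneous t' E'" "eps t' E' = 1"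
    "\<And>j. var v * E j = var w * E' j"
proof -
  obtain \<beta> where \<beta>: "\<beta> \<in> monomials {1..n}" "sdeg a \<beta> = s" "0 < lookup \<beta> v" "0 < lookup \<beta> w"
    using assms(1) unfolding face_def by auto
  obtain \<gamma> where \<gamma>: "\<beta> = pw v 1 + (pw w 1 + \<gamma>)" using expo_split2[OF \<beta>(3,4) assms(2)] by blast
  then obtain j m where jm: "j < length (sh 0)" "gen_coeff j \<noteq> 0" "m \<in> monomials {n-2..n}"
    "sdeg a m + sh 0 ! j = sdeg a \<gamma>"
    using generator_exists[of \<gamma>] \<beta>(1) by auto
  have s: "a v + (a w + sdeg a \<gamma>) = s" using \<gamma> \<beta>(2) by (simp only: sdeg_add sdeg_pw)
  then have "a v + (a w + sdeg a \<gamma>) = a v + t" using assms(5) by simp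
  then have t: "sdeg a (pw w 1 + m) + sh 0 ! j = t"
    using jm(4) by (simp only: sdeg_add sdeg_pw add.assoc vec_nat_add_cancel)
  have "a w + (a v + sdeg a \<gamma>) = a w + t'" using s assms(6) by (simp only: add.left_commute)
  then have t': "sdeg a (pw v 1 + m) + sh 0 ! j = t'"
    using jm(4) by (simp only: sdeg_add sdeg_pw add.assoc vec_nat_add_cancel)
  have mon: "pw w 1 + m \<in> monomials {n-2..n}" "pw v 1 + m \<in> monomials {n-2..n}"
    using jm(3) assms(3,4) by (simp_all add: pw_in_monomials)
  show thesis
  proof (rule that[of "unit_vec j (pw w 1 + m)" "unit_vec j (pw v 1 + m)"])
    show "var v * unit_vec j (pw w 1 + m) i = var w * unit_vec j (pw v 1 + m) i" for i
      by (simp add: unit_vec_def var_def xpow_def mult_single add.left_commute)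
  qed (use t t' mon jm in \<open>simp_all add: aug_unit_vec homogeneous_unit_vec\<close>)
qed

text \<open>Write a column of degree s as x Q_x + y Q_y + z Q_z. The values of eps on the three
  parts sum to 0 because the column lies in K. The edges at x allow the values at y and z to be
  moved to x without changing the column, after which all three parts lie in K. So the column lies
  in <x, y, z>K, contradicting minimality of the resolution.\<close>

lemma no_shift:
  assumes xyz: "{n-2,n-1,n} = {x,y,z}" "x \<noteq> y" "x \<noteq> z" "y \<noteq> z"
    and face: "face n a s {x, y}" "face n a s {x, z}"
  shows "\<not> (\<exists>l<length (sh 1). sh 1 ! l = s)"
proof
  assume "\<exists>l<length (sh 1). sh 1 ! l = s"
  then obtain l where l: "l < length (sh 1)" "sh 1 ! l = s" by blast
  have "x \<in> {n-2,n-1,n}" "y \<in> {n-2,n-1,n}" "z \<in> {n-2,n-1,n}" using xyz by blast+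
  then have A: "x \<in> {n-2..n}" "y \<in> {n-2..n}" "z \<in> {n-2..n}" using n3 by auto
  have t_ex: "\<exists>t. a i + t = s" if F: "face n a s F" "i \<in> F" for i F
  proof -
    obtain \<beta> where "sdeg a \<beta> = s" "0 < lookup \<beta> i" using F unfolding face_def by blast
    then obtain \<gamma> where "\<beta> = pw i 1 + \<gamma>" using expo_split by blast
    then show ?thesis using \<open>sdeg a \<beta> = s\<close> by (intro exI[of _ "sdeg a \<gamma>"]) (simp only: sdeg_add sdeg_pw)
  qed
  obtain tx where tx: "a x + tx = s" using t_ex face by blast
  obtain ty where ty: "a y + ty = s" using t_ex face by blast
  obtain tz where tz: "a z + tz = s" using t_ex face by blast
  have "\<exists>q. D 0 j l = (\<Sum>i\<in>{x,y,z}. var i * q i) \<and>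
      (\<forall>i. \<forall>\<alpha>\<in>keys (q i). pw i 1 + \<alpha> \<in> keys (D 0 j l))" if "j < length (sh 0)" for j
    using D_minimal[OF that, of l] l(1) unfolding xyz(1)
    by (intro split_by_variables) simp_all
  then have "\<forall>j. \<exists>q. j < length (sh 0) \<longrightarrow> D 0 j l = (\<Sum>i\<in>{x,y,z}. var i * q i) \<and>
      (\<forall>i. \<forall>\<alpha>\<in>keys (q i). pw i 1 + \<alpha> \<in> keys (D 0 j l))" by blast
  from choice[OF this] obtain Q where
    "\<forall>j. j < length (sh 0) \<longrightarrow> D 0 j l = (\<Sum>i\<in>{x,y,z}. var i * Q j i) \<and>
      (\<forall>i. \<forall>\<alpha>\<in>keys (Q j i). pw i 1 + \<alpha> \<in> keys (D 0 j l))" by blast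
  then have Q:
    "\<And>j. j < length (sh 0) \<Longrightarrow> D 0 j l = (\<Sum>i\<in>{x,y,z}. var i * Q j i)"
    "\<And>j i \<alpha>. j < length (sh 0) \<Longrightarrow> \<alpha> \<in> keys (Q j i) \<Longrightarrow> pw i 1 + \<alpha> \<in> keys (D 0 j l)"
    by blast+
  have hom: "homogeneous t (\<lambda>j. Q j i)" if "a i + t = s" for i t
    unfolding homogeneous_def free_mod_def
  proof (intro conjI CollectI allI impI ballI)
    fix j assume j: "j < length (sh 0)"
    have "\<alpha> \<in> monomials {n-2..n}" if "\<alpha> \<in> keys (Q j i)" for \<alpha>
    proof -
      have "pw i 1 + \<alpha> \<in> monomials {n-2..n}"
        using Q(2)[OF j that] D_homogeneous(1)[OF j, of l] l(1) by auto
      then show ?thesis by (simp only: monomials_add_iff)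
    qed
    then show "Q j i \<in> carrier (Ar n)" by auto
    fix \<alpha> assume "\<alpha> \<in> keys (Q j i)"
    then have "sdeg a (pw i 1 + \<alpha>) + sh 0 ! j = a i + t"
      using Q(2)[OF j] D_homogeneous(2)[of j 0 l] j l that by simp
    then show "sdeg a \<alpha> + sh 0 ! j = t"
      by (simp only: sdeg_add sdeg_pw add.assoc vec_nat_add_cancel)
  qed
  define ex where "ex = eps tx (\<lambda>j. Q j x)"
  define ey where "ey = eps ty (\<lambda>j. Q j y)"
  define ez where "ez = eps tz (\<lambda>j. Q j z)"
  have "eps s (\<lambda>j. D 0 j l) = eps s (\<lambda>j. var x * Q j x + (var y * Q j y + var z * Q j z))"
    using Q(1) xyz(2-4) by (intro aug_cong) simp
  also have "\<dots> = ex + (ey + ez)"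
    unfolding aug_add ex_def ey_def ez_def
    using eps_var_mult[of x tx] eps_var_mult[of y ty] eps_var_mult[of z tz] tx ty tz by simp
  finally have sum0: "ex + (ey + ez) = 0" using column_in_K[OF l(1)] by (simp add: K_iff)
  obtain Exy Eyx where Ey: "homogeneous tx Exy" "eps tx Exy = 1" "homogeneous ty Eyx" "eps ty Eyx = 1"
    "\<And>j. var x * Exy j = var y * Eyx j"
    using edge_syzygy[OF face(1) xyz(2) A(1,2) tx ty] by blast
  obtain Exz Ezx where Ez: "homogeneous tx Exz" "eps tx Exz = 1" "homogeneous tz Ezx" "eps tz Ezx = 1"
    "\<And>j. var x * Exz j = var z * Ezx j"
    using edge_syzygy[OF face(2) xyz(3) A(1,3) tx tz] by blast
  \<comment> \<open>The values \<open>ey\<close> and \<open>ez\<close> are moved to the x-part,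
    which then has value \<open>ex + (ey + ez) = 0\<close>. The corrections cancel in the total
    since \<open>var x * Exy j = var y * Eyx j\<close>, and likewise for z.\<close>
  define Px where "Px = (\<lambda>j. Q j x + (single 0 ey * Exy j + single 0 ez * Exz j))"
  define Py where "Py = (\<lambda>j. Q j y + single 0 (- ey) * Eyx j)"
  define Pz where "Pz = (\<lambda>j. Q j z + single 0 (- ez) * Ezx j)"
  have Px: "Px \<in> K"
  proof (rule homogeneous_K)
    show "homogeneous tx Px" unfolding Px_def
      by (intro homogeneous_add homogeneous_scale hom Ey Ez tx)
    show "eps tx Px = 0" unfolding Px_def aug_add aug_scale Ey Ez ex_def[symmetric] using sum0 by simp
  qed
  have Py: "Py \<in> K"
  proof (rule homogeneous_K)
    show "homogeneous ty Py" unfolding Py_def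
      by (intro homogeneous_add homogeneous_scale hom Ey Ez ty)
    show "eps ty Py = 0" unfolding Py_def aug_add aug_scale Ey Ez ey_def[symmetric] by simp
  qed
  have Pz: "Pz \<in> K"
  proof (rule homogeneous_K)
    show "homogeneous tz Pz" unfolding Pz_def
      by (intro homogeneous_add homogeneous_scale hom Ey Ez tz)
    show "eps tz Pz = 0" unfolding Pz_def aug_add aug_scale Ey Ez ez_def[symmetric] by simp
  qed
  obtain hx where hx: "hx \<in> free_mod n (length (sh 1))"
    "\<And>k. k < length (sh 0) \<Longrightarrow> Px k = mat_app (length (sh 1)) (D 0) hx k"
    using K_lift[OF Px] by blast
  obtain hy where hy: "hy \<in> free_mod n (length (sh 1))"
    "\<And>k. k < length (sh 0) \<Longrightarrow> Py k = mat_app (length (sh 1)) (D 0) hy k"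
    using K_lift[OF Py] by blast
  obtain hz where hz: "hz \<in> free_mod n (length (sh 1))"
    "\<And>k. k < length (sh 0) \<Longrightarrow> Pz k = mat_app (length (sh 1)) (D 0) hz k"
    using K_lift[OF Pz] by blast
  \<comment> \<open>The l-th basis vector minus the lift of the rewritten column: an element of the
    kernel of \<open>D 0\<close>.\<close>
  define r where "r = (\<lambda>i. (if i = l then 1 else 0) - (var x * hx i + (var y * hy i + var z * hz i)))"
  have vA: "keys (var i :: 'k mpol) \<subseteq> monomials {n-2..n}" if "i \<in> {n-2..n}" for i
    using that by (simp add: var_def pw_in_monomials)
  have "r \<in> free_mod n (length (sh 1))"
    unfolding r_def free_mod_def
  proof (intro CollectI allI impI)
    fix i assume "i < length (sh 1)"
    then show "(if i = l then 1 else 0) - (var x * hx i + (var y * hy i + var z * hz i)) \<in> carrier (Ar n)"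
      unfolding poly_ring_simps mem_Collect_eq
      using hx(1) hy(1) hz(1) vA A
      by (intro carrier_diff carrier_add carrier_mult) (auto simp: free_mod_def)
  qed
  moreover have "mat_app (length (sh 1)) (D 0) r k = 0" if k: "k < length (sh 0)" for k
  proof -
    have "mat_app (length (sh 1)) (D 0) r k =
      (\<Sum>i<length (sh 1). D 0 k i * (if i = l then 1 else 0)) -
      (var x * mat_app (length (sh 1)) (D 0) hx k +
      (var y * mat_app (length (sh 1)) (D 0) hy k + var z * mat_app (length (sh 1)) (D 0) hz k))"
      unfolding mat_app_def r_def sum_distrib_left sum.distrib[symmetric] sum_subtractf[symmetric]
      by (intro sum.cong refl) (simp add: right_diff_distrib distrib_left mult.left_commute)
    also have "(\<Sum>i<length (sh 1). D 0 k i * (if i = l then 1 else 0)) = D 0 k l"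
      using l(1) by (simp add: if_distrib cong: if_cong)
    also have "\<dots> = var x * Q k x + (var y * Q k y + var z * Q k z)"
      using Q(1)[OF k] xyz(2-4) by simp
    also have "var x * Q k x + (var y * Q k y + var z * Q k z) - (var x * mat_app (length (sh 1)) (D 0) hx k +
      (var y * mat_app (length (sh 1)) (D 0) hy k + var z * mat_app (length (sh 1)) (D 0) hz k)) =
      - (single 0 ey * (var x * Exy k - var y * Eyx k) + single 0 ez * (var x * Exz k - var z * Ezx k))"
      unfolding hx(2)[OF k, symmetric] hy(2)[OF k, symmetric] hz(2)[OF k, symmetric] Px_def Py_def Pz_def
      by (simp add: algebra_simps single_uminus)
    also have "\<dots> = 0" using Ey(5) Ez(5) by simp
    finally show ?thesis .
  qed
  ultimately obtain h where h: "h \<in> free_mod n (length (sh 2))"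
    "\<And>k. k < length (sh 1) \<Longrightarrow> r k = mat_app (length (sh 2)) (D 1) h k"
    using ker_D0 by blast
  have var0: "lookup (var i * p) 0 = 0" for i and p :: "'k mpol"
    by (rule lookup_mult_0) (simp add: var_def xpow_def lookup_single when_def pw_eq_0_iff)
  \<comment> \<open>By exactness r lies in the image of \<open>D 1\<close>, whose entries have no
    constant term, so a constant term 1 at l is impossible.\<close>
  have "lookup (r l) 0 = 1"
    unfolding r_def by (simp add: lookup_minus lookup_add var0)
  moreover have "lookup (D 1 l k * h k) 0 = 0" if "k < length (sh 2)" for k
  proof (rule lookup_mult_0, rule ccontr)
    assume "lookup (D 1 l k) 0 \<noteq> 0"
    then have "0 \<in> keys (D 1 l k)" by (simp add: in_keys_iff)
    then show False using D_minimal[of l 1 k 0] l(1) that by (auto simp: numeral_2_eq_2)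
  qed
  ultimately show False using h(2)[OF l(1)] by (simp add: mat_app_def lookup_sum)
qed

end

section \<open>Division by a Groebner basis\<close>

lemma lookup_eq_pairing: "lookup p \<nu> = pairing (\<lambda>m. of_bool (m = \<nu>)) p"
proof -
  have "pairing (\<lambda>m. of_bool (m = \<nu>)) p = (\<Sum>m\<in>insert \<nu> (keys p). lookup p m * of_bool (m = \<nu>))"
    by (rule pairing_superset) auto
  also have "\<dots> = (\<Sum>m\<in>insert \<nu> (keys p). if m = \<nu> then lookup p \<nu> else 0)"
    by (intro sum.cong) auto
  finally show ?thesis by simp
qed

lemma lookup_single_mult:
  fixes p :: "'k::field mpol"
  shows "lookup (single \<gamma> c * p) (\<gamma> + \<nu>) = c * lookup p \<nu>"
  unfolding lookup_eq_pairing pairing_single_mult by simp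

lemma keys_single_mult: "\<mu> \<in> keys (single \<gamma> c * p) \<Longrightarrow> \<exists>\<nu>\<in>keys p. \<mu> = \<gamma> + \<nu>"
  using keys_mult[of "single \<gamma> c" p] by (auto split: if_splits)

text \<open>Positive weights bound every exponent by N. Both the termination of division and the
  existence of normal forms rest on this finiteness.\<close>

lemma finite_bounded_wdeg:
  assumes "\<And>i. i \<in> {1..n} \<Longrightarrow> 0 < \<omega> i"
  shows "finite {\<mu> \<in> monomials {1..n}. wdeg \<omega> \<mu> \<le> N}"
proof -
  let ?S = "{\<mu> \<in> monomials {1..n}. wdeg \<omega> \<mu> \<le> N}"
  have "lookup \<mu> i \<le> N" if "\<mu> \<in> ?S" for \<mu> i
  proof (cases "i \<in> keys \<mu>")
    case True
    then have "0 < \<omega> i" using that assms by (auto simp: monomials_def)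
    then have "lookup \<mu> i \<le> \<omega> i * lookup \<mu> i" by simp
    also have "\<dots> \<le> wdeg \<omega> \<mu>"
      unfolding wdeg_def using True by (intro member_le_sum) auto
    finally show ?thesis using that by simp
  qed (simp add: in_keys_iff)
  moreover have "lookup \<mu> i = 0" if "\<mu> \<in> ?S" "i \<notin> {1..n}" for \<mu> i
    using that by (auto simp: monomials_def not_in_keys_iff_lookup_eq_zero)
  ultimately have "lookup ` ?S \<subseteq> {f. \<forall>i. (i \<in> {1..n} \<longrightarrow> f i \<in> {0..N}) \<and> (i \<notin> {1..n} \<longrightarrow> f i = 0)}"
    by auto
  then have "finite (lookup ` ?S)"
    by (rule finite_subset) (intro finite_set_of_finite_funs finite_atLeastAtMost)
  then show ?thesis
    by (rule finite_imageD) (auto intro: inj_onI poly_mapping_eqI)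
qed

lemma wdeg_mon_gt: "mon_gt \<omega> \<alpha> \<beta> \<Longrightarrow> wdeg \<omega> \<beta> \<le> wdeg \<omega> \<alpha>"
  unfolding mon_gt_def by linarith

text \<open>The reflexive order, with the larger monomial first. It is the bound in
  \<open>is_remainder\<close> when the dividend is the single monomial \<alpha>.\<close>

definition not_above :: "(nat \<Rightarrow> nat) \<Rightarrow> expo \<Rightarrow> expo \<Rightarrow> bool" where
  "not_above \<omega> \<alpha> \<mu> \<longleftrightarrow> \<mu> = \<alpha> \<or> mon_gt \<omega> \<alpha> \<mu>"

lemma not_above_trans: "not_above \<omega> \<alpha> \<beta> \<Longrightarrow> not_above \<omega> \<beta> \<gamma> \<Longrightarrow> not_above \<omega> \<alpha> \<gamma>"
  unfolding not_above_def using mon_gt_trans by blast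

text \<open>Every intermediate polynomial stays in I, so its leading monomial is divisible by that
  of some element of G and no remainder arises. The bound \<alpha> is independent of f so that it
  survives the induction; it is later the dividend \<beta>, while f is the binomial of \<beta> and
  its normal form.\<close>

lemma division:
  fixes f :: "'k::field mpol"
  assumes pos: "\<And>i. i \<in> {1..n} \<Longrightarrow> 0 < \<omega> i"
    and G: "finite G" "G \<subseteq> toric_ideal n a"
      "initial_ideal n \<omega> G = initial_ideal n \<omega> (toric_ideal n a)"
      "\<And>g. g \<in> G \<Longrightarrow> g \<noteq> 0 \<and> lookup g (lead \<omega> g) = 1"
    and f: "f \<in> toric_ideal n a" "\<And>\<mu>. \<mu> \<in> keys f \<Longrightarrow> not_above \<omega> \<alpha> \<mu>"
  shows "\<exists>q. (\<forall>g\<in>G. q g \<in> carrier (Rr n) \<and> (\<forall>\<mu>\<in>keys (q g * g). not_above \<omega> \<alpha> \<mu>)) \<and>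
    f = (\<Sum>g\<in>G. q g * g)"
  using f
\<comment> \<open>The measure counts the monomials not above \<open>lead \<omega> f\<close>. It is
  positive for f \<noteq> 0, since the leading monomial counts itself, so 0 is a safe value at f =
  0, where \<open>lead\<close> has no meaning.\<close>
proof (induction "if f = 0 then 0 else card {\<mu> \<in> monomials {1..n}. not_above \<omega> (lead \<omega> f) \<mu>}"
    arbitrary: f rule: less_induct)
  case (less f)
  show ?case
  proof (cases "f = 0")
    case True
    then show ?thesis by (intro exI[of _ "\<lambda>_. 0"]) simp
  next
    case False
    let ?below = "\<lambda>l. {\<mu> \<in> monomials {1..n}. not_above \<omega> l \<mu>}"
    define l where "l = lead \<omega> f"
    define c where "c = lookup f l"
    have l: "l \<in> keys f" "\<And>\<beta>. \<beta> \<in> keys f \<Longrightarrow> \<beta> \<noteq> l \<Longrightarrow> mon_gt \<omega> l \<beta>"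
      using lead_props[OF False, of \<omega>] unfolding l_def by blast+
    have lmon: "l \<in> monomials {1..n}" using l(1) less.prems(1) unfolding toric_ideal_iff by blast
    have "xpow l \<in> initial_ideal n \<omega> (toric_ideal n a :: 'k mpol set)"
      unfolding xpow_in_initial_ideal[OF toric_ideal_subset]
      using less.prems(1) False lmon l_def by (metis add.right_neutral)
    moreover have "G \<subseteq> carrier (Rr n)" using G(2) toric_ideal_subset by blast
    ultimately obtain g0 \<gamma> where g0: "g0 \<in> G" "l = lead \<omega> g0 + \<gamma>"
      unfolding G(3)[symmetric] using xpow_in_initial_ideal by blast
    have g0': "g0 \<noteq> 0" "lookup g0 (lead \<omega> g0) = 1" using G(4) g0(1) by blast+
    have \<gamma>: "\<gamma> \<in> monomials {1..n}" using lmon g0(2) by simp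
    let ?t = "single \<gamma> c"
    have lead_le: "\<mu> = l \<or> mon_gt \<omega> l \<mu>" if \<mu>: "\<mu> \<in> keys (?t * g0)" for \<mu>
    proof -
      obtain \<nu> where \<nu>: "\<nu> \<in> keys g0" "\<mu> = \<gamma> + \<nu>" using keys_single_mult[OF \<mu>] by blast
      show ?thesis
      proof (cases "\<nu> = lead \<omega> g0")
        case True
        then show ?thesis using \<nu>(2) g0(2) by (simp add: add.commute)
      next
        case False
        then have "mon_gt \<omega> (lead \<omega> g0) \<nu>" using lead_props[OF g0'(1), of \<omega>] \<nu>(1) by blast
        then have "mon_gt \<omega> (\<gamma> + lead \<omega> g0) (\<gamma> + \<nu>)" by (simp only: mon_gt_add_left)
        then show ?thesis using \<nu>(2) g0(2) by (simp add: add.commute)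
      qed
    qed
    let ?f = "f - ?t * g0"
    have tcar: "keys ?t \<subseteq> monomials {1..n}" using \<gamma> by simp
    have fI: "?f \<in> toric_ideal n a"
      using less.prems(1) g0(1) G(2) tcar by (intro toric_ideal_diff toric_ideal_mult) auto
    have "lookup (?t * g0) l = c"
      using lookup_single_mult[of \<gamma> c g0 "lead \<omega> g0"] g0(2) g0'(2) by (simp add: add.commute)
    then have no_l: "l \<notin> keys ?f" by (simp add: in_keys_iff lookup_minus c_def)
    have below: "mon_gt \<omega> l \<mu>" if \<mu>: "\<mu> \<in> keys ?f" for \<mu>
    proof -
      have "\<mu> \<in> keys f \<or> \<mu> \<in> keys (?t * g0)"
        using \<mu> keys_add[of f "- (?t * g0)"] by auto
      moreover have "\<mu> \<noteq> l" using \<mu> no_l by blast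
      ultimately show ?thesis using l(2) lead_le by blast
    qed
    have l\<alpha>: "not_above \<omega> \<alpha> l" using less.prems(2) l(1) .
    have fin: "finite (?below l)"
      using finite_bounded_wdeg[where N = "wdeg \<omega> l", OF pos]
      by (rule finite_subset[rotated]) (auto simp: not_above_def dest: wdeg_mon_gt)
    have pos_card: "0 < card (?below l)"
      using fin lmon by (auto simp: card_gt_0_iff not_above_def)
    have smaller: "(if ?f = 0 then 0 else card (?below (lead \<omega> ?f))) < (if f = 0 then 0 else card (?below (lead \<omega> f)))"
    proof (cases "?f = 0")
      case True
      then show ?thesis using pos_card False by (simp add: l_def)
    next
      case f': False
      have gt: "mon_gt \<omega> l (lead \<omega> ?f)" using below lead_props[OF f'] by blast
      have "?below (lead \<omega> ?f) \<subset> ?below l"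
      proof
        show "?below (lead \<omega> ?f) \<subseteq> ?below l"
          using gt not_above_trans[of \<omega> l "lead \<omega> ?f"] by (auto simp: not_above_def)
        have "l \<notin> ?below (lead \<omega> ?f)"
          using gt mon_gt_asym mon_gt_irrefl unfolding not_above_def by blast
        moreover have "l \<in> ?below l" using lmon by (simp add: not_above_def)
        ultimately show "?below (lead \<omega> ?f) \<noteq> ?below l" by blast
      qed
      then show ?thesis using fin False f' psubset_card_mono l_def by simp
    qed
    have "not_above \<omega> \<alpha> \<mu>" if "\<mu> \<in> keys ?f" for \<mu>
      using not_above_trans[OF l\<alpha>] below[OF that] unfolding not_above_def by blast
    then obtain q where q: "\<forall>g\<in>G. q g \<in> carrier (Rr n) \<and> (\<forall>\<mu>\<in>keys (q g * g). not_above \<omega> \<alpha> \<mu>)"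
      "?f = (\<Sum>g\<in>G. q g * g)"
      using less.hyps[OF smaller fI] by blast
    let ?q = "q(g0 := q g0 + ?t)"
    have "f = ?f + ?t * g0" by simp
    also have "\<dots> = (\<Sum>g\<in>G. q g * g + (if g = g0 then ?t * g0 else 0))"
      unfolding q(2) sum.distrib using G(1) g0(1) by simp
    also have "\<dots> = (\<Sum>g\<in>G. ?q g * g)"
      by (intro sum.cong) (auto simp: distrib_right)
    finally have "f = (\<Sum>g\<in>G. ?q g * g)" .
    moreover have "?q g \<in> carrier (Rr n) \<and> (\<forall>\<mu>\<in>keys (?q g * g). not_above \<omega> \<alpha> \<mu>)" if g: "g \<in> G" for g
    proof (cases "g = g0")
      case True
      have "?q g \<in> carrier (Rr n)"
        using q(1) g tcar True by (simp add: carrier_add)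
      moreover have "not_above \<omega> \<alpha> \<mu>" if \<mu>: "\<mu> \<in> keys (?q g * g)" for \<mu>
      proof -
        have "\<mu> \<in> keys (q g0 * g0) \<or> \<mu> \<in> keys (?t * g0)"
          using \<mu> keys_add[of "q g0 * g0" "?t * g0"] True by (auto simp: distrib_right)
        then show ?thesis
        proof
          assume "\<mu> \<in> keys (?t * g0)"
          then have "not_above \<omega> l \<mu>" using lead_le unfolding not_above_def by blast
          then show ?thesis using not_above_trans[OF l\<alpha>] by blast
        qed (use q(1) g0(1) in blast)
      qed
      ultimately show ?thesis by blast
    qed (use q(1) g in simp)
    ultimately show ?thesis by (intro exI[of _ ?q]) blast
  qed
qed

section \<open>Normal forms\<close>

lemma standard_exists:
  assumes "\<And>i. i \<in> {1..n} \<Longrightarrow> 0 < weights a i" "\<beta> \<in> monomials {1..n}"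
  obtains r where "standard n a r" "sdeg a r = sdeg a \<beta>"
proof -
  let ?S = "{\<mu> \<in> monomials {1..n}. sdeg a \<mu> = sdeg a \<beta>}"
  have "?S \<subseteq> {\<mu> \<in> monomials {1..n}. wdeg (weights a) \<mu> \<le> wdeg (weights a) \<beta>}"
    by (auto simp: wdeg_weights)
  then have "finite ?S" using finite_bounded_wdeg[OF assms(1)] by (rule finite_subset)
  moreover have "?S \<noteq> {}" using assms(2) by blast
  ultimately obtain r where r: "r \<in> ?S" "\<forall>\<mu>\<in>?S. \<mu> \<noteq> r \<longrightarrow> mon_gt (weights a) \<mu> r"
    using finite_total_greatest[of ?S "\<lambda>\<alpha> \<beta>. mon_gt (weights a) \<beta> \<alpha>"] mon_gt_trans mon_gt_total
    by blast
  have "standard n a r"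
    unfolding standard_def
  proof (intro conjI ballI impI notI)
    show "r \<in> monomials {1..n}" using r(1) by simp
    fix \<mu> assume \<mu>: "\<mu> \<in> monomials {1..n}" "sdeg a \<mu> = sdeg a r" "mon_gt (weights a) r \<mu>"
    then have "\<mu> \<in> ?S" using r(1) by simp
    then have "\<mu> = r" using r(2) \<mu>(3) mon_gt_asym by blast
    then show False using \<mu>(3) mon_gt_irrefl by simp
  qed
  then show thesis using that r(1) by simp
qed

text \<open>The binomial of \<beta> and r lies in I, so \<open>division\<close> writes it in terms
  of G; r is irreducible because it is not in in(I).\<close>

lemma remainder_exists:
  fixes G :: "'k::field mpol set"
  assumes pos: "\<And>i. i \<in> {1..n} \<Longrightarrow> 0 < weights a i"
    and G: "is_reduced_gb n (weights a) (toric_ideal n a) G"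
    and \<beta>: "\<beta> \<in> monomials {1..n}"
    and r: "standard n a r" "sdeg a r = sdeg a \<beta>"
  shows "is_remainder n (weights a) G (xpow \<beta>) (xpow r)"
proof -
  let ?I = "toric_ideal n a :: 'k mpol set"
  let ?f = "xpow \<beta> - xpow r :: 'k mpol"
  have G': "finite G" "G \<subseteq> ?I" "initial_ideal n (weights a) G = initial_ideal n (weights a) ?I"
    "\<And>g. g \<in> G \<Longrightarrow> g \<noteq> 0 \<and> lookup g (lead (weights a) g) = 1"
    using G unfolding is_reduced_gb_def by blast+
  have rmon: "r \<in> monomials {1..n}" using r(1) by (simp add: standard_def)
  have fI: "?f \<in> ?I" using \<beta> rmon r(2) by (intro xpow_diff_in_toric_ideal) simp_all
  have below: "not_above (weights a) \<beta> r"
  proof (cases "r = \<beta>")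
    case False
    then have "mon_gt (weights a) r \<beta> \<or> mon_gt (weights a) \<beta> r" by (rule mon_gt_total)
    then show ?thesis using r \<beta> unfolding standard_def not_above_def by metis
  qed (simp add: not_above_def)
  have "not_above (weights a) \<beta> \<mu>" if "\<mu> \<in> keys ?f" for \<mu>
  proof -
    have "\<mu> = \<beta> \<or> \<mu> = r" using that keys_add[of "xpow \<beta>" "- (xpow r :: 'k mpol)"] by auto
    then show ?thesis using below by (auto simp: not_above_def)
  qed
  from division[OF pos G' fI this] obtain q where
    q: "\<forall>g\<in>G. q g \<in> carrier (Rr n) \<and> (\<forall>\<mu>\<in>keys (q g * g). not_above (weights a) \<beta> \<mu>)"
      "?f = (\<Sum>g\<in>G. q g * g)" by blast
  have eq: "xpow \<beta> = (\<Sum>g\<in>G. q g * g) + xpow r" using q(2) by (metis diff_add_cancel)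
  have irreducible: "\<not> (\<exists>\<gamma>. r = lead (weights a) g + \<gamma>)" if "g \<in> G" for g
  proof
    assume "\<exists>\<gamma>. r = lead (weights a) g + \<gamma>"
    then have "xpow r \<in> initial_ideal n (weights a) ?I"
      unfolding xpow_in_initial_ideal[OF toric_ideal_subset]
      using that G'(2,4) rmon by blast
    then show False using initial_toric_ideal[OF rmon] r(1) by blast
  qed
  show ?thesis
    unfolding is_remainder_def
  proof (intro conjI exI[of _ q])
    show "\<forall>g\<in>G. q g \<in> carrier (Rr n) \<and>
      (\<forall>\<mu>\<in>keys (q g * g). \<exists>\<nu>\<in>keys (xpow \<beta> :: 'k mpol). \<mu> = \<nu> \<or> mon_gt (weights a) \<nu> \<mu>)"
      using q(1) by (simp add: not_above_def)
    show "\<forall>\<mu>\<in>keys (xpow r :: 'k mpol). \<forall>g\<in>G. \<not> (\<exists>\<gamma>. \<mu> = lead (weights a) g + \<gamma>)"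
      using irreducible by simp
  qed (use rmon eq in simp_all)
qed

text \<open>Division subtracts an element of I, on which every toric coefficient vanishes. Since
  edges depend on the degree alone, conditions on the remainder can be read as conditions on
  \<beta>.\<close>

lemma remainder_sdeg:
  fixes G :: "'k::field mpol set"
  assumes "is_reduced_gb n \<omega> (toric_ideal n a) G"
    and "is_remainder n \<omega> G (xpow \<beta>) (xpow r)"
  shows "r \<in> monomials {1..n}" "sdeg a r = sdeg a \<beta>"
proof -
  show "r \<in> monomials {1..n}" using assms(2) by (simp add: is_remainder_def)
  obtain q where q: "\<forall>g\<in>G. q g \<in> carrier (Rr n)" "xpow \<beta> = (\<Sum>g\<in>G. q g * g) + xpow r"
    using assms(2) unfolding is_remainder_def by blast
  have "(\<Sum>g\<in>G. q g * g) \<in> toric_ideal n a"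
    using q(1) assms(1) unfolding is_reduced_gb_def
    by (intro toric_ideal_sum toric_ideal_mult) auto
  then have "toric_coeff a (sdeg a \<beta>) (\<Sum>g\<in>G. q g * g) = 0" by (simp add: toric_ideal_iff)
  then have "toric_coeff a (sdeg a \<beta>) (xpow \<beta> :: 'k mpol) = toric_coeff a (sdeg a \<beta>) (xpow r)"
    unfolding q(2) by (simp add: toric_coeff_def pairing_add)
  then show "sdeg a r = sdeg a \<beta>" by (simp add: toric_coeff_xpow split: if_splits)
qed

section \<open>The candidate set and the shifts\<close>

text \<open>The indices x and y are parameters with equations, which keeps truncated subtraction out
  of the proofs. The third vertex, z in the overview, is the index n.\<close>

locale simplicial_setup =
  fixes n :: nat and a :: "nat \<Rightarrow> nat^3" and x y :: nat
  assumes n3: "3 \<le> n" and x: "x = n - 2" and y: "y = n - 1"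
    and nonzero: "\<And>i. i \<in> {1..n} \<Longrightarrow> a i \<noteq> 0"
begin

lemma xyn: "x < y" "y < n" "1 \<le> x" "x \<noteq> y" "y \<noteq> x" "x \<noteq> n" "n \<noteq> x" "y \<noteq> n" "n \<noteq> y"
  using n3 x y by auto

lemma A_eq: "{n-2..n} = {x, y, n}"
  using n3 x y by auto

lemma A_eq': "{n-2, n-1, n} = {x, y, n}"
  using x y by auto

lemma vars_in: "x \<in> {1..n}" "y \<in> {1..n}" "n \<in> {1..n}"
  using xyn by auto

lemma monomials_A: "m \<in> monomials {x, y, n} \<Longrightarrow> m \<in> monomials {1..n}"
  using monomials_mono[of "{x, y, n}" "{1..n}"] vars_in by blast

lemma weights_pos: "i \<in> {1..n} \<Longrightarrow> 0 < weights a i"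
  using nonzero[of i] by (auto simp: weights_def vec_eq_iff sum_pos2 intro!: Nat.gr0I)

lemma lookup_above: "\<alpha> \<in> monomials {1..n} \<Longrightarrow> n < j \<Longrightarrow> lookup \<alpha> j = 0"
  by (auto simp: monomials_def in_keys_iff)

text \<open>In equal degree the larger exponent at the last difference marks the smaller monomial,
  and \<alpha> is the smallest. For k = n this gives maximality in \<open>x_n\<close>; descending
  from n, it determines the exponents one after the other.\<close>

lemma standard_max:
  assumes "standard n a \<alpha>" "\<beta> \<in> monomials {1..n}" "sdeg a \<beta> = sdeg a \<alpha>"
    and "\<And>j. k < j \<Longrightarrow> j \<le> n \<Longrightarrow> lookup \<beta> j = lookup \<alpha> j"
  shows "lookup \<beta> k \<le> lookup \<alpha> k"
proof (rule ccontr)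
  assume "\<not> ?thesis"
  then have lt: "lookup \<alpha> k < lookup \<beta> k" by simp
  have "lookup \<alpha> j = lookup \<beta> j" if "k < j" for j
  proof (cases "j \<le> n")
    case False
    then show ?thesis
      using lookup_above[of \<alpha> j] lookup_above[OF assms(2), of j] assms(1) by (simp add: standard_def)
  qed (use assms(4)[OF that] in simp)
  then have "mon_gt (weights a) \<alpha> \<beta>"
    unfolding mon_gt_def wdeg_weights assms(3) using lt by blast
  then show False using assms(1-3) unfolding standard_def by blast
qed

lemma not_standard:
  assumes "\<alpha> \<in> monomials {1..n}" "\<not> standard n a \<alpha>"
  obtains \<beta> k where "\<beta> \<in> monomials {1..n}" "sdeg a \<beta> = sdeg a \<alpha>" "mon_gt (weights a) \<alpha> \<beta>"
    "k \<le> n" "lookup \<alpha> k < lookup \<beta> k" "\<And>j. k < j \<Longrightarrow> lookup \<alpha> j = lookup \<beta> j"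
proof -
  obtain \<beta> where \<beta>: "\<beta> \<in> monomials {1..n}" "sdeg a \<beta> = sdeg a \<alpha>" "mon_gt (weights a) \<alpha> \<beta>"
    using assms unfolding standard_def by blast
  then obtain k where k: "lookup \<alpha> k < lookup \<beta> k" "\<forall>j>k. lookup \<alpha> j = lookup \<beta> j"
    unfolding mon_gt_def wdeg_weights \<beta>(2) by blast
  have "k \<le> n"
  proof (rule ccontr)
    assume "\<not> k \<le> n"
    then show False using k(1) lookup_above[OF \<beta>(1), of k] by simp
  qed
  then show thesis using that[OF \<beta>] k by blast
qed

abbreviation "init \<equiv> initial_ideal n (weights a)"

text \<open>Both summands are spanned by monomials, so a monomial in the sum lies in one of
  them.\<close>

lemma B0_iff:
  "u \<in> B0 n (weights a) (toric_ideal n a :: 'k::field mpol set) \<longleftrightarrow>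
    standard n a u \<and> lookup u x = 0 \<and> lookup u y = 0 \<and> lookup u n = 0"
    (is "_ \<longleftrightarrow> ?R")
proof -
  let ?I = "toric_ideal n a :: 'k mpol set"
  let ?V = "Idl\<^bsub>Rr n\<^esub> {var x, var y, var n} :: 'k mpol set"
  have V: "?V = {p. keys p \<subseteq> monomials {1..n} \<and> (\<forall>\<mu>\<in>keys p. \<exists>i\<in>{x, y, n}. 0 < lookup \<mu> i)}"
    using var_ideal[of "{x, y, n}" "{1..n}"] vars_in by simp
  have init: "init ?I = {p. keys p \<subseteq> monomials {1..n} \<and> (\<forall>\<mu>\<in>keys p. \<not> standard n a \<mu>)}"
    by (rule initial_toric_ideal_eq)
  have B: "u \<in> B0 n (weights a) ?I \<longleftrightarrow> u \<in> monomials {1..n} \<and> xpow u \<notin> init ?I <+>\<^bsub>Rr n\<^esub> ?V"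
    by (simp add: B0_def x y)
  show ?thesis
  proof
    assume u: "u \<in> B0 n (weights a) ?I"
    have "xpow u = xpow u + (0 :: 'k mpol)" "xpow u = 0 + (xpow u :: 'k mpol)" by simp_all
    moreover have "(0 :: 'k mpol) \<in> init ?I" "0 \<in> ?V" unfolding init V by simp_all
    ultimately have "xpow u \<notin> init ?I" "xpow u \<notin> ?V"
      using u unfolding B set_add_poly_ring by blast+
    then show ?R using u unfolding B init V by auto
  next
    assume R: ?R
    have "xpow u \<notin> init ?I <+>\<^bsub>Rr n\<^esub> ?V"
    proof
      assume "xpow u \<in> init ?I <+>\<^bsub>Rr n\<^esub> ?V"
      then obtain p q :: "'k mpol" where pq: "p \<in> init ?I" "q \<in> ?V" "xpow u = p + q"
        unfolding set_add_poly_ring by blast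
      have "u \<in> keys (xpow u :: 'k mpol)" by simp
      then have "u \<in> keys p \<union> keys q" using keys_add[of p q] unfolding pq(3) by blast
      then show False
      proof
        assume "u \<in> keys p"
        then show False using pq(1) R unfolding init by blast
      next
        assume "u \<in> keys q"
        then have "\<exists>i\<in>{x, y, n}. 0 < lookup u i" using pq(2) unfolding V by blast
        then show False using R by auto
      qed
    qed
    then show "u \<in> B0 n (weights a) ?I" using R unfolding B standard_def by blast
  qed
qed

text \<open>Cancelling a common variable turns a comparison with a nonstandard candidate into one
  with the standard monomial left after division by that variable.\<close>

lemma strip:
  assumes "\<beta> \<in> monomials {1..n}" "sdeg a \<beta> = sdeg a (pw i 1 + N)" "0 < lookup \<beta> i"
  obtains \<beta>' where "\<beta> = pw i 1 + \<beta>'" "\<beta>' \<in> monomials {1..n}" "sdeg a \<beta>' = sdeg a N"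
proof -
  obtain \<beta>' where \<beta>': "\<beta> = pw i 1 + \<beta>'" using expo_split[OF assms(3)] by blast
  moreover have "\<beta>' \<in> monomials {1..n}" using assms(1) unfolding \<beta>' monomials_add_iff by blast
  moreover have "sdeg a \<beta>' = sdeg a N"
    using assms(2) unfolding \<beta>' by (simp only: sdeg_add vec_nat_add_cancel)
  ultimately show thesis by (rule that)
qed

text \<open>
  The pairs \<open>(u, M\<^sub>(\<^sub>u\<^sub>,\<^sub>i\<^sub>))\<close>, described by divisibility in \<open>in(I)\<close>.
\<close>

definition candidate :: "expo \<Rightarrow> expo \<Rightarrow> bool" where
  "candidate u m \<longleftrightarrow> standard n a u \<and> lookup u x = 0 \<and> lookup u y = 0 \<and> lookup u n = 0 \<and>
    m \<in> monomials {x, y, n} \<and> \<not> standard n a (u + m) \<and>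
    (\<forall>i m'. m = pw i 1 + m' \<longrightarrow> standard n a (u + m'))"

text \<open>If m divided by one variable were still in the colon ideal, some generator would
  properly divide m, and removing m from M would leave the generated ideal unchanged, against
  minimality.\<close>

lemma B1'_candidate:
  assumes "\<beta> \<in> B1' n (weights a) (toric_ideal n a :: 'k::field mpol set)"
  obtains u m where "\<beta> = u + m" "candidate u m"
proof -
  let ?I = "toric_ideal n a :: 'k mpol set"
  obtain u m M where u: "u \<in> B0 n (weights a) ?I" and M:
    "is_min_mon_gens n (colon_A n (weights a) ?I u) M" "m \<in> M" and \<beta>: "\<beta> = u + m"
    using assms unfolding B1'_def by blast
  let ?K = "colon_A n (weights a) ?I u"
  have umon: "u \<in> monomials {1..n}" using u unfolding B0_iff standard_def by blast
  have Msub: "M \<subseteq> monomials {x, y, n}"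
    and gen: "Idl\<^bsub>poly_ring {x, y, n}\<^esub> (xpow ` M) = ?K"
    and minimal: "\<And>M'. M' \<subset> M \<Longrightarrow> Idl\<^bsub>poly_ring {x, y, n}\<^esub> (xpow ` M') \<noteq> ?K"
    using M(1) unfolding is_min_mon_gens_def A_eq by blast+
  have Idl: "Idl\<^bsub>poly_ring {x, y, n}\<^esub> (xpow ` M') =
      {p :: 'k mpol. keys p \<subseteq> monomials {x, y, n} \<and> (\<forall>\<mu>\<in>keys p. \<exists>m\<in>M'. \<exists>\<gamma>. \<mu> = m + \<gamma>)}"
    if "M' \<subseteq> M" for M'
    using that Msub by (intro monomial_ideal) blast
  have colon: "xpow \<mu> \<in> ?K \<longleftrightarrow> \<not> standard n a (u + \<mu>)" if \<mu>: "\<mu> \<in> monomials {x, y, n}" for \<mu>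
  proof -
    have "u + \<mu> \<in> monomials {1..n}" using umon monomials_A[OF \<mu>] by simp
    then have "xpow (u + \<mu>) \<in> init ?I \<longleftrightarrow> \<not> standard n a (u + \<mu>)" by (rule initial_toric_ideal)
    then show ?thesis
      using \<mu> monomials_A[OF \<mu>] unfolding colon_A_def A_eq
      by (simp add: xpow_mult add.commute)
  qed
  have m: "m \<in> monomials {x, y, n}" using M(2) Msub by blast
  have "(xpow m :: 'k mpol) \<in> Idl\<^bsub>poly_ring {x, y, n}\<^esub> (xpow ` M)"
    unfolding Idl[OF order_refl] using m M(2) by (auto intro!: bexI[of _ m] exI[of _ 0])
  then have nonstd: "\<not> standard n a (u + m)" using colon[OF m] unfolding gen by blast
  have "standard n a (u + m')" if m': "m = pw i 1 + m'" for i m'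
  proof (rule ccontr)
    assume ns: "\<not> standard n a (u + m')"
    have "m' \<in> monomials {x, y, n}" using m unfolding m' monomials_add_iff by blast
    then have "(xpow m' :: 'k mpol) \<in> Idl\<^bsub>poly_ring {x, y, n}\<^esub> (xpow ` M)" using colon ns unfolding gen by blast
    then obtain m'' \<gamma> where m'': "m'' \<in> M" "m' = m'' + \<gamma>" unfolding Idl[OF order_refl] by auto
    have m_eq: "m = m'' + (pw i 1 + \<gamma>)" unfolding m' m''(2) by (rule add.left_commute)
    have "lookup m i = Suc (lookup m'' i + lookup \<gamma> i)" unfolding m_eq by (simp add: lookup_add lookup_pw)
    then have "m'' \<noteq> m" by auto
    have "\<exists>k\<in>M - {m}. \<exists>\<gamma>. \<mu> = k + \<gamma>" if k: "k \<in> M" "\<mu> = k + \<delta>" for k \<mu> \<delta>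
    proof (cases "k = m")
      case True
      then have "\<mu> = m'' + (pw i 1 + \<gamma> + \<delta>)" using k(2) m_eq by (simp only: add.assoc)
      then show ?thesis using m''(1) \<open>m'' \<noteq> m\<close> by blast
    qed (use k in blast)
    then have "Idl\<^bsub>poly_ring {x, y, n}\<^esub> (xpow ` (M - {m})) = (Idl\<^bsub>poly_ring {x, y, n}\<^esub> (xpow ` M) :: 'k mpol set)"
      unfolding Idl[OF order_refl] Idl[OF Diff_subset] by blast
    then show False using minimal[of "M - {m}"] M(2) unfolding gen by blast
  qed
  then have "candidate u m"
    using u m nonstd unfolding candidate_def B0_iff by blast
  then show thesis using that \<beta> by blast
qed

section \<open>Vertices and edges in the degree of a candidate\<close>

abbreviation "edge s i j \<equiv> face n a s {i, j}"

lemma candidateD: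
  assumes "candidate u m"
  shows "u \<in> monomials {1..n}" "m \<in> monomials {1..n}" "u + m \<in> monomials {1..n}"
    "lookup u x = 0" "lookup u y = 0" "lookup u n = 0"
    "\<not> standard n a (u + m)" "m \<noteq> 0" "i \<notin> {x, y, n} \<Longrightarrow> lookup m i = 0"
  using assms monomials_A[of m] unfolding candidate_def standard_def
  by (auto simp: monomials_def keys_expo_add in_keys_iff)

lemma candidate_strip:
  assumes "candidate u m" "0 < lookup m i"
  obtains m' where "m = pw i 1 + m'" "standard n a (u + m')" "u + m = pw i 1 + (u + m')"
proof -
  obtain m' where m': "m = pw i 1 + m'" using expo_split[OF assms(2)] by blast
  moreover have "standard n a (u + m')" using assms(1) m' unfolding candidate_def by blast
  moreover have "u + m = pw i 1 + (u + m')" unfolding m' by (rule add.left_commute)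
  ultimately show thesis by (rule that)
qed

text \<open>If \<open>x_n\<close> divides u + m, it also divides any smaller monomial of the same
  degree, whose last exponent is at least as large. Cancelling it from both contradicts standardness
  of the quotient.\<close>

lemma candidate_lookup_n:
  assumes "candidate u m"
  shows "lookup m n = 0"
proof (rule ccontr)
  assume "lookup m n \<noteq> 0"
  then obtain m' where m': "standard n a (u + m')" "u + m = pw n 1 + (u + m')"
    using candidate_strip[OF assms, of n] by auto
  obtain \<beta> k where \<beta>: "\<beta> \<in> monomials {1..n}" "sdeg a \<beta> = sdeg a (u + m)" "mon_gt (weights a) (u + m) \<beta>"
    "k \<le> n" "lookup (u + m) k < lookup \<beta> k" "\<And>j. k < j \<Longrightarrow> lookup (u + m) j = lookup \<beta> j"
    using not_standard[OF candidateD(3,7)[OF assms]] by blast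
  have "0 < lookup (u + m) n" unfolding m'(2) by (simp add: lookup_add lookup_pw)
  then have "0 < lookup \<beta> n" using \<beta>(4,5) \<beta>(6)[of n] by (cases "k = n") simp_all
  then obtain \<beta>' where \<beta>': "\<beta> = pw n 1 + \<beta>'" "\<beta>' \<in> monomials {1..n}" "sdeg a \<beta>' = sdeg a (u + m')"
    using strip[OF \<beta>(1), of n "u + m'"] \<beta>(2) unfolding m'(2) by blast
  have "mon_gt (weights a) (u + m') \<beta>'" using \<beta>(3) unfolding m'(2) \<beta>'(1) mon_gt_add_left .
  then show False using m'(1) \<beta>'(2,3) unfolding standard_def by blast
qed

lemma candidate_cases:
  assumes "candidate u m"
  shows "0 < lookup m x \<or> 0 < lookup m y"
proof (rule ccontr)
  assume "\<not> ?thesis"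
  then have "lookup m i = 0" for i
    using candidate_lookup_n[OF assms] candidateD(9)[OF assms, of i] by (cases "i \<in> {x, y, n}") auto
  then have "m = 0" by (intro poly_mapping_eqI) simp
  then show False using candidateD(8)[OF assms] by blast
qed

lemma candidate_vertex:
  "candidate u m \<Longrightarrow> 0 < lookup m i \<Longrightarrow> face n a (sdeg a (u + m)) {i}"
  unfolding face_def by (rule bexI[OF _ candidateD(3)]) (simp_all add: lookup_add)

text \<open>A smaller \<beta> of the same degree shares no variable with m, since that variable
  could be cancelled. So at each i dividing m the exponent of \<beta> is 0 and that of u + m is
  positive. This excludes i from being the last difference k, where \<beta> has the larger exponent,
  and from lying beyond it.\<close>

lemma candidate_larger_vertex:
  assumes "candidate u m"
  obtains k where "k \<le> n" "\<And>i. 0 < lookup m i \<Longrightarrow> i < k" "face n a (sdeg a (u + m)) {k}"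
proof -
  obtain \<beta> k where \<beta>: "\<beta> \<in> monomials {1..n}" "sdeg a \<beta> = sdeg a (u + m)" "mon_gt (weights a) (u + m) \<beta>"
    "k \<le> n" "lookup (u + m) k < lookup \<beta> k" "\<And>j. k < j \<Longrightarrow> lookup (u + m) j = lookup \<beta> j"
    using not_standard[OF candidateD(3,7)[OF assms]] by blast
  have "i < k" if i: "0 < lookup m i" for i
  proof -
    obtain m' where m': "standard n a (u + m')" "u + m = pw i 1 + (u + m')"
      using candidate_strip[OF assms i] by blast
    have "lookup \<beta> i = 0"
    proof (rule ccontr)
      assume "lookup \<beta> i \<noteq> 0"
      then obtain \<beta>' where \<beta>': "\<beta> = pw i 1 + \<beta>'" "\<beta>' \<in> monomials {1..n}" "sdeg a \<beta>' = sdeg a (u + m')"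
        using strip[OF \<beta>(1), of i "u + m'"] \<beta>(2) unfolding m'(2) by blast
      have "mon_gt (weights a) (u + m') \<beta>'" using \<beta>(3) unfolding m'(2) \<beta>'(1) mon_gt_add_left .
      then show False using m'(1) \<beta>'(2,3) unfolding standard_def by blast
    qed
    moreover have "0 < lookup (u + m) i" using i by (simp add: lookup_add)
    ultimately show ?thesis using \<beta>(5) \<beta>(6)[of i] by (cases i k rule: linorder_cases) simp_all
  qed
  moreover have "face n a (sdeg a (u + m)) {k}" unfolding face_def using \<beta>(1,2,5) by (intro bexI[of _ \<beta>]) auto
  ultimately show thesis using that \<beta>(4) by blast
qed

text \<open>Cancelling i from a monomial realising the edge leaves one divisible by j in the degree
  of the standard monomial \<open>u + m'\<close>. By \<open>top\<close>, from index j on u + m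
  involves at most the variable i, and that to the first power, so \<open>u + m'\<close> vanishes
  there; maximality forces the other monomial to vanish there too.\<close>

lemma no_edge:
  assumes "candidate u m" "0 < lookup m i" "i \<noteq> j" "j \<le> n"
    and top: "\<And>k. j \<le> k \<Longrightarrow> k \<le> n \<Longrightarrow> lookup (u + m) k = of_bool (k = i)"
  shows "\<not> edge (sdeg a (u + m)) i j"
proof
  assume "edge (sdeg a (u + m)) i j"
  then obtain \<beta> where \<beta>: "\<beta> \<in> monomials {1..n}" "sdeg a \<beta> = sdeg a (u + m)" "0 < lookup \<beta> i" "0 < lookup \<beta> j"
    unfolding face_def by auto
  obtain m' where m': "standard n a (u + m')" "u + m = pw i 1 + (u + m')"
    using candidate_strip[OF assms(1,2)] by blast
  obtain \<beta>' where \<beta>': "\<beta> = pw i 1 + \<beta>'" "\<beta>' \<in> monomials {1..n}" "sdeg a \<beta>' = sdeg a (u + m')"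
    using strip[OF \<beta>(1), of i "u + m'"] \<beta>(2,3) unfolding m'(2) by blast
  have zero: "lookup (u + m') k = 0" if "j \<le> k" "k \<le> n" for k
    using top[OF that] unfolding m'(2) by (simp add: lookup_add lookup_pw split: if_splits)
  have "lookup \<beta>' k = 0" if "j \<le> k" "k \<le> n" for k
    using that
  \<comment> \<open>Descending from n: once the exponents beyond k agree,
    \<open>standard_max\<close> applies at k.\<close>
  proof (induction "n - k" arbitrary: k rule: less_induct)
    case (less k)
    have "lookup \<beta>' l = lookup (u + m') l" if "k < l" "l \<le> n" for l
      using less.hyps[of l] zero[of l] less.prems that by simp
    then have "lookup \<beta>' k \<le> lookup (u + m') k" by (rule standard_max[OF m'(1) \<beta>'(2,3)])
    then show ?case using zero[OF less.prems] by simp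
  qed
  then have "lookup \<beta>' j = 0" using assms(4) by blast
  then show False using \<beta>(4) assms(3) unfolding \<beta>'(1) by (simp add: lookup_add lookup_pw)
qed

end

lemma card_fibre_eq:
  assumes "finite B" "image_mset f (mset_set B) = mset xs"
  shows "card {e \<in> B. f e = s} = card {l. l < length xs \<and> xs ! l = s}"
proof -
  have "{e \<in> B. f e = s} = {e. e \<in># mset_set B \<and> s = f e}" using assms(1) by auto
  then have "card {e \<in> B. f e = s} = (\<Sum>e | e \<in># mset_set B \<and> s = f e. 1)" by simp
  also have "\<dots> = (\<Sum>e | e \<in># mset_set B \<and> s = f e. count (mset_set B) e)"
    using assms(1) by (intro sum.cong) simp_all
  also have "\<dots> = count (mset xs) s" unfolding assms(2)[symmetric] count_image_mset' ..
  also have "\<dots> = card {l. l < length xs \<and> xs ! l = s}"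
    by (simp add: count_mset count_list_eq_length_filter length_filter_conv_card eq_commute)
  finally show ?thesis .
qed

context simplicial_setup
begin

text \<open>Dividing both by the common variable i gives standard monomials of equal degree, which
  coincide.\<close>

lemma candidate_unique:
  assumes "candidate u m" "candidate u' m'" "sdeg a (u + m) = sdeg a (u' + m')"
    and "0 < lookup m i" "0 < lookup m' i"
  shows "u + m = u' + m'"
proof -
  obtain k where k: "standard n a (u + k)" "u + m = pw i 1 + (u + k)"
    using candidate_strip[OF assms(1,4)] by blast
  obtain k' where k': "standard n a (u' + k')" "u' + m' = pw i 1 + (u' + k')"
    using candidate_strip[OF assms(2,5)] by blast
  have "sdeg a (u + k) = sdeg a (u' + k')"
    using assms(3) unfolding k(2) k'(2) by (simp only: sdeg_add[of a "pw i 1"] vec_nat_add_cancel)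
  then show ?thesis using standard_unique[OF k(1) k'(1)] k(2) k'(2) by simp
qed

lemma no_edge_n:
  assumes "candidate u m" "0 < lookup m i"
  shows "\<not> edge (sdeg a (u + m)) i n"
proof (rule no_edge[OF assms])
  show "i \<noteq> n" using candidate_lookup_n[OF assms(1)] assms(2) by auto
  then show "lookup (u + m) k = of_bool (k = i)" if "n \<le> k" "k \<le> n" for k
    using that candidate_lookup_n[OF assms(1)] candidateD(6)[OF assms(1)]
    by (simp add: lookup_add)
qed simp

lemma no_edge_xy:
  assumes "candidate u m" "0 < lookup m x" "lookup m y = 0"
  shows "\<not> edge (sdeg a (u + m)) x y"
proof (rule no_edge[OF assms(1,2)])
  fix k assume "y \<le> k" "k \<le> n"
  then have "k = y \<or> k = n" using y by auto
  then show "lookup (u + m) k = of_bool (k = x)"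
    using assms(3) candidate_lookup_n[OF assms(1)] candidateD(5,6)[OF assms(1)] xyn
    by (auto simp: lookup_add)
qed (use xyn in simp_all)

text \<open>With exponent 1, removing y from m leaves a standard monomial free of x, y and n, as
  \<open>no_edge\<close> requires. This is the origin of the bound b \<ge> 2 in C.\<close>

lemma no_edge_yx:
  assumes "candidate u m" "lookup m x = 0" "lookup m y = 1"
  shows "\<not> edge (sdeg a (u + m)) x y"
proof -
  have "\<not> edge (sdeg a (u + m)) y x"
  proof (rule no_edge[OF assms(1)])
    fix k assume "x \<le> k" "k \<le> n"
    then have "k = x \<or> k = y \<or> k = n" using x y by auto
    then show "lookup (u + m) k = of_bool (k = y)"
      using assms(2,3) candidate_lookup_n[OF assms(1)] candidateD(4-6)[OF assms(1)] xyn
      by (auto simp: lookup_add)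
  qed (use xyn assms(3) in simp_all)
  then show ?thesis by (simp add: insert_commute)
qed

lemma isolated_iff:
  "isolated n a s x \<longleftrightarrow> \<not> edge s x y \<and> \<not> edge s x n"
  "isolated n a s y \<longleftrightarrow> \<not> edge s x y \<and> \<not> edge s y n"
  "isolated n a s n \<longleftrightarrow> \<not> edge s x n \<and> \<not> edge s y n"
  unfolding isolated_def A_eq using xyn by (auto simp: insert_commute)

text \<open>If y divides m, the larger vertex is n and {y, n} is not an edge, so a missing edge at x
  isolates y or n. Otherwise m is a power of x, and x itself is isolated.\<close>

lemma isolated_vertex:
  assumes c: "candidate u m" and e: "\<not> (edge (sdeg a (u + m)) x y \<and> edge (sdeg a (u + m)) x n)"
  shows "\<exists>v\<in>{x, y, n}. \<exists>w\<in>{x, y, n}. v \<noteq> w \<and> face n a (sdeg a (u + m)) {v} \<and>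
    face n a (sdeg a (u + m)) {w} \<and> isolated n a (sdeg a (u + m)) v"
proof -
  obtain k where k: "k \<le> n" "\<And>i. 0 < lookup m i \<Longrightarrow> i < k" "face n a (sdeg a (u + m)) {k}"
    using candidate_larger_vertex[OF c] by blast
  show ?thesis
  proof (cases "0 < lookup m y")
    case True
    then have "k = n" using k(1) k(2)[OF True] y by simp
    then have faces: "face n a (sdeg a (u + m)) {n}" "face n a (sdeg a (u + m)) {y}"
      using k(3) candidate_vertex[OF c True] by simp_all
    have "isolated n a (sdeg a (u + m)) y \<or> isolated n a (sdeg a (u + m)) n"
      unfolding isolated_iff using no_edge_n[OF c True] e by blast
    then show ?thesis using faces xyn by blast
  next
    case False
    then have mx: "0 < lookup m x" using candidate_cases[OF c] by simp
    have "x < k" using k(2)[OF mx] .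
    then have "k = y \<or> k = n" using k(1) x y by auto
    moreover have "isolated n a (sdeg a (u + m)) x"
      unfolding isolated_iff using no_edge_n[OF c mx] no_edge_xy[OF c mx] False by blast
    ultimately show ?thesis using k(3) candidate_vertex[OF c mx] xyn by blast
  qed
qed

text \<open>The first candidate excludes both edges at x and the second excludes {y, n}. The vertex
  n exists because the second candidate has a vertex with index larger than y.\<close>

lemma three_isolated:
  assumes "candidate u m" "candidate u' m'" "sdeg a (u + m) = s" "sdeg a (u' + m') = s"
    and "0 < lookup m x" "lookup m y = 0" "0 < lookup m' y"
  shows "isolated n a s x" "isolated n a s y" "isolated n a s n"
    "face n a s {x}" "face n a s {y}" "face n a s {n}"
proof -
  show "isolated n a s x" "isolated n a s y" "isolated n a s n"
    unfolding isolated_iff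
    using no_edge_n[OF assms(1,5)] no_edge_xy[OF assms(1,5,6)] no_edge_n[OF assms(2,7)] assms(3,4)
    by simp_all
  show "face n a s {x}" "face n a s {y}"
    using candidate_vertex[OF assms(1,5)] candidate_vertex[OF assms(2,7)] assms(3,4) by simp_all
  obtain k where k: "k \<le> n" "\<And>i. 0 < lookup m' i \<Longrightarrow> i < k" "face n a (sdeg a (u' + m')) {k}"
    using candidate_larger_vertex[OF assms(2)] by blast
  have "k = n" using k(1) k(2)[OF assms(7)] y by simp
  then show "face n a s {n}" using k(3) assms(4) by simp
qed

text \<open>
  In each degree \<open>B\<^sub>1'\<close> has at most one element divisible by \<open>x\<^sub>n\<^sub>-\<^sub>2\<close> and at most one divisible by
  \<open>x\<^sub>n\<^sub>-\<^sub>1\<close>, and if these differ then all three vertices are isolated, so that both are shifts.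
  This is why \<open>B\<^sub>1\<close> is determined although only its multiset of degrees is prescribed.
\<close>

lemma mem_B1_iff:
  assumes res: "is_minimal_graded_free_resolution n a (toric_ideal n a :: 'k::field mpol set) sh g D"
    and B: "B \<subseteq> B1' n (weights a) (toric_ideal n a :: 'k mpol set)" "finite B"
      "image_mset (sdeg a) (mset_set B) = mset (sh 1)"
    and e: "e \<in> B1' n (weights a) (toric_ideal n a :: 'k mpol set)"
  shows "e \<in> B \<longleftrightarrow> \<not> (edge (sdeg a e) x y \<and> edge (sdeg a e) x n)"
proof -
  interpret R: short_resolution n a sh g D using n3 res by unfold_locales
  let ?s = "sdeg a e"
  let ?L = "{l. l < length (sh 1) \<and> sh 1 ! l = ?s}"
  let ?B = "{e' \<in> B. sdeg a e' = ?s}"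
  have card: "card ?B = card ?L" by (rule card_fibre_eq[OF B(2,3)])
  have fin: "finite ?B" "finite ?L" using B(2) by auto
  have rep: "\<exists>u m. e' = u + m \<and> candidate u m" if "e' \<in> B1' n (weights a) (toric_ideal n a :: 'k mpol set)" for e'
    using B1'_candidate[OF that] by blast
  show ?thesis
  proof
    assume "e \<in> B"
    then have "?B \<noteq> {}" by blast
    then have "?L \<noteq> {}" using card fin by (metis card_eq_0_iff)
    then have "\<exists>l<length (sh 1). sh 1 ! l = ?s" by blast
    then show "\<not> (edge ?s x y \<and> edge ?s x n)"
      using R.no_shift[OF A_eq'] xyn by blast
  next
    assume edges: "\<not> (edge ?s x y \<and> edge ?s x n)"
    show "e \<in> B"
    proof (rule ccontr)
      assume notin: "e \<notin> B"
      obtain u m where um: "e = u + m" "candidate u m" using rep[OF e] by blast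
      have "\<exists>l<length (sh 1). sh 1 ! l = ?s"
        using isolated_vertex[OF um(2)] edges R.shift_exists unfolding um(1) A_eq by blast
      then have "?L \<noteq> {}" by blast
      then have "?B \<noteq> {}" using card fin by (metis card_eq_0_iff)
      then obtain e' where e': "e' \<in> B" "sdeg a e' = ?s" by blast
      obtain u' m' where um': "e' = u' + m'" "candidate u' m'" using rep e'(1) B(1) by blast
      have ne: "e \<noteq> e'" using notin e'(1) by blast
      have s: "sdeg a (u + m) = ?s" "sdeg a (u' + m') = ?s" using e'(2) um(1) um'(1) by simp_all
      have disjoint: "\<not> (0 < lookup m i \<and> 0 < lookup m' i)" for i
        using candidate_unique[OF um(2) um'(2), of i] ne s unfolding um(1) um'(1) by auto
      have iso: "isolated n a ?s x \<and> isolated n a ?s y \<and> isolated n a ?s n \<and>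
        face n a ?s {x} \<and> face n a ?s {y} \<and> face n a ?s {n}"
      proof (cases "0 < lookup m y")
        case True
        then have "lookup m' y = 0" using disjoint[of y] by simp
        then have "0 < lookup m' x" using candidate_cases[OF um'(2)] by simp
        show ?thesis
          by (intro conjI three_isolated[OF um'(2) um(2) s(2,1) \<open>0 < lookup m' x\<close> \<open>lookup m' y = 0\<close> True])
      next
        case False
        then have "0 < lookup m x" using candidate_cases[OF um(2)] by simp
        then have "0 < lookup m' y" using candidate_cases[OF um'(2)] disjoint[of x] by simp
        moreover have "lookup m y = 0" using False by simp
        ultimately show ?thesis
          by (intro conjI three_isolated[OF um(2) um'(2) s \<open>0 < lookup m x\<close>])
      qed
      have "{x, y, n} \<subseteq> {n-2..n}" unfolding A_eq ..
      then obtain l l' where l: "l \<noteq> l'" "l \<in> ?L" "l' \<in> ?L"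
        using R.two_shifts_exist[of x y n ?s] xyn(4,6,8) iso by blast
      \<comment> \<open>Two shifts in this degree force a second element e'' of B besides
        e'.\<close>
      have "?B \<noteq> {e'}"
      proof
        assume "?B = {e'}"
        then have "card ?L = 1" unfolding card[symmetric] by simp
        then obtain l0 where L: "?L = {l0}" by (rule card_1_singletonE)
        have "l = l0" "l' = l0" using l(2,3) unfolding L singleton_iff .
        then show False using l(1) by simp
      qed
      then obtain e'' where e'': "e'' \<in> B" "sdeg a e'' = ?s" "e'' \<noteq> e'" using e' by blast
      obtain u'' m'' where um'': "e'' = u'' + m''" "candidate u'' m''" using rep e''(1) B(1) by blast
      have ne'': "e \<noteq> e''" using notin e''(1) by blast
      have eq: "sdeg a (u + m) = sdeg a (u'' + m'')" "sdeg a (u' + m') = sdeg a (u'' + m'')"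
        using e'(2) e''(2) unfolding um(1) um'(1) um''(1) by simp_all
      have "\<not> (0 < lookup m i \<and> 0 < lookup m'' i)" for i
        using candidate_unique[OF um(2) um''(2) eq(1), of i] ne'' unfolding um(1) um''(1) by auto
      moreover have "\<not> (0 < lookup m' i \<and> 0 < lookup m'' i)" for i
        using candidate_unique[OF um'(2) um''(2) eq(2), of i] e''(3) unfolding um'(1) um''(1) by auto
      \<comment> \<open>Pigeonhole: each of m, m', m'' is divisible by x or y, and no two of them
        share a variable.\<close>
      ultimately show False
        using disjoint[of x] disjoint[of y]
          candidate_cases[OF um(2)] candidate_cases[OF um'(2)] candidate_cases[OF um''(2)]
        by meson
    qed
  qed
qed

section \<open>The ideal conditions as edges, and the remainders of elements of C\<close>

lemma pw_Suc_pred: "1 \<le> b \<Longrightarrow> v + pw i b = pw i 1 + (v + pw i (b - 1))"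
  by (rule poly_mapping_eqI) (simp add: lookup_add lookup_pw)

text \<open>Membership means that some monomial in the degree of \<open>v + pw i (b - 1)\<close> is
  divisible by x. Multiplying it by the variable i realises the edge, and i \<noteq> x ensures that
  x survives when i is cancelled again.\<close>

lemma xpow_plus_var_iff_edge:
  assumes "v \<in> monomials {1..n}" "1 \<le> b" "i \<in> {1..n}" "i \<noteq> x"
  shows "xpow (v + pw i (b - 1)) \<in>
      (toric_ideal n a :: 'k::field mpol set) <+>\<^bsub>Rr n\<^esub> Idl\<^bsub>Rr n\<^esub> {var x} \<longleftrightarrow>
    edge (sdeg a (v + pw i b)) x i"
proof -
  let ?\<alpha> = "v + pw i (b - 1)"
  have "?\<alpha> \<in> monomials {1..n}" using assms(1,3) by (simp add: pw_in_monomials)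
  then have "xpow ?\<alpha> \<in> (toric_ideal n a :: 'k mpol set) <+>\<^bsub>Rr n\<^esub> Idl\<^bsub>Rr n\<^esub> {var x} \<longleftrightarrow>
      (\<exists>\<beta>\<in>monomials {1..n}. sdeg a \<beta> = sdeg a ?\<alpha> \<and> 0 < lookup \<beta> x)"
    using vars_in(1) by (rule xpow_in_toric_plus_var)
  also have "\<dots> \<longleftrightarrow> edge (sdeg a (v + pw i b)) x i"
  proof
    assume "\<exists>\<beta>\<in>monomials {1..n}. sdeg a \<beta> = sdeg a ?\<alpha> \<and> 0 < lookup \<beta> x"
    then obtain \<beta> where \<beta>: "\<beta> \<in> monomials {1..n}" "sdeg a \<beta> = sdeg a ?\<alpha>" "0 < lookup \<beta> x" by blast
    have "sdeg a (pw i 1 + \<beta>) = sdeg a (v + pw i b)"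
      unfolding pw_Suc_pred[OF assms(2)] sdeg_add[of a "pw i 1"] \<beta>(2) ..
    moreover have "pw i 1 + \<beta> \<in> monomials {1..n}" using \<beta>(1) assms(3) by (simp add: pw_in_monomials)
    moreover have "\<forall>j\<in>{x, i}. 0 < lookup (pw i 1 + \<beta>) j" using \<beta>(3) by (simp add: lookup_add lookup_pw)
    ultimately show "edge (sdeg a (v + pw i b)) x i" unfolding face_def by blast
  next
    assume "edge (sdeg a (v + pw i b)) x i"
    then obtain \<beta> where \<beta>: "\<beta> \<in> monomials {1..n}" "sdeg a \<beta> = sdeg a (v + pw i b)"
      "0 < lookup \<beta> x" "0 < lookup \<beta> i" unfolding face_def by auto
    obtain \<beta>' where \<beta>': "\<beta> = pw i 1 + \<beta>'" "\<beta>' \<in> monomials {1..n}" "sdeg a \<beta>' = sdeg a ?\<alpha>"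
      using strip[OF \<beta>(1) _ \<beta>(4), of ?\<alpha>] \<beta>(2) unfolding pw_Suc_pred[OF assms(2)] by blast
    have "0 < lookup \<beta>' x" using \<beta>(3) assms(4) unfolding \<beta>'(1) by (simp add: lookup_add lookup_pw)
    then show "\<exists>\<beta>\<in>monomials {1..n}. sdeg a \<beta> = sdeg a ?\<alpha> \<and> 0 < lookup \<beta> x"
      using \<beta>'(2,3) by blast
  qed
  finally show ?thesis .
qed

lemma decomposition_unique:
  assumes "u + m = v + m'" "lookup u x = 0" "lookup u y = 0" "lookup u n = 0"
    "lookup v x = 0" "lookup v y = 0" "lookup v n = 0"
    "m \<in> monomials {x, y, n}" "m' \<in> monomials {x, y, n}"
  shows "u = v" "m = m'"
proof -
  have *: "lookup u i + lookup m i = lookup v i + lookup m' i" for i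
    using assms(1) by (metis lookup_add)
  have "lookup u i = lookup v i" for i
  proof (cases "i \<in> {x, y, n}")
    case False
    then have "lookup m i = 0" "lookup m' i = 0"
      using assms(8,9) by (auto simp: monomials_def in_keys_iff)
    then show ?thesis using *[of i] by simp
  qed (use assms in auto)
  then show "u = v" by (rule poly_mapping_eqI)
  then show "m = m'" using assms(1) by simp
qed

lemma candidate_setC:
  assumes "v \<in> B0 n (weights a) (toric_ideal n a :: 'k::field mpol set)"
    and "v + pw y b \<in> B1' n (weights a) (toric_ideal n a :: 'k mpol set)"
  shows "candidate v (pw y b)"
proof -
  obtain u m where um: "v + pw y b = u + m" "candidate u m" using B1'_candidate[OF assms(2)] by blast
  have "v = u" "pw y b = m"
    using decomposition_unique[OF um(1)] assms(1) um(2) unfolding B0_iff candidate_def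
    by (auto simp: pw_in_monomials)
  then show ?thesis using um(2) by simp
qed

text \<open>If x divides m, the edge {x, n} is missing. Otherwise m is a power of y, with exponent 1
  because e is outside C, and {x, y} is missing.\<close>

lemma not_setC_no_edge:
  assumes "e \<in> B1' n (weights a) (toric_ideal n a :: 'k::field mpol set)"
    and "e \<notin> setC n (weights a) (toric_ideal n a :: 'k mpol set)"
  shows "\<not> (edge (sdeg a e) x y \<and> edge (sdeg a e) x n)"
proof -
  obtain u m where um: "e = u + m" "candidate u m" using B1'_candidate[OF assms(1)] by blast
  show ?thesis
  proof (cases "0 < lookup m x")
    case True
    then show ?thesis using no_edge_n[OF um(2)] um(1) by blast
  next
    case False
    then have my: "0 < lookup m y" using candidate_cases[OF um(2)] by simp
    have "lookup m i = lookup (pw y (lookup m y)) i" for i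
      using False candidate_lookup_n[OF um(2)] candidateD(9)[OF um(2), of i]
      by (auto simp: lookup_pw)
    then have m: "m = pw y (lookup m y)" by (rule poly_mapping_eqI)
    have "u \<in> B0 n (weights a) (toric_ideal n a :: 'k mpol set)"
      using um(2) unfolding B0_iff candidate_def by blast
    moreover have e: "e = u + pw y (lookup m y)" using um(1) m by simp
    moreover note assms(1)
    ultimately have "2 \<le> lookup m y \<Longrightarrow> e \<in> setC n (weights a) (toric_ideal n a :: 'k mpol set)"
      unfolding setC_def y[symmetric] by blast
    then have "\<not> 2 \<le> lookup m y" using assms(2) by blast
    then have "lookup m y = 1" using my by simp
    then show ?thesis using no_edge_yx[OF um(2)] False um(1) by simp
  qed
qed

text \<open>If y divided the normal form r, cancelling y would make r equal to the nonstandard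
  dividend. Since n is a vertex in this degree and r is maximal in \<open>x_n\<close>, the variable
  n divides r. The exponent k of x may be 0.\<close>

lemma remainder_shape:
  fixes G :: "'k::field mpol set"
  assumes gb: "is_reduced_gb n (weights a) (toric_ideal n a) G"
    and c: "candidate v (pw y b)" "1 \<le> b"
  obtains w k l where "w \<in> B0 n (weights a) (toric_ideal n a :: 'k mpol set)" "1 \<le> l"
    "is_remainder n (weights a) G (xpow (v + pw y b)) (xpow (w + pw x k + pw n l))"
proof -
  let ?e = "v + pw y b"
  have emon: "?e \<in> monomials {1..n}" using candidateD(3)[OF c(1)] .
  obtain r where r: "standard n a r" "sdeg a r = sdeg a ?e"
    using standard_exists[OF weights_pos emon] by blast
  have rmon: "r \<in> monomials {1..n}" using r(1) by (simp add: standard_def)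
  have my: "0 < lookup (pw y b) y" using c(2) by (simp add: lookup_pw)
  have ry: "lookup r y = 0"
  proof (rule ccontr)
    assume "lookup r y \<noteq> 0"
    obtain m' where m': "standard n a (v + m')" "?e = pw y 1 + (v + m')"
      using candidate_strip[OF c(1) my] by blast
    obtain r' where r': "r = pw y 1 + r'" "r' \<in> monomials {1..n}" "sdeg a r' = sdeg a (v + m')"
      using strip[OF rmon, of y "v + m'"] r(2) \<open>lookup r y \<noteq> 0\<close> unfolding m'(2) by auto
    have "standard n a (r' + pw y 1)" using r(1) unfolding r'(1) by (simp only: add.commute)
    then have "r' = v + m'" using standard_unique[OF standard_add m'(1)] r'(3) by blast
    then have "r = ?e" unfolding m'(2) r'(1) by simp
    then show False using r(1) candidateD(7)[OF c(1)] by blast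
  qed
  obtain k where k: "k \<le> n" "\<And>i. 0 < lookup (pw y b) i \<Longrightarrow> i < k" "face n a (sdeg a ?e) {k}"
    using candidate_larger_vertex[OF c(1)] by blast
  have "k = n" using k(1) k(2)[OF my] y by simp
  then obtain \<beta> where \<beta>: "\<beta> \<in> monomials {1..n}" "sdeg a \<beta> = sdeg a r" "0 < lookup \<beta> n"
    using k(3) r(2) unfolding face_def by auto
  have "lookup \<beta> n \<le> lookup r n" by (rule standard_max[OF r(1) \<beta>(1,2)]) simp
  then have rn: "1 \<le> lookup r n" using \<beta>(3) by simp
  \<comment> \<open>The part of r in the last three variables: y is absent by \<open>ry\<close>, so
    the cofactor w lies in \<open>B0\<close>.\<close>
  define p where "p = pw x (lookup r x) + pw n (lookup r n)"
  define w where "w = r - p"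
  have eq: "r = w + p"
    by (rule poly_mapping_eqI) (use xyn in \<open>auto simp: w_def p_def lookup_add lookup_minus lookup_pw\<close>)
  have "standard n a w" using r(1) standard_add unfolding eq by blast
  then have "w \<in> B0 n (weights a) (toric_ideal n a :: 'k mpol set)"
    unfolding B0_iff using ry xyn by (simp add: w_def p_def lookup_add lookup_minus lookup_pw)
  moreover have "is_remainder n (weights a) G (xpow ?e) (xpow r)"
    by (rule remainder_exists[OF weights_pos gb emon r])
  then have "is_remainder n (weights a) G (xpow ?e) (xpow (w + pw x (lookup r x) + pw n (lookup r n)))"
    using eq unfolding p_def by (simp add: add.assoc)
  ultimately show thesis using that rn by blast
qed

end

theorem theorem3p7:
  fixes n :: nat
    and a :: "nat \<Rightarrow> nat^3"
    and \<omega> :: "nat \<Rightarrow> nat"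
    and I G :: "'k::field mpol set"
    and B1 :: "expo set"
  assumes simplicial: "simplicial_generators n a"
    and I_def: "I = toric_ideal n a"
    and \<omega>_def: "\<omega> = weights a"
    and gb: "is_reduced_gb n \<omega> I G"
    and B1: "is_B1 n a \<omega> I B1"
  shows
    "(\<forall>v\<in>B0 n \<omega> I. \<forall>b\<ge>2. v + pw (n-1) b \<in> setC1 n \<omega> I G \<longrightarrow>
        (v + pw (n-1) b \<in> B1 \<longleftrightarrow>
         xpow (v + pw (n-1) (b-1)) \<notin> I <+>\<^bsub>Rr n\<^esub> Idl\<^bsub>Rr n\<^esub> {var (n-2)}))
     \<and>
     (\<forall>v\<in>B0 n \<omega> I. \<forall>b\<ge>2. v + pw (n-1) b \<in> setC2 n \<omega> I G \<longrightarrow>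
        (\<forall>w\<in>B0 n \<omega> I. \<forall>c\<ge>1.
           is_remainder n \<omega> G (xpow (v + pw (n-1) b)) (xpow (w + pw n c)) \<longrightarrow>
           (v + pw (n-1) b \<in> B1 \<longleftrightarrow>
            xpow (v + pw (n-1) (b-1)) \<notin> I <+>\<^bsub>Rr n\<^esub> Idl\<^bsub>Rr n\<^esub> {var (n-2)} \<or>
            xpow (w + pw n (c-1)) \<notin> I <+>\<^bsub>Rr n\<^esub> Idl\<^bsub>Rr n\<^esub> {var (n-2)})))
     \<and>
     B1 = (B1' n \<omega> I - setC n \<omega> I)
        \<union> {v + pw (n-1) b | v b. v \<in> B0 n \<omega> I \<and> 2 \<le> b \<and> v + pw (n-1) b \<in> setC1 n \<omega> I G \<and>
             xpow (v + pw (n-1) (b-1)) \<notin> I <+>\<^bsub>Rr n\<^esub> Idl\<^bsub>Rr n\<^esub> {var (n-2)}}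
        \<union> {v + pw (n-1) b | v b w c. v \<in> B0 n \<omega> I \<and> 2 \<le> b \<and> v + pw (n-1) b \<in> setC2 n \<omega> I G \<and>
             w \<in> B0 n \<omega> I \<and> 1 \<le> c \<and>
             is_remainder n \<omega> G (xpow (v + pw (n-1) b)) (xpow (w + pw n c)) \<and>
             (xpow (v + pw (n-1) (b-1)) \<notin> I <+>\<^bsub>Rr n\<^esub> Idl\<^bsub>Rr n\<^esub> {var (n-2)} \<or>
              xpow (w + pw n (c-1)) \<notin> I <+>\<^bsub>Rr n\<^esub> Idl\<^bsub>Rr n\<^esub> {var (n-2)})}"
proof -
  have n3: "3 \<le> n" and nz: "\<And>i. i \<in> {1..n} \<Longrightarrow> a i \<noteq> 0"
    using simplicial unfolding simplicial_generators_def by blast+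
  interpret S: simplicial_setup n a "n - 2" "n - 1"
    by (rule simplicial_setup.intro[OF n3 refl refl nz])
  let ?e = "\<lambda>v b. v + pw (n-1) b"
  let ?Q = "I <+>\<^bsub>Rr n\<^esub> Idl\<^bsub>Rr n\<^esub> {var (n-2)}"
  let ?xy = "\<lambda>e. S.edge (sdeg a e) (n-2) (n-1)"
  let ?xz = "\<lambda>e. S.edge (sdeg a e) (n-2) n"
  obtain sh g D where res: "is_minimal_graded_free_resolution n a I sh g D"
      "image_mset (sdeg a) (mset_set B1) = mset (sh 1)"
    and sub: "B1 \<subseteq> B1' n \<omega> I" and fin: "finite B1"
    using B1 unfolding is_B1_def by blast
  note unf = I_def \<omega>_def
  have mem: "e \<in> B1 \<longleftrightarrow> \<not> (?xy e \<and> ?xz e)" if "e \<in> B1' n \<omega> I" for e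
    using S.mem_B1_iff[OF res(1)[unfolded unf] sub[unfolded unf] fin res(2)] that unfolding unf by blast
  have mon: "v \<in> monomials {1..n}" if "v \<in> B0 n \<omega> I" for v
    using that unfolding unf S.B0_iff standard_def by blast
  have xy: "xpow (v + pw (n-1) (b-1)) \<in> ?Q \<longleftrightarrow> ?xy (?e v b)" if "v \<in> B0 n \<omega> I" "2 \<le> b" for v b
    unfolding unf
    by (rule S.xpow_plus_var_iff_edge[OF mon[OF that(1)] _ S.vars_in(2) S.xyn(5)]) (use that in simp)
  \<comment> \<open>The criterion gives an edge in the degree of the remainder, which is the degree
    of e.\<close>
  have xz: "xpow (w + pw n (c-1)) \<in> ?Q \<longleftrightarrow> ?xz e"
    if "w \<in> B0 n \<omega> I" "1 \<le> c" "is_remainder n \<omega> G (xpow e) (xpow (w + pw n c))" for w c e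
  proof -
    have "sdeg a (w + pw n c) = sdeg a e"
      using remainder_sdeg(2)[OF gb[unfolded unf(1)] that(3)] .
    moreover have "xpow (w + pw n (c-1)) \<in> ?Q \<longleftrightarrow> ?xz (w + pw n c)"
      unfolding unf
      by (rule S.xpow_plus_var_iff_edge[OF mon[OF that(1)] that(2) S.vars_in(3) S.xyn(7)])
    ultimately show ?thesis by simp
  qed
  \<comment> \<open>Here the remainder itself is divisible by x and z and realises the edge, so only
    {x, y} is left to test.\<close>
  have C1: "?xz e" if "e \<in> setC1 n \<omega> I G" for e
  proof -
    obtain k c w where r: "1 \<le> k" "1 \<le> c" "w \<in> B0 n \<omega> I"
      "is_remainder n \<omega> G (xpow e) (xpow (w + pw (n-2) k + pw n c))"
      using \<open>e \<in> setC1 n \<omega> I G\<close> unfolding setC1_def by blast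
    note d = remainder_sdeg[OF gb[unfolded unf(1)] r(4)]
    have "\<forall>i\<in>{n-2, n}. 0 < lookup (w + pw (n-2) k + pw n c) i"
      using r(1,2) by (simp add: lookup_add lookup_pw)
    then show ?thesis unfolding face_def using d by blast
  qed
  have C_sub: "setC n \<omega> I \<subseteq> B1' n \<omega> I" unfolding setC_def by blast
  have C1_sub: "setC1 n \<omega> I G \<subseteq> setC n \<omega> I" and C2_sub: "setC2 n \<omega> I G \<subseteq> setC n \<omega> I"
    unfolding setC1_def setC2_def by blast+
  have part1: "?e v b \<in> B1 \<longleftrightarrow> xpow (v + pw (n-1) (b-1)) \<notin> ?Q"
    if "v \<in> B0 n \<omega> I" "2 \<le> b" "?e v b \<in> setC1 n \<omega> I G" for v b
    using mem[of "?e v b"] xy[OF that(1,2)] C1[OF that(3)] that(3) C1_sub C_sub by blast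
  have part2: "?e v b \<in> B1 \<longleftrightarrow> xpow (v + pw (n-1) (b-1)) \<notin> ?Q \<or> xpow (w + pw n (c-1)) \<notin> ?Q"
    if "v \<in> B0 n \<omega> I" "2 \<le> b" "?e v b \<in> setC2 n \<omega> I G" "w \<in> B0 n \<omega> I" "1 \<le> c"
      "is_remainder n \<omega> G (xpow (?e v b)) (xpow (w + pw n c))" for v b w c
    using mem[of "?e v b"] xy[OF that(1,2)] xz[OF that(4,5,6)] that(3) C2_sub C_sub by blast
  have outside: "e \<in> B1" if "e \<in> B1' n \<omega> I" "e \<notin> setC n \<omega> I" for e
    using mem[OF that(1)] S.not_setC_no_edge that unfolding unf by blast
  \<comment> \<open>The decomposition of C: the exponent k of x in the remainder is positive for the
    first alternative and 0 for the second.\<close>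
  have cover: "e \<in> setC1 n \<omega> I G \<or>
      (\<exists>w\<in>B0 n \<omega> I. \<exists>c\<ge>1. e \<in> setC2 n \<omega> I G \<and> is_remainder n \<omega> G (xpow e) (xpow (w + pw n c)))"
    if e: "e \<in> setC n \<omega> I" for e
  proof -
    obtain v b where v: "e = ?e v b" "v \<in> B0 n \<omega> I" "2 \<le> b" "?e v b \<in> B1' n \<omega> I"
      using e unfolding setC_def by blast
    have "S.candidate v (pw (n-1) b)" using v(2,4) S.candidate_setC unfolding unf by blast
    moreover have "1 \<le> b" using v(3) by simp
    ultimately obtain w k l where w: "w \<in> B0 n \<omega> I" "1 \<le> l"
      "is_remainder n \<omega> G (xpow e) (xpow (w + pw (n-2) k + pw n l))"
      using S.remainder_shape[OF gb[unfolded unf]] unfolding unf v(1) by blast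
    show ?thesis
    proof (cases "k = 0")
      case True
      then have "pw (n-2) k = 0" by (simp add: pw_def)
      then have "is_remainder n \<omega> G (xpow e) (xpow (w + pw n l))" using w(3) by simp
      then show ?thesis using w(1,2) e unfolding setC2_def by blast
    next
      case False
      then have "1 \<le> k" by simp
      then show ?thesis using w e unfolding setC1_def by blast
    qed
  qed
  show ?thesis
  proof (intro conjI ballI allI impI)
    show "B1 = (B1' n \<omega> I - setC n \<omega> I)
        \<union> {?e v b | v b. v \<in> B0 n \<omega> I \<and> 2 \<le> b \<and> ?e v b \<in> setC1 n \<omega> I G \<and>
             xpow (v + pw (n-1) (b-1)) \<notin> ?Q}
        \<union> {?e v b | v b w c. v \<in> B0 n \<omega> I \<and> 2 \<le> b \<and> ?e v b \<in> setC2 n \<omega> I G \<and>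
             w \<in> B0 n \<omega> I \<and> 1 \<le> c \<and>
             is_remainder n \<omega> G (xpow (?e v b)) (xpow (w + pw n c)) \<and>
             (xpow (v + pw (n-1) (b-1)) \<notin> ?Q \<or> xpow (w + pw n (c-1)) \<notin> ?Q)}"
      (is "_ = ?X \<union> ?Y \<union> ?Z")
    proof
      show "?X \<union> ?Y \<union> ?Z \<subseteq> B1"
        using outside part1 part2 by blast
      show "B1 \<subseteq> ?X \<union> ?Y \<union> ?Z"
      proof
        fix e assume eB: "e \<in> B1"
        show "e \<in> ?X \<union> ?Y \<union> ?Z"
        proof (cases "e \<in> setC n \<omega> I")
          case True
          then obtain v b where v: "e = ?e v b" "v \<in> B0 n \<omega> I" "2 \<le> b"
            unfolding setC_def by blast
          from cover[OF True] show ?thesis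
          proof
            assume "e \<in> setC1 n \<omega> I G"
            then have "e \<in> ?Y" using part1[OF v(2,3)] v eB by blast
            then show ?thesis by blast
          next
            assume "\<exists>w\<in>B0 n \<omega> I. \<exists>c\<ge>1. e \<in> setC2 n \<omega> I G \<and> is_remainder n \<omega> G (xpow e) (xpow (w + pw n c))"
            then have "e \<in> ?Z" using part2[OF v(2,3)] v eB by blast
            then show ?thesis by blast
          qed
        next
          case False
          then show ?thesis using eB sub by blast
        qed
      qed
    qed
  qed (use part1 part2 in blast)+
qed

end
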